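(* The decision problem ARRIVAL is in $\mathrm{coNP}$.
   Context: A switch graph is a 4-tuple $G=(V,E,s_0,s_1)$ where $V$ is a finite vertex set, $n=|V|$, $s_0,s_1:V\to V$, and $E=\{(v,s_0(v)):v\in V\}\cup\{(v,s_1(v)):v\in V\}$ (loops allowed; possibly $s_0(v)=s_1(v)$). The procedure $\textsc{Run}(G,o,d)$: maintain arrays $\mathtt{s\_curr},\mathtt{s\_next}$ indexed by $V$, initially $\mathtt{s\_curr}[v]=s_0(v)$, $\mathtt{s\_next}[v]=s_1(v)$; set $v:=o$; while $v\neq d$: $w:=\mathtt{s\_curr}[v]$, swap $\mathtt{s\_curr}[v],\mathtt{s\_next}[v]$, $v:=w$ (traversing edge $(v,w)$). ARRIVAL is the decision problem: given a switch graph $G$ (encoded by the maps $s_0,s_1$) and $o,d\in V$, does $\textsc{Run}(G,o,d)$ terminate? *)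

theory Defs
  imports Main
begin

text \<open>Switch graphs with vertex set V = {0..<n}; s0, s1 are the successor maps.
  The state of Run is (v, s_curr, s_next).\<close>

definition run_step :: "(nat \<Rightarrow> nat) \<times> (nat \<Rightarrow> nat) \<times> nat \<Rightarrow> (nat \<Rightarrow> nat) \<times> (nat \<Rightarrow> nat) \<times> nat" where
  "run_step st = (case st of (cur, nxt, v) \<Rightarrow> (cur(v := nxt v), nxt(v := cur v), cur v))"

definition run_terminates :: "(nat \<Rightarrow> nat) \<Rightarrow> (nat \<Rightarrow> nat) \<Rightarrow> nat \<Rightarrow> nat \<Rightarrow> bool" where
  "run_terminates s0 s1 o' d \<longleftrightarrow> (\<exists>k. snd (snd ((run_step ^^ k) (s0, s1, o'))) = d)"

definition valid_instance :: "nat \<Rightarrow> (nat \<Rightarrow> nat) \<Rightarrow> (nat \<Rightarrow> nat) \<Rightarrow> nat \<Rightarrow> nat \<Rightarrow> bool" where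
  "valid_instance n s0 s1 o' d \<longleftrightarrow> 0 < n \<and> o' < n \<and> d < n \<and> (\<forall>v<n. s0 v < n \<and> s1 v < n)"

text \<open>Binary encoding: binary digits (least significant first), each bit doubled,
  terminated by the pair [True, False]; this is prefix-free.\<close>

fun bin :: "nat \<Rightarrow> bool list" where
  "bin n = (if n = 0 then [] else odd n # bin (n div 2))"

definition enc_nat :: "nat \<Rightarrow> bool list" where
  "enc_nat n = concat (map (\<lambda>b. [b, b]) (bin n)) @ [True, False]"

definition enc_instance :: "nat \<Rightarrow> (nat \<Rightarrow> nat) \<Rightarrow> (nat \<Rightarrow> nat) \<Rightarrow> nat \<Rightarrow> nat \<Rightarrow> bool list" where
  "enc_instance n s0 s1 o' d =
     enc_nat n @ enc_nat o' @ enc_nat d @ concat (map (\<lambda>v. enc_nat (s0 v) @ enc_nat (s1 v)) [0..<n])"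

definition ARRIVAL :: "bool list set" where
  "ARRIVAL = {w. \<exists>n s0 s1 o' d. valid_instance n s0 s1 o' d \<and> w = enc_instance n s0 s1 o' d
                                  \<and> run_terminates s0 s1 o' d}"

datatype dir = Lft | Rgt | Stay

text \<open>States 0..<tm_Q (start state 0, accepting state tm_acc, which halts);
  tape symbols 0..<tm_G, with 0 = blank, 1 = bit False, 2 = bit True, 3 = separator.\<close>

record tm =
  tm_Q :: nat
  tm_G :: nat
  tm_delta :: "nat \<Rightarrow> nat \<Rightarrow> nat \<times> nat \<times> dir"
  tm_acc :: nat

definition wf_tm :: "tm \<Rightarrow> bool" where
  "wf_tm M \<longleftrightarrow> 0 < tm_Q M \<and> tm_acc M < tm_Q M \<and> 4 \<le> tm_G M \<and>
     (\<forall>q<tm_Q M. \<forall>a<tm_G M. fst (tm_delta M q a) < tm_Q M \<and> fst (snd (tm_delta M q a)) < tm_G M)"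

type_synonym config = "nat \<times> (int \<Rightarrow> nat) \<times> int"

definition tm_step :: "tm \<Rightarrow> config \<Rightarrow> config" where
  "tm_step M c = (case c of (q, tp, h) \<Rightarrow>
     if q = tm_acc M then (q, tp, h)
     else (case tm_delta M q (tp h) of (q', a, d) \<Rightarrow>
       (q', tp(h := a), h + (case d of Lft \<Rightarrow> -1 | Rgt \<Rightarrow> 1 | Stay \<Rightarrow> 0))))"

definition tm_init :: "nat list \<Rightarrow> config" where
  "tm_init w = (0, (\<lambda>i. if 0 \<le> i \<and> nat i < length w then w ! nat i else 0), 0)"

definition accepts_within :: "tm \<Rightarrow> nat list \<Rightarrow> nat \<Rightarrow> bool" where
  "accepts_within M w t \<longleftrightarrow> fst ((tm_step M ^^ t) (tm_init w)) = tm_acc M"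

definition sym_of_bits :: "bool list \<Rightarrow> nat list" where
  "sym_of_bits xs = map (\<lambda>b. if b then 2 else 1) xs"

definition in_NP :: "bool list set \<Rightarrow> bool" where
  "in_NP L \<longleftrightarrow> (\<exists>M c k. wf_tm M \<and>
     (\<forall>x. x \<in> L \<longleftrightarrow> (\<exists>y. length y \<le> c * (length x + 1) ^ k \<and>
         accepts_within M (sym_of_bits x @ [3] @ sym_of_bits y) (c * (length x + 1) ^ k))))"

definition in_coNP :: "bool list set \<Rightarrow> bool" where
  "in_coNP L \<longleftrightarrow> in_NP (- L)"

end

theory Submission
  imports Defs
begin

text \<open>
  Give every vertex \<open>v\<close> a weight \<open>t v \<in> {0, 1, \<dots>, \<infinity>}\<close> such that the destination has weight \<open>0\<close> and
  every \<open>v\<close> satisfies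
  \<open>t v \<ge> [v = o] + (\<Sum>u. s0 u = v. \<lceil>t u / 2\<rceil>) + (\<Sum>u. s1 u = v. \<lfloor>t u / 2\<rfloor>)\<close>.
  The right-hand side is the number of arrivals at \<open>v\<close> if every \<open>u\<close> is left \<open>t u\<close> times, and it is monotone
  in \<open>t\<close>, so by induction on the time the run visits no vertex more than \<open>t v\<close> times and never visits the
  destination. Conversely, if the run does not terminate, then a vertex at distance \<open>l\<close> from the
  destination is visited less than \<open>2 ^ l\<close> times; taking the number of visits for these vertices and
  \<open>\<infinity>\<close> for the vertices that cannot reach the destination gives weights with at most \<open>n\<close> digits.

  To check such weights on a Turing machine we use nondeterministic regular programs over finitely many
  stacks. Bounding the iterations of each loop by a polynomial bounds their running time by a polynomial,
  and the choices made in a run serve as the certificate. The verifier guesses the weights, writes them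
  into a table indexed by the binary vertex numbers, and subtracts the contribution of every edge from
  the entry of its target. Inputs that do not encode an instance are accepted by separate branches.
\<close>

section \<open>Nondeterministic stack programs\<close>

text \<open>\<open>in_NP\<close> asks for a concrete one-tape machine, so every check has to be
  carried out symbol by symbol. Nondeterminism keeps this short: a failed test just yields no
  result, so head positions, digit widths and iteration counts are guessed and merely confirmed.
  Halving needs no arithmetic, as both halves are written from the same guessed digits, shifted by
  one place. Soundness is proved for every loop bound, because the machine does not count
  iterations; completeness needs one polynomial bound. Infinite weights are needed because a run
  that misses the destination may circle forever among vertices that cannot reach it. The visit
  counts at an arbitrary time are no certificate either, since the current position has one arrival
  more than departures. They are taken when the total number of visits to the vertices that can
  reach the destination is maximal; the run then stands outside that set. Invalid words need
  branches of their own because the complement of \<open>ARRIVAL\<close> is taken among all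
  words.\<close>

datatype sym = Dig bool | Hash | Start | Omega

text \<open>Roles in the main verifier: \<open>RX\<close> input, \<open>RN\<close> vertex count,
  \<open>RU\<close> vertex counter with scratch stack \<open>RV\<close>, \<open>RD\<close> index of
  the destination, \<open>RE0\<close> and \<open>RE1\<close> the queued edges of \<open>s0\<close>
  and \<open>s1\<close>, \<open>RL\<close> and \<open>RR\<close> the table left and right of a head.
  The branches for invalid words reuse \<open>RE0\<close> and \<open>RR\<close> to compare
  \<open>RN\<close> with \<open>RM\<close>.\<close>

datatype reg = RX | RZ | RN | RM | RU | RV | RD | RE0 | RE1 | RL | RR

text \<open>There are no conditionals: a test is a \<open>Pop\<close> of a prescribed symbol or an
  \<open>Emp\<close>, and a run that fails a test relates to no final state.\<close>

datatype com = Pop reg sym | Push reg sym | Emp reg | Seq com com (infixr ";;" 61) | Alt com com | Star com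

type_synonym stacks = "reg \<Rightarrow> sym list"

text \<open>The bound \<open>B\<close> limits the number of iterations of every single loop. It makes the
  running time polynomial in \<open>B\<close>, with the nesting depth of loops as the degree.\<close>

primrec rn :: "nat \<Rightarrow> com \<Rightarrow> stacks \<Rightarrow> stacks \<Rightarrow> bool" where
  "rn B (Pop i a) = (\<lambda>s s'. \<exists>r. s i = a # r \<and> s' = s(i := r))"
| "rn B (Push i a) = (\<lambda>s s'. s' = s(i := a # s i))"
| "rn B (Emp i) = (\<lambda>s s'. s i = [] \<and> s' = s)"
| "rn B (Seq c d) = rn B c OO rn B d"
| "rn B (Alt c d) = (\<lambda>s s'. rn B c s s' \<or> rn B d s s')"
| "rn B (Star c) = (\<lambda>s s'. \<exists>k\<le>B. (rn B c ^^ k) s s')"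

text \<open>Administrative steps are included: every \<open>Alt\<close> and every round of a
  \<open>Star\<close> spends a step on reading a choice, and leaving the loop spends one
  more.\<close>

primrec cost :: "nat \<Rightarrow> com \<Rightarrow> nat" where
  "cost B (Pop i a) = 1"
| "cost B (Push i a) = 1"
| "cost B (Emp i) = 1"
| "cost B (Seq c d) = 1 + cost B c + cost B d"
| "cost B (Alt c d) = 1 + cost B c + cost B d"
| "cost B (Star c) = 1 + B * (1 + cost B c)"

lemma relpowp_mono_nat:
  fixes P Q :: "'a \<Rightarrow> 'a \<Rightarrow> bool"
  assumes "\<And>x y. P x y \<Longrightarrow> Q x y" "(P ^^ k) x y"
  shows "(Q ^^ k) x y"
  using assms(2)
proof (induction k arbitrary: y)
  case (Suc k)
  then show ?case using assms(1) by auto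
qed simp

text \<open>Soundness proofs begin by enlarging \<open>B\<close> with this lemma, so that
  specifications valid only for \<open>B\<close> above certain lengths become applicable.\<close>

lemma rn_mono:
  assumes "B \<le> B'" "rn B c s s'"
  shows "rn B' c s s'"
  using assms(2)
proof (induction c arbitrary: s s')
  case (Star c)
  then show ?case using assms(1) relpowp_mono_nat[of "rn B c" "rn B' c"] by (auto intro: le_trans)
next
  case (Seq c d)
  then show ?case by (auto intro!: relcomppI)
qed auto

definition rns :: "nat \<Rightarrow> com list \<Rightarrow> stacks \<Rightarrow> stacks \<Rightarrow> bool" where
  "rns B K = foldr (\<lambda>c r. rn B c OO r) K (=)"

lemma rns_simps [simp]: "rns B [] = (=)" "rns B (c # K) = rn B c OO rns B K"
  by (simp_all add: rns_def)

lemma rns_mono: "B \<le> B' \<Longrightarrow> rns B K s s' \<Longrightarrow> rns B' K s s'"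
  by (induction K arbitrary: s) (auto dest: rn_mono)

section \<open>A deterministic machine with an explicit list of choices\<close>

type_synonym conf = "com list \<times> stacks \<times> bool list"

text \<open>All nondeterminism sits in the list of bits. \<open>None\<close> means stuck: a failed
  test, exhausted choices, or the empty continuation.\<close>

fun kstep :: "conf \<Rightarrow> conf option" where
  "kstep ([], s, y) = None"
| "kstep (Pop i a # K, s, y) =
     (case s i of [] \<Rightarrow> None | b # r \<Rightarrow> if a = b then Some (K, s(i := r), y) else None)"
| "kstep (Push i a # K, s, y) = Some (K, s(i := a # s i), y)"
| "kstep (Emp i # K, s, y) = (if s i = [] then Some (K, s, y) else None)"
| "kstep (Seq c d # K, s, y) = Some (c # d # K, s, y)"
| "kstep (Alt c d # K, s, y) =
     (case y of [] \<Rightarrow> None | b # y' \<Rightarrow> Some ((if b then c # K else d # K), s, y'))"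
| "kstep (Star c # K, s, y) =
     (case y of [] \<Rightarrow> None | b # y' \<Rightarrow> Some ((if b then c # Star c # K else K), s, y'))"

inductive ksteps :: "nat \<Rightarrow> conf \<Rightarrow> conf \<Rightarrow> bool" where
  ksteps_0: "ksteps 0 C C"
| ksteps_Suc: "kstep C = Some C' \<Longrightarrow> ksteps t C' C'' \<Longrightarrow> ksteps (Suc t) C C''"

lemma ksteps_1: "kstep C = Some C' \<Longrightarrow> ksteps 1 C C'"
  using ksteps_Suc[OF _ ksteps_0] by simp

lemma ksteps_trans: "ksteps t C C' \<Longrightarrow> ksteps t' C' C'' \<Longrightarrow> ksteps (t + t') C C''"
  by (induction rule: ksteps.induct) (auto intro: ksteps.intros)

text \<open>Read backwards, a step prepends at most one iteration to one loop of the continuation,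
  so one more unit of \<open>B\<close> suffices. Along an accepting run this produces some finite
  bound.\<close>

lemma kstep_rns:
  assumes "kstep (K, s, y) = Some (K', s1, y')" "rns B K' s1 s'"
  shows "rns (Suc B) K s s'"
proof (cases "(K, s, y)" rule: kstep.cases)
  case (7 c K0 s0 y0)
  then obtain b z where y: "y = b # z" using assms(1) by (cases y) auto
  show ?thesis
  proof (cases b)
    case True
    then have "rns B (c # Star c # K0) s s'" using assms 7 y by auto
    then obtain u v k where u: "rn B c s u" "(rn B c ^^ k) u v" "k \<le> B" "rns B K0 v s'" by auto
    then have "(rn B c ^^ Suc k) s v" by (metis relpowp_Suc_I2)
    then have "(rn (Suc B) c ^^ Suc k) s v"
      by (rule relpowp_mono_nat[rotated]) (auto intro: rn_mono[of B])
    then have "rn (Suc B) (Star c) s v" using u(3) by (auto simp del: relpowp.simps)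
    moreover have "rns (Suc B) K0 v s'" using u(4) by (rule rns_mono[rotated]) simp
    ultimately show ?thesis using 7 by (auto simp del: rn.simps)
  next
    case False
    then have "rns (Suc B) K0 s s'" using assms 7 y by (auto intro: rns_mono[of B])
    moreover have "rn (Suc B) (Star c) s s" by (auto intro: exI[of _ 0])
    ultimately show ?thesis using 7 by (auto simp del: rn.simps)
  qed
next
  case (6 c d K0 s0 y0)
  then have "rns (Suc B) K' s1 s'" using assms(2) by (auto intro: rns_mono[of B])
  then show ?thesis using 6 assms(1) by (auto split: list.splits if_splits)
next
  case (5 c d K0 s0 y0)
  then have "rns (Suc B) K' s1 s'" using assms(2) by (auto intro: rns_mono[of B])
  then show ?thesis using 5 assms(1) by (auto simp: relcompp_assoc)
next
  case (2 i a K0 s0 y0)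
  then have "rns (Suc B) K' s1 s'" using assms(2) by (auto intro: rns_mono[of B])
  then show ?thesis using 2 assms(1) by (auto split: list.splits if_splits)
next
  case (3 i a K0 s0 y0)
  then have "rns (Suc B) K' s1 s'" using assms(2) by (auto intro: rns_mono[of B])
  then show ?thesis using 3 assms(1) by auto
next
  case (4 i K0 s0 y0)
  then have "rns (Suc B) K' s1 s'" using assms(2) by (auto intro: rns_mono[of B])
  then show ?thesis using 4 assms(1) by (auto split: if_splits)
qed (use assms in auto)

text \<open>Uniformity in the continuation \<open>K\<close> and the unread choices \<open>z\<close>
  lets the choice lists of subprograms be concatenated. Each choice is consumed by a step of its
  own, hence \<open>length y \<le> t\<close>.\<close>

lemma rn_ksteps:
  assumes "rn B c s s'"
  shows "\<exists>t y. t \<le> cost B c \<and> length y \<le> t \<and> (\<forall>K z. ksteps t (c # K, s, y @ z) (K, s', z))"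
  using assms
proof (induction c arbitrary: s s')
  case (Pop i a)
  then show ?case by (intro exI[of _ 1] exI[of _ "[]"]) (auto intro!: ksteps_1[simplified])
next
  case (Push i a)
  then show ?case by (intro exI[of _ 1] exI[of _ "[]"]) (auto simp: fun_upd_def intro!: ksteps_1[simplified])
next
  case (Emp i)
  then show ?case by (intro exI[of _ 1] exI[of _ "[]"]) (auto intro!: ksteps_1[simplified])
next
  case (Seq c d)
  then obtain u where "rn B c s u" "rn B d u s'" by auto
  with Seq.IH obtain t y t' y' where
    1: "t \<le> cost B c" "length y \<le> t" "\<forall>K z. ksteps t (c # K, s, y @ z) (K, u, z)" and
    2: "t' \<le> cost B d" "length y' \<le> t'" "\<forall>K z. ksteps t' (d # K, u, y' @ z) (K, s', z)"
    by metis
  have "ksteps (Suc (t + t')) (Seq c d # K, s, (y @ y') @ z) (K, s', z)" for K z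
    using ksteps_trans[OF 1(3)[rule_format, of "d # K" "y' @ z"] 2(3)[rule_format, of K z]]
    by (intro ksteps_Suc[of _ "(c # d # K, s, y @ y' @ z)"]) simp_all
  then show ?case using 1 2 by (intro exI[of _ "Suc (t + t')"] exI[of _ "y @ y'"]) auto
next
  case (Alt c d)
  have *: ?case if asm: "rn B e s s'" "\<And>K z. kstep (Alt c d # K, s, b # z) = Some (e # K, s, z)"
    "cost B e \<le> cost B c + cost B d" "e \<in> {c, d}" for e b
  proof -
    have "e = c \<or> e = d" using asm(4) by simp
    then have "\<exists>t y. t \<le> cost B e \<and> length y \<le> t \<and> (\<forall>K z. ksteps t (e # K, s, y @ z) (K, s', z))"
      using Alt.IH[of s s'] asm(1) by (elim disjE) simp_all
    then obtain t y where 1: "t \<le> cost B e" "length y \<le> t" "\<forall>K z. ksteps t (e # K, s, y @ z) (K, s', z)"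
      by blast
    then have "ksteps (Suc t) (Alt c d # K, s, (b # y) @ z) (K, s', z)" for K z
      using asm(2) 1(3) by (intro ksteps_Suc[of _ "(e # K, s, y @ z)"]) simp_all
    then show ?thesis using 1 asm(3) by (intro exI[of _ "Suc t"] exI[of _ "b # y"]) auto
  qed
  show ?case using Alt.prems *[of c True] *[of d False] by auto
next
  case (Star c)
  then obtain k where k: "k \<le> B" "(rn B c ^^ k) s s'" by auto
  have "\<exists>t y. t \<le> 1 + k * (1 + cost B c) \<and> length y \<le> t \<and>
      (\<forall>K z. ksteps t (Star c # K, s, y @ z) (K, s', z))"
    using k(2)
  proof (induction k arbitrary: s)
    case 0
    then show ?case
      by (intro exI[of _ 1] exI[of _ "[False]"]) (auto intro!: ksteps_1[simplified])
  next
    case (Suc k)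
    then obtain u where u: "rn B c s u" "(rn B c ^^ k) u s'" by (metis relpowp_Suc_D2)
    obtain t y where 1: "t \<le> cost B c" "length y \<le> t" "\<forall>K z. ksteps t (c # K, s, y @ z) (K, u, z)"
      using Star.IH[OF u(1)] by auto
    obtain t' y' where 2: "t' \<le> 1 + k * (1 + cost B c)" "length y' \<le> t'"
      "\<forall>K z. ksteps t' (Star c # K, u, y' @ z) (K, s', z)"
      using Suc.IH[OF u(2)] by auto
    have "ksteps (Suc (t + t')) (Star c # K, s, (True # y @ y') @ z) (K, s', z)" for K z
      using ksteps_trans[OF 1(3)[rule_format, of "Star c # K" "y' @ z"] 2(3)[rule_format, of K z]]
      by (intro ksteps_Suc[of _ "(c # Star c # K, s, y @ y' @ z)"]) simp_all
    then show ?case using 1 2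
      by (intro exI[of _ "Suc (t + t')"] exI[of _ "True # y @ y'"]) auto
  qed
  then obtain t y where "t \<le> 1 + k * (1 + cost B c)" "length y \<le> t"
      "\<forall>K z. ksteps t (Star c # K, s, y @ z) (K, s', z)" by blast
  moreover have "1 + k * (1 + cost B c) \<le> cost B (Star c)"
    using mult_le_mono1[OF k(1), of "1 + cost B c"] by simp
  ultimately show ?case by (meson le_trans)
qed

text \<open>The control states: a finite superset of the continuations that occur while \<open>c\<close> runs
  in front of \<open>K\<close>.\<close>

primrec conts :: "com \<Rightarrow> com list \<Rightarrow> com list set" where
  "conts (Pop i a) K = {Pop i a # K, K}"
| "conts (Push i a) K = {Push i a # K, K}"
| "conts (Emp i) K = {Emp i # K, K}"
| "conts (Seq c d) K = insert (Seq c d # K) (conts c (d # K) \<union> conts d K)"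
| "conts (Alt c d) K = insert (Alt c d # K) (conts c K \<union> conts d K)"
| "conts (Star c) K = insert (Star c # K) (insert K (conts c (Star c # K)))"

fun succs :: "com list \<Rightarrow> com list set" where
  "succs [] = {}"
| "succs (Seq c d # K) = {c # d # K}"
| "succs (Alt c d # K) = {c # K, d # K}"
| "succs (Star c # K) = {c # Star c # K, K}"
| "succs (_ # K) = {K}"

lemma finite_conts: "finite (conts c K)"
  by (induction c arbitrary: K) auto

lemma conts_ends: "c # K \<in> conts c K" "K \<in> conts c K"
  by (induction c arbitrary: K) auto

text \<open>The end \<open>K\<close> is exempt because its successors belong to whatever follows
  \<open>c\<close>; for \<open>K = []\<close> there are none.\<close>

lemma conts_closed:
  assumes "L \<in> conts c K" "L \<noteq> K"
  shows "succs L \<subseteq> conts c K"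
  using assms
proof (induction c arbitrary: K L)
  case (Seq c d)
  then consider "L = Seq c d # K" | "L \<in> conts c (d # K)" "L \<noteq> d # K" | "L \<in> conts d K"
    using conts_ends(1)[of d K] by (cases "L = d # K") auto
  then show ?case
    by cases (use Seq conts_ends in \<open>simp_all add: subset_iff\<close>)
next
  case (Star c)
  then consider "L = Star c # K" | "L \<in> conts c (Star c # K)" "L \<noteq> Star c # K"
    by auto
  then show ?case
    by cases (use Star conts_ends in \<open>simp_all add: subset_iff\<close>)
next
  case (Alt c d)
  then consider "L = Alt c d # K" | "L \<in> conts c K" | "L \<in> conts d K"
    by auto
  then show ?case
    by cases (use Alt conts_ends in \<open>simp_all add: subset_iff\<close>)
qed auto

section \<open>Compilation to Turing machines\<close>

text \<open>One symbol carries an entry of every stack, so the stacks are parallel tracks of a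
  single tape and the alphabet stays finite.\<close>

datatype cell = Sep | Cell "reg \<Rightarrow> sym option"

text \<open>The continuation is a type parameter so that \<open>set_st\<close> yields the
  continuations stored in a state; finiteness of the control rests on this. \<open>Go\<close> states
  walk away from the home separator, \<open>Bk\<close> and \<open>Back\<close> states have turned
  round.\<close>

datatype 'k st = Init | At 'k | PushGo reg sym 'k | PopGo reg sym 'k | PopBk reg sym 'k
  | EmpGo reg 'k | Back 'k | ChGo 'k 'k | ChBk 'k | Rej

instance reg :: finite
proof
  have "UNIV = {RX, RZ, RN, RM, RU, RV, RD, RE0, RE1, RL, RR}"
    by (auto intro: reg.exhaust)
  then show "finite (UNIV :: reg set)" by (metis finite.emptyI finite.insertI)
qed

instance sym :: finite
proof
  have "x \<in> {Hash, Start, Omega} \<union> range Dig" for x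
    by (cases x) auto
  then have "UNIV = {Hash, Start, Omega} \<union> range Dig" by blast
  then show "finite (UNIV :: sym set)" by (metis finite finite.emptyI finite.insertI finite_UnI finite_imageI)
qed

instance cell :: finite
proof
  have "UNIV = insert Sep (range Cell)"
    by (auto intro: cell.exhaust)
  then show "finite (UNIV :: cell set)" by (metis finite finite.insertI finite_imageI)
qed

text \<open>A \<open>Pop\<close> overshoots to the first free cell of its track and tests the cell
  to the right of it; for an empty stack that cell is the separator, and the last clause rejects. A
  choice bit is overwritten by \<open>Sep\<close> when it is read, so the next choice is always the
  first non-separator to the right of the home cell.\<close>

fun delta :: "com list \<Rightarrow> com list st \<Rightarrow> cell \<Rightarrow> com list st \<times> cell \<times> dir" where
  "delta K0 Init Sep = (At K0, Sep, Stay)"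
| "delta K0 Init (Cell f) = (Init, Cell f, Rgt)"
| "delta K0 (At []) g = (At [], g, Stay)"
| "delta K0 (At (Pop i a # K)) g = (PopGo i a K, g, Lft)"
| "delta K0 (At (Push i a # K)) g = (PushGo i a K, g, Lft)"
| "delta K0 (At (Emp i # K)) g = (EmpGo i K, g, Lft)"
| "delta K0 (At (Seq c d # K)) g = (At (c # d # K), g, Stay)"
| "delta K0 (At (Alt c d # K)) g = (ChGo (c # K) (d # K), g, Rgt)"
| "delta K0 (At (Star c # K)) g = (ChGo (c # Star c # K) K, g, Rgt)"
| "delta K0 (PushGo i a K) (Cell f) =
     (if f i = None then (Back K, Cell (f(i := Some a)), Rgt) else (PushGo i a K, Cell f, Lft))"
| "delta K0 (PopGo i a K) (Cell f) =
     (if f i = None then (PopBk i a K, Cell f, Rgt) else (PopGo i a K, Cell f, Lft))"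
| "delta K0 (PopBk i a K) (Cell f) =
     (if f i = Some a then (Back K, Cell (f(i := None)), Rgt) else (Rej, Cell f, Stay))"
| "delta K0 (EmpGo i K) (Cell f) =
     (if f i = None then (Back K, Cell f, Rgt) else (Rej, Cell f, Stay))"
| "delta K0 (Back K) (Cell f) = (Back K, Cell f, Rgt)"
| "delta K0 (Back K) Sep = (At K, Sep, Stay)"
| "delta K0 (ChGo K L) Sep = (ChGo K L, Sep, Rgt)"
| "delta K0 (ChGo K L) (Cell f) =
     (if f RX = Some (Dig True) then (ChBk K, Sep, Lft)
      else if f RX = Some (Dig False) then (ChBk L, Sep, Lft) else (Rej, Cell f, Stay))"
| "delta K0 (ChBk K) Sep = (ChBk K, Sep, Lft)"
| "delta K0 (ChBk K) (Cell f) = (At K, Cell f, Rgt)"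
| "delta K0 _ g = (Rej, g, Stay)"

type_synonym gconf = "com list st \<times> (int \<Rightarrow> cell) \<times> int"

fun gstep :: "com list \<Rightarrow> gconf \<Rightarrow> gconf" where
  gstep_eq: "gstep K0 (q, tp, h) = (if q = At [] then (q, tp, h) else
     (case delta K0 q (tp h) of (q', g, d) \<Rightarrow>
       (q', tp(h := g), h + (case d of Lft \<Rightarrow> -1 | Rgt \<Rightarrow> 1 | Stay \<Rightarrow> 0))))"

declare gstep_eq [simp del]

text \<open>Choice bits look like input bits on the track of \<open>RX\<close>, since input and
  certificate are written with the same two tape symbols.\<close>

definition bitcell :: "bool \<Rightarrow> cell" where
  "bitcell b = Cell ((\<lambda>_. None)(RX := Some (Dig b)))"

definition blank :: cell where
  "blank = Cell (\<lambda>_. None)"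

text \<open>Every stack has its own track to the left of cell \<open>h\<close>, growing outwards. The cells
  \<open>h, \<dots>, h + p\<close> hold the separator and the \<open>p\<close> choice bits consumed so far, followed by the
  remaining choice bits \<open>y\<close>.\<close>

definition lay :: "int \<Rightarrow> stacks \<Rightarrow> nat \<Rightarrow> bool list \<Rightarrow> int \<Rightarrow> cell" where
  "lay h s p y z =
     (if z < h then Cell (\<lambda>i. if nat (h - 1 - z) < length (s i) then Some (rev (s i) ! nat (h - 1 - z)) else None)
      else if z \<le> h + int p then Sep
      else if nat (z - h - 1 - int p) < length y then bitcell (y ! nat (z - h - 1 - int p)) else blank)"

section \<open>Simulation of program steps by walks on the tape\<close>

lemma reach_trans: "(f ^^ m) C = C' \<Longrightarrow> (f ^^ n) C' = C'' \<Longrightarrow> (f ^^ (m + n)) C = C''"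
  by (simp add: funpow_add add.commute[of m n])

lemma reach_Suc: "f C = C' \<Longrightarrow> (f ^^ n) C' = C'' \<Longrightarrow> (f ^^ Suc n) C = C''"
  by (simp add: funpow_swap1)

lemma walk_left:
  assumes "\<And>j. j < n \<Longrightarrow> delta K0 q (tp (h - int j)) = (q, tp (h - int j), Lft)" "q \<noteq> At []"
  shows "(gstep K0 ^^ n) (q, tp, h) = (q, tp, h - int n)"
  using assms(1)
proof (induction n)
  case (Suc n)
  then show ?case using assms(2) by (simp add: gstep_eq)
qed simp

lemma walk_right:
  assumes "\<And>j. j < n \<Longrightarrow> delta K0 q (tp (h + int j)) = (q, tp (h + int j), Rgt)" "q \<noteq> At []"
  shows "(gstep K0 ^^ n) (q, tp, h) = (q, tp, h + int n)"
  using assms(1)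
proof (induction n)
  case (Suc n)
  then show ?case using assms(2) by (simp add: gstep_eq)
qed simp

lemma lay_track:
  "lay h s p y (h - 1 - int n) = Cell (\<lambda>i. if n < length (s i) then Some (rev (s i) ! n) else None)"
  by (auto simp: lay_def fun_eq_iff)

lemma lay_sep: "n \<le> p \<Longrightarrow> lay h s p y (h + int n) = Sep"
  by (simp add: lay_def)

lemma lay_choice:
  "lay h s p y (h + 1 + int p) = (case y of [] \<Rightarrow> blank | b # _ \<Rightarrow> bitcell b)"
  by (auto simp: lay_def split: list.splits)

lemma lay_choice_upd:
  "(lay h s p (b # y))(h + 1 + int p := Sep) = lay h s (Suc p) y"
proof
  fix z
  have "nat (z - h - 1 - int p) = Suc (nat (z - h - 1 - int (Suc p)))" if "z > h + 1 + int p"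
    using that by auto
  then show "((lay h s p (b # y))(h + 1 + int p := Sep)) z = lay h s (Suc p) y z"
    by (auto simp: lay_def)
qed

lemma lay_push:
  "(lay h s p y)(h - 1 - int (length (s i)) :=
     Cell ((\<lambda>k. if length (s i) < length (s k) then Some (rev (s k) ! length (s i)) else None)(i := Some a)))
   = lay h (s(i := a # s i)) p y" (is "?L = ?R")
proof
  fix z
  have "nat (h - 1 - z) = length (s i) \<longleftrightarrow> z = h - 1 - int (length (s i))" if "z < h"
    using that by auto
  then show "?L z = ?R z"
    by (auto simp: lay_def nth_append fun_eq_iff)
qed

lemma lay_pop:
  assumes "s i = a # r"
  shows "(lay h s p y)(h - 1 - int (length r) :=
     Cell ((\<lambda>k. if length r < length (s k) then Some (rev (s k) ! length r) else None)(i := None)))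
   = lay h (s(i := r)) p y" (is "?L = ?R")
proof
  fix z
  have "nat (h - 1 - z) = length r \<longleftrightarrow> z = h - 1 - int (length r)" if "z < h"
    using that by auto
  then show "?L z = ?R z"
    using assms by (auto simp: lay_def nth_append fun_eq_iff)
qed

lemma back_home:
  "(gstep K0 ^^ Suc n) (Back K, lay h s p y, h - int n) = (At K, lay h s p y, h)"
proof -
  have "(gstep K0 ^^ n) (Back K, lay h s p y, h - int n) = (Back K, lay h s p y, h - int n + int n)"
    by (rule walk_right) (auto simp: lay_def)
  moreover have "gstep K0 (Back K, lay h s p y, h) = (At K, lay h s p y, h)"
    using lay_sep[of 0 p h s y] by (auto simp: gstep_eq)
  ultimately show ?thesis by simp
qed

lemma push_sim:
  "(gstep K0 ^^ (2 * length (s i) + 3)) (At (Push i a # K), lay h s p y, h)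
    = (At K, lay h (s(i := a # s i)) p y, h)"
proof -
  let ?n = "length (s i)" and ?T = "lay h s p y" and ?T' = "lay h (s(i := a # s i)) p y"
  have 1: "gstep K0 (At (Push i a # K), ?T, h) = (PushGo i a K, ?T, h - 1)"
    by (simp add: gstep_eq)
  have 2: "(gstep K0 ^^ ?n) (PushGo i a K, ?T, h - 1) = (PushGo i a K, ?T, h - 1 - int ?n)"
    by (rule walk_left) (auto simp: lay_track)
  have 3: "gstep K0 (PushGo i a K, ?T, h - 1 - int ?n) = (Back K, ?T', h - int ?n)"
    using lay_push[of h s p y i a] by (simp add: gstep_eq lay_track)
  have "(gstep K0 ^^ (Suc (?n + Suc (Suc ?n)))) (At (Push i a # K), ?T, h) = (At K, ?T', h)"
    by (rule reach_Suc[of "gstep K0", OF 1 reach_trans[OF 2 reach_Suc[of "gstep K0", OF 3 back_home]]])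
  moreover have "Suc (?n + Suc (Suc ?n)) = 2 * ?n + 3" by simp
  ultimately show ?thesis by metis
qed

lemma popgo_sim:
  "(gstep K0 ^^ (length (s i) + 2)) (At (Pop i a # K), lay h s p y, h)
    = (PopBk i a K, lay h s p y, h - int (length (s i)))"
proof -
  let ?n = "length (s i)" and ?T = "lay h s p y"
  have 1: "gstep K0 (At (Pop i a # K), ?T, h) = (PopGo i a K, ?T, h - 1)"
    by (simp add: gstep_eq)
  have 2: "(gstep K0 ^^ ?n) (PopGo i a K, ?T, h - 1) = (PopGo i a K, ?T, h - 1 - int ?n)"
    by (rule walk_left) (auto simp: lay_track)
  have 3: "(gstep K0 ^^ 1) (PopGo i a K, ?T, h - 1 - int ?n) = (PopBk i a K, ?T, h - int ?n)"
    by (simp add: gstep_eq lay_track fun_upd_idem)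
  show ?thesis
    using reach_Suc[of "gstep K0", OF 1 reach_trans[OF 2 3]] by simp
qed

lemma pop_sim:
  assumes "s i = a # r"
  shows "(gstep K0 ^^ (2 * length (s i) + 3)) (At (Pop i a # K), lay h s p y, h)
    = (At K, lay h (s(i := r)) p y, h)"
proof -
  let ?n = "length (s i)" and ?T = "lay h s p y" and ?T' = "lay h (s(i := r)) p y"
  have n: "h - int ?n = h - 1 - int (length r)" using assms by simp
  have 1: "gstep K0 (PopBk i a K, ?T, h - int ?n) = (Back K, ?T', h - int (length r))"
    unfolding n using lay_pop[of s i a r h p y, OF assms] assms
    by (simp add: gstep_eq lay_track nth_append)
  have "(gstep K0 ^^ ((?n + 2) + Suc (Suc (length r)))) (At (Pop i a # K), ?T, h) = (At K, ?T', h)"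
    by (rule reach_trans[OF popgo_sim reach_Suc[of "gstep K0", OF 1 back_home]])
  moreover have "(?n + 2) + Suc (Suc (length r)) = 2 * ?n + 3" using assms by simp
  ultimately show ?thesis by metis
qed

lemma pop_rej:
  assumes "s i = [] \<or> hd (s i) \<noteq> a"
  shows "\<exists>m. fst ((gstep K0 ^^ m) (At (Pop i a # K), lay h s p y, h)) = Rej"
proof -
  let ?n = "length (s i)"
  have *: "fst (gstep K0 (PopBk i a K, lay h s p y, h - int ?n)) = Rej"
  proof (cases "s i")
    case Nil
    then show ?thesis using lay_sep[of 0 p h s y] by (simp add: gstep_eq)
  next
    case (Cons b r)
    then have n: "h - int ?n = h - 1 - int (length r)" by simp
    show ?thesis unfolding n using assms Cons by (simp add: gstep_eq lay_track nth_append)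
  qed
  have "(gstep K0 ^^ (?n + 2 + 1)) (At (Pop i a # K), lay h s p y, h)
     = gstep K0 (PopBk i a K, lay h s p y, h - int ?n)"
    by (rule reach_trans[OF popgo_sim]) simp
  then show ?thesis using * by metis
qed

lemma emp_sim:
  assumes "s i = []"
  shows "(gstep K0 ^^ 3) (At (Emp i # K), lay h s p y, h) = (At K, lay h s p y, h)"
proof -
  let ?T = "lay h s p y"
  have 1: "gstep K0 (At (Emp i # K), ?T, h) = (EmpGo i K, ?T, h - 1)"
    by (simp add: gstep_eq)
  have 2: "gstep K0 (EmpGo i K, ?T, h - 1) = (Back K, ?T, h)"
    using assms lay_track[of h s p y 0] by (simp add: gstep_eq fun_upd_idem)
  have "(gstep K0 ^^ Suc (Suc (Suc 0))) (At (Emp i # K), ?T, h) = (At K, ?T, h)"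
    by (rule reach_Suc[of "gstep K0", OF 1 reach_Suc[of "gstep K0", OF 2]])
      (use back_home[of 0 K0 K h s p y] in simp)
  then show ?thesis by (metis numeral_3_eq_3)
qed

lemma emp_rej:
  assumes "s i \<noteq> []"
  shows "\<exists>m. fst ((gstep K0 ^^ m) (At (Emp i # K), lay h s p y, h)) = Rej"
proof -
  let ?T = "lay h s p y"
  have 1: "gstep K0 (At (Emp i # K), ?T, h) = (EmpGo i K, ?T, h - 1)"
    by (simp add: gstep_eq)
  have 2: "fst (gstep K0 (EmpGo i K, ?T, h - 1)) = Rej"
    using assms lay_track[of h s p y 0] by (simp add: gstep_eq)
  show ?thesis using 1 2 by (intro exI[of _ "Suc (Suc 0)"]) simp
qed

lemma choice_go:
  "(gstep K0 ^^ p) (ChGo K L, lay h s p y, h + 1) = (ChGo K L, lay h s p y, h + 1 + int p)"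
proof (rule walk_right)
  fix j assume "j < p"
  then have "lay h s p y (h + 1 + int j) = Sep"
    using lay_sep[of "Suc j" p h s y] by (simp add: algebra_simps)
  then show "delta K0 (ChGo K L) (lay h s p y (h + 1 + int j))
      = (ChGo K L, lay h s p y (h + 1 + int j), Rgt)" by simp
qed simp

text \<open>The first step is a hypothesis, so that one lemma serves both \<open>Alt\<close> and
  \<open>Star\<close>. The count is one step out, \<open>p\<close> separators, the reading step,
  \<open>p + 1\<close> separators on the way back including the home cell, and one step onto the
  home cell from its left.\<close>

lemma choice_sim:
  assumes "gstep K0 (At M, lay h s p (b # y), h) = (ChGo K L, lay h s p (b # y), h + 1)"
  shows "(gstep K0 ^^ (2 * p + 4)) (At M, lay h s p (b # y), h)
    = (At (if b then K else L), lay h s (Suc p) y, h)"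
proof -
  let ?T = "lay h s p (b # y)" and ?T' = "lay h s (Suc p) y" and ?K = "if b then K else L"
  have 3: "gstep K0 (ChGo K L, ?T, h + 1 + int p) = (ChBk ?K, ?T', h + int p)"
    using lay_choice_upd[of h s p b y] by (auto simp: gstep_eq lay_choice bitcell_def)
  have 4: "(gstep K0 ^^ (Suc p)) (ChBk ?K, ?T', h + int p) = (ChBk ?K, ?T', h + int p - int (Suc p))"
  proof (rule walk_left)
    fix j assume "j < Suc p"
    then have "?T' (h + int p - int j) = Sep"
      using lay_sep[of "p - j" "Suc p" h s y] by (simp add: algebra_simps)
    then show "delta K0 (ChBk ?K) (?T' (h + int p - int j)) = (ChBk ?K, ?T' (h + int p - int j), Lft)"
      by (simp del: if_split)
  qed simp
  have 5: "(gstep K0 ^^ 1) (ChBk ?K, ?T', h + int p - int (Suc p)) = (At ?K, ?T', h)"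
    using lay_track[of h s "Suc p" y 0] by (simp add: gstep_eq fun_upd_idem)
  have "(gstep K0 ^^ (Suc (p + Suc (Suc p + 1)))) (At M, ?T, h) = (At ?K, ?T', h)"
    by (rule reach_Suc[of "gstep K0", OF assms reach_trans[OF choice_go
          reach_Suc[of "gstep K0", OF 3 reach_trans[OF 4 5]]]])
  moreover have "Suc (p + Suc (Suc p + 1)) = 2 * p + 4" by simp
  ultimately show ?thesis by metis
qed

lemma choice_rej:
  assumes "gstep K0 (At M, lay h s p [], h) = (ChGo K L, lay h s p [], h + 1)"
  shows "\<exists>m. fst ((gstep K0 ^^ m) (At M, lay h s p [], h)) = Rej"
proof -
  have "fst (gstep K0 (ChGo K L, lay h s p [], h + 1 + int p)) = Rej"
    by (simp add: gstep_eq lay_choice blank_def)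
  moreover have "(gstep K0 ^^ (Suc p)) (At M, lay h s p [], h) = (ChGo K L, lay h s p [], h + 1 + int p)"
    by (rule reach_Suc[of "gstep K0", OF assms choice_go])
  ultimately have "fst ((gstep K0 ^^ (Suc (Suc p))) (At M, lay h s p [], h)) = Rej"
    by simp
  then show ?thesis by blast
qed

lemma gstep_alt:
  "gstep K0 (At (Alt c d # K), lay h s p y, h) = (ChGo (c # K) (d # K), lay h s p y, h + 1)"
  "gstep K0 (At (Star c # K), lay h s p y, h) = (ChGo (c # Star c # K) K, lay h s p y, h + 1)"
  "gstep K0 (At (Seq c d # K), lay h s p y, h) = (At (c # d # K), lay h s p y, h)"
  by (simp_all add: gstep_eq)

text \<open>\<open>N\<close> bounds the stack heights and the block of used choices, the two
  distances the head may have to cover. \<open>0 < m\<close> drives the induction in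
  \<open>gstep_sound\<close>.\<close>

lemma kstep_sim:
  assumes "kstep (K, s, y) = Some (K', s', y')" "\<And>i. length (s i) \<le> N" "p \<le> N"
  shows "\<exists>m p'. 0 < m \<and> m \<le> 2 * N + 4 \<and> p' \<le> Suc p \<and>
    (gstep K0 ^^ m) (At K, lay h s p y, h) = (At K', lay h s' p' y', h)"
proof (cases "(K, s, y)" rule: kstep.cases)
  case (2 i a K0' s0 y0)
  then obtain r where r: "s i = a # r" "K' = K0'" "s' = s(i := r)" "y' = y"
    using assms(1) by (auto split: list.splits if_splits)
  show ?thesis
    using pop_sim[of s i a r K0 K0' h p y, OF r(1)] r 2 assms(2)[of i]
    by (intro exI[of _ "2 * length (s i) + 3"] exI[of _ p]) simp
next
  case (3 i a K0' s0 y0)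
  then show ?thesis
    using push_sim[of s i K0 a K0' h p y] assms(1) assms(2)[of i]
    by (intro exI[of _ "2 * length (s i) + 3"] exI[of _ p]) simp
next
  case (4 i K0' s0 y0)
  then have "s i = []" using assms(1) by (auto split: if_splits)
  then show ?thesis
    using emp_sim[of s i K0 K0' h p y] 4 assms(1)
    by (intro exI[of _ 3] exI[of _ p]) simp
next
  case (5 c d K0' s0 y0)
  then show ?thesis using assms(1) gstep_alt(3)
    by (intro exI[of _ 1] exI[of _ p]) simp
next
  case (6 c d K0' s0 y0)
  then obtain b z where "y = b # z" using assms(1) by (auto split: list.splits)
  moreover have "(gstep K0 ^^ (2 * p + 4)) (At (Alt c d # K0'), lay h s p (b # z), h)
      = (At (if b then c # K0' else d # K0'), lay h s (Suc p) z, h)"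
    by (rule choice_sim[OF gstep_alt(1)])
  ultimately show ?thesis using 6 assms(1,3)
    by (intro exI[of _ "2 * p + 4"] exI[of _ "Suc p"]) auto
next
  case (7 c K0' s0 y0)
  then obtain b z where "y = b # z" using assms(1) by (auto split: list.splits)
  moreover have "(gstep K0 ^^ (2 * p + 4)) (At (Star c # K0'), lay h s p (b # z), h)
      = (At (if b then c # Star c # K0' else K0'), lay h s (Suc p) z, h)"
    by (rule choice_sim[OF gstep_alt(2)])
  ultimately show ?thesis using 7 assms(1,3)
    by (intro exI[of _ "2 * p + 4"] exI[of _ "Suc p"]) auto
qed (use assms(1) in simp)

lemma kstep_rej:
  assumes "kstep (K, s, y) = None" "K \<noteq> []"
  shows "\<exists>m. fst ((gstep K0 ^^ m) (At K, lay h s p y, h)) = Rej"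
proof (cases "(K, s, y)" rule: kstep.cases)
  case (2 i a K0' s0 y0)
  then show ?thesis using assms(1) pop_rej[of s i a K0 K0' h p y] by (auto split: list.splits if_splits)
next
  case (4 i K0' s0 y0)
  then show ?thesis using assms(1) emp_rej[of s i K0 K0' h p y] by (auto split: if_splits)
next
  case (6 c d K0' s0 y0)
  then show ?thesis using assms(1) choice_rej[OF gstep_alt(1)] by (auto split: list.splits)
next
  case (7 c K0' s0 y0)
  then show ?thesis using assms(1) choice_rej[OF gstep_alt(2)] by (auto split: list.splits)
qed (use assms in auto)

lemma acc_stays: "fst C = At [] \<Longrightarrow> (gstep K0 ^^ m) C = C"
  by (induction m; cases C) (auto simp: gstep_eq)

lemma rej_stays: "fst C = Rej \<Longrightarrow> fst ((gstep K0 ^^ m) C) = Rej"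
proof (induction m)
  case (Suc m)
  then show ?case by (cases "(gstep K0 ^^ m) C") (auto simp: gstep_eq)
qed simp

text \<open>Complete induction on the running time, cutting off the walk that simulates one program
  step.\<close>

lemma gstep_sound:
  assumes "fst ((gstep K0 ^^ t) (At K, lay h s p y, h)) = At []"
  shows "\<exists>B s'. rns B K s s'"
  using assms
proof (induction t arbitrary: K s p y rule: less_induct)
  case (less t)
  let ?C = "(At K, lay h s p y, h)"
  show ?case
  proof (cases "K = []")
    case False
    show ?thesis
    proof (cases "kstep (K, s, y)")
      case None
      then obtain m where m: "fst ((gstep K0 ^^ m) ?C) = Rej" using kstep_rej False by blast
      \<comment> \<open>\<open>Rej\<close> and \<open>At []\<close> are both absorbing, so reaching
        each of them once is contradictory at time \<open>t + m\<close>.\<close>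
      have "fst ((gstep K0 ^^ (t + m)) ?C) = Rej"
        unfolding funpow_add comp_def using rej_stays[OF m] by simp
      moreover have "fst ((gstep K0 ^^ (m + t)) ?C) = At []"
        unfolding funpow_add comp_def using acc_stays[OF less.prems] less.prems by simp
      ultimately show ?thesis by (simp add: add.commute)
    next
      case (Some C')
      obtain K' s' y' where C': "C' = (K', s', y')" by (cases C')
      define N where "N = Max (range (\<lambda>i. length (s i))) + p"
      have "length (s i) \<le> N" for i unfolding N_def by (intro trans_le_add1 Max_ge) auto
      moreover have "p \<le> N" by (simp add: N_def)
      ultimately obtain m p' where m: "0 < m" "(gstep K0 ^^ m) ?C = (At K', lay h s' p' y', h)"
        using kstep_sim[of K s y K' s' y' N p K0 h] Some C' by blast
      have "\<exists>B s''. rns B K' s' s''"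
      proof (cases "m \<le> t")
        case True
        then have "(gstep K0 ^^ (t - m)) (At K', lay h s' p' y', h) = (gstep K0 ^^ t) ?C"
          using reach_trans[OF m(2), of "t - m"] by simp
        then show ?thesis using less.IH[of "t - m" K' s' p' y'] less.prems m(1) True by simp
      next
        case False
        \<comment> \<open>If acceptance falls inside the walk, the configuration is frozen from then
          on, so the end of the walk is itself accepting and \<open>K'\<close> is empty.\<close>
        have "(gstep K0 ^^ m) ?C = (gstep K0 ^^ (m - t)) ((gstep K0 ^^ t) ?C)"
          using False by (metis comp_apply funpow_add le_add_diff_inverse2 nat_le_linear)
        then have "(gstep K0 ^^ t) ?C = (At K', lay h s' p' y', h)"
          using acc_stays[OF less.prems] m(2) by metis
        then have "K' = []" using less.prems by simp
        then show ?thesis by auto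
      qed
      then show ?thesis using kstep_rns Some C' by blast
    qed
  qed auto
qed

lemma kstep_length:
  assumes "kstep (K, s, y) = Some (K', s', y')" "\<And>i. length (s i) \<le> N"
  shows "length (s' i) \<le> Suc N"
proof -
  have "length (s' i) \<le> Suc (length (s i))"
    by (cases "(K, s, y)" rule: kstep.cases)
      (use assms(1) in \<open>auto split: list.splits if_splits\<close>)
  then show ?thesis using assms(2)[of i] by simp
qed

text \<open>A program step lengthens a stack or the block of used choices by at most one; the slack
  \<open>T\<close> in the hypotheses keeps \<open>N\<close> valid throughout the run.\<close>

lemma gstep_complete:
  assumes "ksteps T (K, s, y) (K', s', y')" "\<And>i. length (s i) + T \<le> N" "p + T \<le> N"
  shows "\<exists>m p'. m \<le> T * (2 * N + 4) \<and>
    (gstep K0 ^^ m) (At K, lay h s p y, h) = (At K', lay h s' p' y', h)"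
  using assms
proof (induction T "(K, s, y)" "(K', s', y')" arbitrary: K s y p rule: ksteps.induct)
  case ksteps_0
  then show ?case by (intro exI[of _ 0] exI[of _ p]) auto
next
  case (ksteps_Suc C1 t K s y)
  obtain K1 s1 y1 where C1: "C1 = (K1, s1, y1)" by (cases C1)
  have l: "length (s i) \<le> N - Suc t" for i using ksteps_Suc.prems(1)[of i] by simp
  have "length (s i) \<le> N" for i using l[of i] by simp
  moreover have "p \<le> N" using ksteps_Suc.prems(2) by simp
  ultimately obtain m p1 where 1: "m \<le> 2 * N + 4" "p1 \<le> Suc p"
    "(gstep K0 ^^ m) (At K, lay h s p y, h) = (At K1, lay h s1 p1 y1, h)"
    using kstep_sim[of K s y K1 s1 y1 N p K0 h] ksteps_Suc.hyps(1) C1 by blast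
  have "length (s1 i) + t \<le> N" for i
    using kstep_length[of K s y K1 s1 y1 "N - Suc t" i] ksteps_Suc.hyps(1) C1 l ksteps_Suc.prems(2)
    by simp
  moreover have "p1 + t \<le> N" using 1(2) ksteps_Suc.prems(2) by simp
  ultimately obtain m' p' where 2: "m' \<le> t * (2 * N + 4)"
    "(gstep K0 ^^ m') (At K1, lay h s1 p1 y1, h) = (At K', lay h s' p' y', h)"
    using ksteps_Suc.hyps(3)[OF C1] by blast
  show ?case using reach_trans[OF 1(3) 2(2)] 1(1) 2(1)
    by (intro exI[of _ "m + m'"] exI[of _ p']) simp
qed

section \<open>Finite control, and the numbering of states and symbols\<close>

definition inp :: "bool list \<Rightarrow> stacks" where
  "inp x = (\<lambda>_. [])(RX := map Dig x)"

text \<open>Possibly larger than the set of reachable states, but finite and closed under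
  \<open>delta\<close>.\<close>

definition statesof :: "com \<Rightarrow> com list st set" where
  "statesof c = {q. set_st q \<subseteq> conts c []}"

lemma finite_statesof: "finite (statesof c)"
proof -
  let ?K = "conts c []"
  let ?A = "{Init, Rej} \<union> At ` ?K \<union> Back ` ?K \<union> ChBk ` ?K \<union> (\<Union>i. EmpGo i ` ?K) \<union> (\<Union>K\<in>?K. ChGo K ` ?K)
     \<union> (\<Union>i a. PushGo i a ` ?K) \<union> (\<Union>i a. PopGo i a ` ?K) \<union> (\<Union>i a. PopBk i a ` ?K)"
  have "statesof c \<subseteq> ?A"
  proof
    fix q assume "q \<in> statesof c"
    then have "set_st q \<subseteq> ?K" by (simp add: statesof_def)
    then show "q \<in> ?A" by (cases q) (simp_all add: image_iff)
  qed
  then show ?thesis by (rule finite_subset) (simp add: finite_conts)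
qed

lemma delta_statesof:
  assumes "q \<in> statesof c"
  shows "fst (delta [c] q g) \<in> statesof c"
proof -
  let ?S = "conts c []"
  have cl: "x \<in> ?S" if "K \<in> ?S" "x \<in> succs K" for K x
    using conts_closed[of K c "[]"] that by (cases "K = []") auto
  have S: "[c] \<in> ?S" "[] \<in> ?S" "\<And>i a K. Pop i a # K \<in> ?S \<Longrightarrow> K \<in> ?S"
    "\<And>i a K. Push i a # K \<in> ?S \<Longrightarrow> K \<in> ?S" "\<And>i K. Emp i # K \<in> ?S \<Longrightarrow> K \<in> ?S"
    "\<And>d e K. Seq d e # K \<in> ?S \<Longrightarrow> d # e # K \<in> ?S"
    "\<And>d e K. Alt d e # K \<in> ?S \<Longrightarrow> d # K \<in> ?S"
    "\<And>d e K. Alt d e # K \<in> ?S \<Longrightarrow> e # K \<in> ?S"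
    "\<And>d K. Star d # K \<in> ?S \<Longrightarrow> d # Star d # K \<in> ?S"
    "\<And>d K. Star d # K \<in> ?S \<Longrightarrow> K \<in> ?S"
    by (rule conts_ends | rule cl, assumption, simp)+
  show ?thesis
    using assms unfolding statesof_def
    by (cases "([c], q, g)" rule: delta.cases) (auto simp: S(1,2) dest: S(3-) split: if_splits)
qed

text \<open>A \<open>tm\<close> prescribes state 0 as the start and symbols 0 to 3 for the blank,
  the bits and the separator, so the numbering must take given values on an initial list.\<close>

lemma exists_numbering:
  assumes "finite A" "distinct xs" "set xs \<subseteq> A"
  shows "\<exists>e. bij_betw e A {..<card A} \<and> (\<forall>i<length xs. e (xs ! i) = i)"
proof -
  obtain ys where ys: "set ys = A - set xs" "distinct ys"
    using assms(1) finite_distinct_list by (metis finite_Diff)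
  let ?zs = "xs @ ys"
  have zs: "distinct ?zs" "set ?zs = A" "length ?zs = card A"
    using ys assms by auto (metis Diff_partition distinct_append distinct_card inf.commute Diff_disjoint length_append set_append)
  let ?e = "the_inv_into {..<length ?zs} ((!) ?zs)"
  have b: "bij_betw ((!) ?zs) {..<length ?zs} (set ?zs)"
    using bij_betw_nth[OF zs(1) refl refl] .
  have "bij_betw ?e A {..<card A}"
    using bij_betw_the_inv_into[OF b] zs by simp
  moreover have "?e (xs ! i) = i" if "i < length xs" for i
    using the_inv_into_f_f[OF bij_betw_imp_inj_on[OF b], of i] that by (simp add: nth_append)
  ultimately show ?thesis by blast
qed

lemma gstep_scan:
  assumes "length x = h" 
  shows "(gstep [c] ^^ Suc h) (Init, lay (int h) (inp x) 0 y, 0) = (At [c], lay (int h) (inp x) 0 y, int h)"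
proof -
  have "(gstep [c] ^^ h) (Init, lay (int h) (inp x) 0 y, 0) = (Init, lay (int h) (inp x) 0 y, 0 + int h)"
    by (rule walk_right) (auto simp: lay_def)
  then show ?thesis using lay_sep[of 0 0 "int h" "inp x" y] by (simp add: gstep_eq fun_upd_idem)
qed

lemma acc_mono:
  assumes "fst ((gstep K0 ^^ m) C) = At []" "m \<le> t"
  shows "fst ((gstep K0 ^^ t) C) = At []"
proof -
  obtain n where "t = n + m" using assms(2) by (metis le_add_diff_inverse2)
  then have "(gstep K0 ^^ t) C = (gstep K0 ^^ n) ((gstep K0 ^^ m) C)" by (simp add: funpow_add)
  then show ?thesis using acc_stays[OF assms(1)] assms(1) by simp
qed

lemma rn_accepts:
  fixes x :: "bool list" and h T :: nat and B :: nat and c :: com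
  defines "h \<equiv> length x" and "T \<equiv> cost B c"
  assumes "rn B c (inp x) s'"
  shows "\<exists>y. length y \<le> T \<and>
    fst ((gstep [c] ^^ (h + 1 + T * (2 * (h + T) + 4))) (Init, lay (int h) (inp x) 0 y, 0)) = At []"
proof -
  obtain t y where t: "t \<le> T" "length y \<le> t" and
    *: "\<forall>K z. ksteps t (c # K, inp x, y @ z) (K, s', z)" using rn_ksteps[OF assms(3)] T_def by blast
  have ks: "ksteps t ([c], inp x, y) ([], s', [])" using *[rule_format, of "[]" "[]"] by simp
  have "length (inp x i) + t \<le> h + t" for i by (simp add: inp_def h_def)
  moreover have "0 + t \<le> h + t" by simp
  ultimately obtain m p' where m: "m \<le> t * (2 * (h + t) + 4)"
    "(gstep [c] ^^ m) (At [c], lay (int h) (inp x) 0 y, int h) = (At [], lay (int h) s' p' [], int h)"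
    using gstep_complete[OF ks] by blast
  have scan: "(gstep [c] ^^ Suc h) (Init, lay (int h) (inp x) 0 y, 0) = (At [c], lay (int h) (inp x) 0 y, int h)"
    by (rule gstep_scan) (simp add: h_def)
  have "fst ((gstep [c] ^^ (Suc h + m)) (Init, lay (int h) (inp x) 0 y, 0)) = At []"
    using reach_trans[OF scan m(2)] by simp
  moreover have "t * (2 * (h + t) + 4) \<le> T * (2 * (h + T) + 4)"
    using t(1) by (intro mult_le_mono) auto
  then have "Suc h + m \<le> h + 1 + T * (2 * (h + T) + 4)" using m(1) by simp
  ultimately show ?thesis using t acc_mono le_trans by blast
qed

section \<open>Polynomially bounded functions\<close>

definition poly_bounded :: "(nat \<Rightarrow> nat) \<Rightarrow> bool" where
  "poly_bounded f \<longleftrightarrow> (\<exists>c k. \<forall>m. f m \<le> c * (m + 1) ^ k)"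

lemma poly_bounded_const: "poly_bounded (\<lambda>_. a)"
  unfolding poly_bounded_def by (rule exI[of _ a], rule exI[of _ 0]) simp

lemma poly_bounded_id: "poly_bounded (\<lambda>m. m)"
  unfolding poly_bounded_def by (rule exI[of _ 1], rule exI[of _ 1]) simp

lemma poly_bounded_add:
  assumes "poly_bounded f" "poly_bounded g"
  shows "poly_bounded (\<lambda>m. f m + g m)"
proof -
  obtain c k c' k' where f: "\<And>m. f m \<le> c * (m + 1) ^ k" and g: "\<And>m. g m \<le> c' * (m + 1) ^ k'"
    using assms unfolding poly_bounded_def by metis
  have "f m + g m \<le> (c + c') * (m + 1) ^ (k + k')" for m
  proof -
    have "c * (m + 1) ^ k \<le> c * (m + 1) ^ (k + k')" "c' * (m + 1) ^ k' \<le> c' * (m + 1) ^ (k + k')"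
      by (auto intro!: mult_le_mono2 power_increasing)
    then show ?thesis unfolding add_mult_distrib using f[of m] g[of m] by linarith
  qed
  then show ?thesis unfolding poly_bounded_def by blast
qed

lemma poly_bounded_mult:
  assumes "poly_bounded f" "poly_bounded g"
  shows "poly_bounded (\<lambda>m. f m * g m)"
proof -
  obtain c k c' k' where f: "\<And>m. f m \<le> c * (m + 1) ^ k" and g: "\<And>m. g m \<le> c' * (m + 1) ^ k'"
    using assms unfolding poly_bounded_def by metis
  have "f m * g m \<le> (c * c') * (m + 1) ^ (k + k')" for m
    using mult_le_mono[OF f[of m] g[of m]] by (simp add: power_add algebra_simps)
  then show ?thesis unfolding poly_bounded_def by blast
qed

lemma poly_bounded_Suc: "poly_bounded f \<Longrightarrow> poly_bounded (\<lambda>m. Suc (f m))"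
  using poly_bounded_add[OF poly_bounded_const[of 1]] by simp

lemmas poly_bounded_intros =
  poly_bounded_const poly_bounded_id poly_bounded_add poly_bounded_mult poly_bounded_Suc

text \<open>The program \<open>c\<close> is fixed, so the nesting depth of its loops, which governs
  the degree, is a constant.\<close>

lemma poly_bounded_cost: "poly_bounded P \<Longrightarrow> poly_bounded (\<lambda>m. cost (P m) c)"
  by (induction c) (simp_all add: poly_bounded_intros)

text \<open>Soundness is demanded for every \<open>B\<close>, because an accepting run of the
  machine only yields some bound on its loops.\<close>

theorem in_NP_if_program:
  assumes P: "poly_bounded P"
    and sound: "\<And>x B s'. rn B c (inp x) s' \<Longrightarrow> x \<in> L"
    and complete: "\<And>x. x \<in> L \<Longrightarrow> \<exists>s'. rn (P (length x)) c (inp x) s'"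
  shows "in_NP L"
proof -
  let ?Q = "statesof c"
  have "distinct [Init :: com list st]" "set [Init] \<subseteq> ?Q" by (auto simp: statesof_def)
  from exists_numbering[OF finite_statesof this] obtain f where
    f: "bij_betw f ?Q {..<card ?Q}" "f Init = 0" by auto
  have "distinct [blank, bitcell False, bitcell True, Sep]"
    by (auto simp: blank_def bitcell_def fun_eq_iff)
  from exists_numbering[OF finite this subset_UNIV] obtain e where
    e: "bij_betw e UNIV {..<card (UNIV :: cell set)}" and
    e': "\<forall>i<4. e ([blank, bitcell False, bitcell True, Sep] ! i) = i" by auto
  have es: "e blank = 0" "e (bitcell False) = 1" "e (bitcell True) = 2" "e Sep = 3"
    using e'[rule_format, of 0] e'[rule_format, of 1] e'[rule_format, of 2] e'[rule_format, of 3] by auto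
  define fi where "fi = the_inv_into ?Q f"
  define ei where "ei = the_inv_into UNIV e"
  have fi: "fi (f q) = q" if "q \<in> ?Q" for q
    using f(1) that unfolding fi_def by (intro the_inv_into_f_f) (auto simp: bij_betw_def)
  have fi': "fi i \<in> ?Q" if "i < card ?Q" for i
    using f(1) that unfolding fi_def by (intro the_inv_into_into) (auto simp: bij_betw_def)
  have ei: "ei (e g) = g" for g
    using e unfolding ei_def by (intro the_inv_into_f_f) (auto simp: bij_betw_def)
  have flt: "f q < card ?Q" if "q \<in> ?Q" for q using f(1) that by (auto simp: bij_betw_def)
  have elt: "e g < card (UNIV :: cell set)" for g using e by (auto simp: bij_betw_def)
  have acc: "At [] \<in> ?Q" using conts_ends(2)[of "[]" c] by (simp add: statesof_def)
  have finj: "f q = f (At []) \<longleftrightarrow> q = At []" if "q \<in> ?Q" for q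
    using fi[OF that] fi[OF acc] by metis
  define M where "M = \<lparr>tm_Q = card ?Q, tm_G = card (UNIV :: cell set),
     tm_delta = (\<lambda>q a. case delta [c] (fi q) (ei a) of (q', g, d) \<Rightarrow> (f q', e g, d)), tm_acc = f (At [])\<rparr>"
  have wf: "wf_tm M"
    using flt[OF acc] flt[OF delta_statesof[OF fi']] elt elt[of Sep] es(4)
    by (auto simp: wf_tm_def M_def split: prod.splits) (metis fst_conv)
  define phi :: "gconf \<Rightarrow> config" where "phi = (\<lambda>(q, tp, h). (f q, e \<circ> tp, h))"
  have step: "tm_step M (phi C) = phi (gstep [c] C) \<and> fst (gstep [c] C) \<in> ?Q"
    if "fst C \<in> ?Q" for C
  proof (cases C)
    case (fields q tp h)
    then have q: "q \<in> ?Q" using that by simp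
    show ?thesis
    proof (cases "delta [c] q (tp h)")
      case (fields q' g d)
      then have "q' \<in> ?Q" using delta_statesof[OF q, of "tp h"] by simp
      then show ?thesis using \<open>C = _\<close> fields q finj[OF q] fi[OF q] ei
        by (auto simp: tm_step_def phi_def gstep_eq M_def fun_eq_iff)
    qed
  qed
  have steps: "(tm_step M ^^ t) (phi C) = phi ((gstep [c] ^^ t) C) \<and> fst ((gstep [c] ^^ t) C) \<in> ?Q"
    if "fst C \<in> ?Q" for C t
    using that step by (induction t) auto
  define C0 where "C0 x y = (Init :: com list st, lay (int (length x)) (inp x) 0 y, 0 :: int)" for x y
  have C0Q: "fst (C0 x y) \<in> ?Q" for x y by (simp add: C0_def statesof_def)
  \<comment> \<open>The input needs no preparation: it already is the track of \<open>RX\<close>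
    with the top of the stack outermost, and the separator symbol 3 is the home cell.\<close>
  have init: "tm_init (sym_of_bits x @ [3] @ sym_of_bits y) = phi (C0 x y)" for x y
  proof -
    have e_bit: "e (bitcell b) = (if b then 2 else 1)" for b using es by (cases b) auto
    have *: "lay (int (length x)) (inp x) 0 y z = bitcell (x ! nat z)" if "0 \<le> z" "z < int (length x)" for z
    proof -
      have "nat (int (length x) - 1 - z) = length x - 1 - nat z" "nat z < length x" using that by auto
      then show ?thesis using that 
        by (auto simp: lay_def bitcell_def inp_def rev_nth fun_eq_iff)
    qed
    have **: "lay (int (length x)) (inp x) 0 y z = blank" if "z < 0" for z
      using that by (auto simp: lay_def blank_def inp_def fun_eq_iff)
    have "(if 0 \<le> z \<and> nat z < length (sym_of_bits x @ [3] @ sym_of_bits y)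
        then (sym_of_bits x @ [3] @ sym_of_bits y) ! nat z else 0)
      = e (lay (int (length x)) (inp x) 0 y z)" for z
    proof -
      consider "z < 0" | "0 \<le> z" "z < int (length x)" | "z = int (length x)"
        | j where "z = int (length x) + 1 + int j"
        by (metis add.commute linorder_less_linear not_less zle_iff_zadd zless_imp_add1_zle)
      then show ?thesis
      proof cases
        case 1 then show ?thesis by (simp add: ** es)
      next
        case 2
        then have "nat z < length x" by auto
        then show ?thesis using 2 by (simp add: * e_bit sym_of_bits_def nth_append)
      next
        case 3 then show ?thesis by (simp add: es sym_of_bits_def nth_append lay_def)
      next
        case (4 j)
        then have "nat z = length x + 1 + j" by auto
        then show ?thesis using 4 by (auto simp: es e_bit sym_of_bits_def nth_append lay_def)
      qed
    qed
    then have eq: "(\<lambda>z. if 0 \<le> z \<and> nat z < length (sym_of_bits x @ [3] @ sym_of_bits y)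
        then (sym_of_bits x @ [3] @ sym_of_bits y) ! nat z else 0)
      = e \<circ> lay (int (length x)) (inp x) 0 y"
      unfolding comp_def by (rule ext)
    have "phi (C0 x y) = (0, e \<circ> lay (int (length x)) (inp x) 0 y, 0)"
      by (simp add: phi_def C0_def f(2))
    then show ?thesis
      unfolding tm_init_def eq by (rule sym)
  qed
  have accepts: "accepts_within M (sym_of_bits x @ [3] @ sym_of_bits y) t
     \<longleftrightarrow> fst ((gstep [c] ^^ t) (C0 x y)) = At []" for x y t
    unfolding accepts_within_def init using steps[OF C0Q, of t x y] finj
    by (auto simp: phi_def M_def split: prod.splits)
  \<comment> \<open>Scanning the input takes \<open>m + 1\<close> steps; then come at most
    \<open>cost (P m) c\<close> program steps, each a walk of at most \<open>2 * N + 4\<close> moves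
    with \<open>N = m + cost (P m) c\<close>.\<close>
  define W where "W m = m + 1 + cost (P m) c * (2 * (m + cost (P m) c) + 4)" for m
  have "poly_bounded W"
    unfolding W_def by (intro poly_bounded_intros poly_bounded_cost P)
  then obtain a k where ak: "W m \<le> a * (m + 1) ^ k" for m unfolding poly_bounded_def by blast
  have "\<exists>y. length y \<le> a * (length x + 1) ^ k \<and>
      accepts_within M (sym_of_bits x @ [3] @ sym_of_bits y) (a * (length x + 1) ^ k)" if x: "x \<in> L" for x
  proof -
    obtain s' where "rn (P (length x)) c (inp x) s'" using complete[OF x] by blast
    from rn_accepts[OF this] obtain y where y: "length y \<le> cost (P (length x)) c"
      "fst ((gstep [c] ^^ W (length x)) (C0 x y)) = At []"
      unfolding C0_def W_def by blast
    have "cost (P (length x)) c * 1 \<le> cost (P (length x)) c * (2 * (length x + cost (P (length x)) c) + 4)"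
      by (rule mult_le_mono2) simp
    then have "cost (P (length x)) c \<le> W (length x)" unfolding W_def by linarith
    then have "length y \<le> a * (length x + 1) ^ k" using y(1) ak[of "length x"] by linarith
    then show ?thesis using accepts acc_mono[OF y(2) ak] by blast
  qed
  moreover have "x \<in> L"
    if acc: "accepts_within M (sym_of_bits x @ [3] @ sym_of_bits y) t" for x y t
  proof -
    let ?h = "length x"
    have "fst ((gstep [c] ^^ t) (C0 x y)) = At []" using acc accepts by blast
    \<comment> \<open>Acceptance persists, so the length of the scan can be added to
      \<open>t\<close> and the scan then split off at the front.\<close>
    then have "fst ((gstep [c] ^^ (Suc ?h + t)) (C0 x y)) = At []"
      by (rule acc_mono) simp
    moreover have "(gstep [c] ^^ (Suc ?h + t)) (C0 x y)
       = (gstep [c] ^^ t) (At [c], lay (int ?h) (inp x) 0 y, int ?h)"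
      unfolding C0_def by (rule reach_trans[OF gstep_scan[OF refl] refl])
    ultimately have "fst ((gstep [c] ^^ t) (At [c], lay (int ?h) (inp x) 0 y, int ?h)) = At []" by simp
    then obtain B s' where "rns B [c] (inp x) s'" using gstep_sound by blast
    then have "rn B c (inp x) s'" by auto
    then show ?thesis by (rule sound)
  qed
  ultimately have "\<forall>x. x \<in> L \<longleftrightarrow> (\<exists>y. length y \<le> a * (length x + 1) ^ k \<and>
         accepts_within M (sym_of_bits x @ [3] @ sym_of_bits y) (a * (length x + 1) ^ k))"
    by blast
  then show ?thesis unfolding in_NP_def using wf by blast
qed

section \<open>Certificates for nontermination\<close>

text \<open>The weight \<open>None\<close> stands for infinity.\<close>

definition inflow :: "nat \<Rightarrow> (nat \<Rightarrow> nat) \<Rightarrow> (nat \<Rightarrow> nat) \<Rightarrow> nat \<Rightarrow> (nat \<Rightarrow> nat) \<Rightarrow> nat \<Rightarrow> nat" where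
  "inflow n s0 s1 o' t v = (if o' = v then 1 else 0) +
     (\<Sum>u<n. (if s0 u = v then (t u + 1) div 2 else 0) + (if s1 u = v then t u div 2 else 0))"

text \<open>Infinite weights satisfy their inequality trivially. A finite weight forbids infinite
  predecessors, as half of infinity is infinite; hence \<open>the (t u)\<close> is meaningful
  wherever it contributes.\<close>

definition certificate ::
  "nat \<Rightarrow> (nat \<Rightarrow> nat) \<Rightarrow> (nat \<Rightarrow> nat) \<Rightarrow> nat \<Rightarrow> nat \<Rightarrow> (nat \<Rightarrow> nat option) \<Rightarrow> bool" where
  "certificate n s0 s1 o' d t \<longleftrightarrow> t d = Some 0 \<and>
     (\<forall>v<n. \<forall>m. t v = Some m \<longrightarrow> (\<forall>u<n. s0 u = v \<or> s1 u = v \<longrightarrow> t u \<noteq> None) \<and>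
        inflow n s0 s1 o' (\<lambda>u. the (t u)) v \<le> m)"

lemma run_step_eq: "run_step (cur, nxt, v) = (cur(v := nxt v), nxt(v := cur v), cur v)"
  by (simp add: run_step_def)

locale arrival_run =
  fixes n :: nat and s0 s1 :: "nat \<Rightarrow> nat" and o' d :: nat
  assumes valid: "valid_instance n s0 s1 o' d"
begin

definition pos :: "nat \<Rightarrow> nat" where
  "pos k = snd (snd ((run_step ^^ k) (s0, s1, o')))"

text \<open>Counts times strictly before \<open>k\<close>, that is, departures during the first
  \<open>k\<close> steps; the current position is not included yet. The parity gives the state of
  the switch.\<close>

primrec visits :: "nat \<Rightarrow> nat \<Rightarrow> nat" where
  "visits 0 v = 0"
| "visits (Suc k) v = visits k v + (if pos k = v then 1 else 0)"

lemma run_state: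
  "(run_step ^^ k) (s0, s1, o') = (\<lambda>v. if even (visits k v) then s0 v else s1 v,
     \<lambda>v. if even (visits k v) then s1 v else s0 v, pos k)"
proof (induction k)
  case 0
  then show ?case by (simp add: pos_def)
next
  case (Suc k)
  then show ?case
    by (auto simp: run_step_eq pos_def[of "Suc k"] fun_eq_iff)
qed

lemma pos_0: "pos 0 = o'"
  by (simp add: pos_def)

lemma pos_Suc: "pos (Suc k) = (if even (visits k (pos k)) then s0 (pos k) else s1 (pos k))"
  using run_state[of k] by (simp add: pos_def[of "Suc k"] run_step_eq)

lemma pos_less: "pos k < n"
  using valid by (induction k) (auto simp: valid_instance_def pos_0 pos_Suc)

text \<open>Flow conservation: every visit except the initial one arrives over an edge.\<close>

lemma inflow_visits: "inflow n s0 s1 o' (visits k) v = visits (Suc k) v"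
proof (induction k)
  case 0
  then show ?case by (simp add: inflow_def pos_0)
next
  case (Suc k)
  let ?f = "\<lambda>k u. (if s0 u = v then (visits k u + 1) div 2 else 0) + (if s1 u = v then visits k u div 2 else 0)"
  \<comment> \<open>Only the summand of \<open>pos k\<close> changes: raising an even count enlarges
    the rounded-up half, raising an odd one the rounded-down half, which matches the edge chosen by
    \<open>pos_Suc\<close>.\<close>
  have "(\<Sum>u<n. ?f (Suc k) u) = (\<Sum>u<n. ?f k u + (if u = pos k then (if pos (Suc k) = v then 1 else 0) else 0))"
    by (rule sum.cong) (auto simp: pos_Suc elim!: oddE evenE)
  also have "\<dots> = (\<Sum>u<n. ?f k u) + (if pos (Suc k) = v then 1 else 0)"
    using pos_less[of k] by (simp add: sum.distrib)
  finally have "inflow n s0 s1 o' (visits (Suc k)) v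
      = inflow n s0 s1 o' (visits k) v + (if pos (Suc k) = v then 1 else 0)"
    by (simp only: inflow_def)
  then show ?case using Suc visits.simps(2)[of "Suc k" v] by linarith
qed

lemma inflow_mono:
  assumes "\<And>u. u < n \<Longrightarrow> s0 u = v \<or> s1 u = v \<Longrightarrow> t u \<le> t' u"
  shows "inflow n s0 s1 o' t v \<le> inflow n s0 s1 o' t' v"
proof -
  have "(if s0 u = v then (t u + 1) div 2 else 0) + (if s1 u = v then t u div 2 else 0)
      \<le> (if s0 u = v then (t' u + 1) div 2 else 0) + (if s1 u = v then t' u div 2 else 0)"
    if "u < n" for u
    using assms[OF that] by (auto intro!: add_mono div_le_mono)
  then show ?thesis unfolding inflow_def by (auto intro!: sum_mono)
qed

text \<open>A certificate is a pre-fixed point of the monotone operator \<open>inflow\<close>, so it dominates the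
  number of visits at any time.\<close>

lemma certificate_sound:
  assumes "certificate n s0 s1 o' d t"
  shows "\<not> run_terminates s0 s1 o' d"
proof -
  have *: "v < n \<Longrightarrow> t v = Some m \<Longrightarrow> visits k v \<le> m" for k v m
  proof (induction k arbitrary: v m)
    case (Suc k)
    have "visits (Suc k) v = inflow n s0 s1 o' (visits k) v"
      by (simp only: inflow_visits)
    also have "\<dots> \<le> inflow n s0 s1 o' (\<lambda>u. the (t u)) v"
    proof (rule inflow_mono)
      fix u assume u: "u < n" "s0 u = v \<or> s1 u = v"
      then obtain m' where "t u = Some m'"
        using assms Suc.prems unfolding certificate_def by blast
      then show "visits k u \<le> the (t u)" using Suc.IH[OF u(1)] by simp
    qed
    also have "\<dots> \<le> m" using assms Suc.prems unfolding certificate_def by blast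
    finally show ?case .
  qed simp
  have "pos k \<noteq> d" for k
  proof
    assume "pos k = d"
    then have "visits (Suc k) d > 0" by simp
    moreover have "visits (Suc k) d \<le> 0"
      using *[of d 0 "Suc k"] assms valid by (simp add: certificate_def valid_instance_def)
    ultimately show False by simp
  qed
  then show ?thesis by (simp add: run_terminates_def pos_def)
qed

section \<open>Vertices by distance to the destination\<close>

primrec layer :: "nat \<Rightarrow> nat set" where
  "layer 0 = {d}"
| "layer (Suc j) = layer j \<union> {v. v < n \<and> (s0 v \<in> layer j \<or> s1 v \<in> layer j)}"

lemma layer_less: "layer j \<subseteq> {..<n}"
  using valid by (induction j) (auto simp: valid_instance_def)

text \<open>If all of the first \<open>n\<close> extensions were proper, \<open>layer n\<close>
  would have more than \<open>n\<close> elements.\<close>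

lemma layer_closed: "\<exists>j<n. layer (Suc j) = layer j"
proof (rule ccontr)
  assume *: "\<not> ?thesis"
  have "j \<le> n \<Longrightarrow> Suc j \<le> card (layer j)" for j
  proof (induction j)
    case (Suc j)
    have "layer j \<noteq> layer (Suc j)" using * Suc.prems by (metis Suc_le_eq)
    moreover have "layer j \<subseteq> layer (Suc j)" by auto
    ultimately have "card (layer j) < card (layer (Suc j))"
      using layer_less[of "Suc j"] by (intro psubset_card_mono) (auto intro: finite_subset)
    then show ?case using Suc by simp
  qed simp
  from this[of n] have "Suc n \<le> card (layer n)" by simp
  moreover have "card (layer n) \<le> card {..<n}" using layer_less by (intro card_mono) auto
  ultimately show False by simp
qed

lemma certificate_complete:
  assumes "\<not> run_terminates s0 s1 o' d"
  obtains t where "certificate n s0 s1 o' d t" "\<And>v m. t v = Some m \<Longrightarrow> m < 2 ^ n"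
proof -
  have nd: "pos k \<noteq> d" for k using assms by (auto simp: run_terminates_def pos_def)
  \<comment> \<open>A vertex that is new in the next layer has a successor \<open>w\<close> in
    \<open>layer j\<close>, and at least the rounded-down half of its visits continue to
    \<open>w\<close>. The claim ranges over all \<open>k\<close> because these arrivals are counted
    at \<open>Suc k\<close>.\<close>
  have bound: "v \<in> layer j \<Longrightarrow> visits k v < 2 ^ j" for j k v
  proof (induction j arbitrary: k v)
    case 0
    then have "v = d" by simp
    moreover have "visits k d = 0" using nd by (induction k) auto
    ultimately show ?case by simp
  next
    case (Suc j)
    show ?case
    proof (cases "v \<in> layer j")
      case True
      then show ?thesis using Suc.IH[of v k] by simp
    next
      case False
      then obtain w where w: "v < n" "s0 v = w \<or> s1 v = w" "w \<in> layer j" using Suc.prems by auto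
      have "visits k v div 2 \<le> (if s0 v = w then (visits k v + 1) div 2 else 0)
          + (if s1 v = w then visits k v div 2 else 0)"
        using w(2) by auto
      also have "\<dots> \<le> (\<Sum>u<n. (if s0 u = w then (visits k u + 1) div 2 else 0)
          + (if s1 u = w then visits k u div 2 else 0))"
        using w(1) by (intro member_le_sum) auto
      also have "\<dots> \<le> visits (Suc k) w"
        unfolding inflow_visits[symmetric] inflow_def by simp
      also have "\<dots> < 2 ^ j" using Suc.IH[OF w(3)] .
      finally show ?thesis by simp
    qed
  qed
  obtain j where j: "j < n" "layer (Suc j) = layer j" using layer_closed by blast
  let ?C = "layer j"
  have fin: "finite ?C" using layer_less by (rule finite_subset) simp
  define V where "V k = sum (visits k) ?C" for k
  have "V k \<le> card ?C * 2 ^ j" for k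
    unfolding V_def using bound[of _ j k] sum_bounded_above[of ?C "visits k" "2 ^ j"]
    by (simp add: less_imp_le)
  then have "finite (range V)" by (meson finite_atMost finite_subset image_subsetI atMost_iff)
  \<comment> \<open>\<open>V\<close> is bounded and so attains a maximum at some \<open>K\<close>.
    There \<open>pos K\<close> lies outside \<open>?C\<close>, hence on \<open>?C\<close> the counts
    at \<open>Suc K\<close> and \<open>K\<close> agree, and flow conservation turns into the
    certificate inequality.\<close>
  then obtain K where K: "\<And>k. V k \<le> V K"
    using Max_in[of "range V"] Max_ge[of "range V"] by (metis empty_not_UNIV image_is_empty rangeE rangeI)
  have "V (Suc K) = V K + (if pos K \<in> ?C then 1 else 0)"
    unfolding V_def using fin by (simp add: sum.distrib)
  then have out: "pos K \<notin> ?C" using K[of "Suc K"] by (auto split: if_splits)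
  define t where "t v = (if v \<in> ?C then Some (visits K v) else None)" for v
  have "d \<in> ?C" by (induction j) auto
  moreover have "visits K d = 0" using nd by (induction K) auto
  moreover have "inflow n s0 s1 o' (\<lambda>u. the (t u)) v \<le> m \<and> (\<forall>u<n. s0 u = v \<or> s1 u = v \<longrightarrow> t u \<noteq> None)"
    if v: "t v = Some m" for v m
  proof -
    have vC: "v \<in> ?C" and m: "m = visits K v" using v by (auto simp: t_def split: if_splits)
    \<comment> \<open>Stability of the layers at \<open>j\<close> makes \<open>?C\<close> closed
      under predecessors.\<close>
    have pred: "u \<in> ?C" if "u < n" "s0 u = v \<or> s1 u = v" for u
      using j(2) vC that by auto
    have "inflow n s0 s1 o' (\<lambda>u. the (t u)) v \<le> inflow n s0 s1 o' (visits K) v"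
      using pred by (intro inflow_mono) (simp add: t_def)
    also have "\<dots> = visits K v" using vC out by (auto simp: inflow_visits)
    finally show ?thesis using m pred by (auto simp: t_def)
  qed
  ultimately have "certificate n s0 s1 o' d t"
    unfolding certificate_def by (simp add: t_def)
  moreover have "m < 2 ^ n" if "t v = Some m" for v m
  proof -
    have "m < 2 ^ j" using that bound[of v j K] by (auto simp: t_def split: if_splits)
    also have "\<dots> < 2 ^ n" using j(1) by simp
    finally show ?thesis .
  qed
  ultimately show ?thesis using that by blast
qed

end

section \<open>Binary numbers and tokens\<close>

declare bin.simps [simp del]

primrec val :: "bool list \<Rightarrow> nat" where
  "val [] = 0"
| "val (b # bs) = of_bool b + 2 * val bs"

primrec inc :: "bool list \<Rightarrow> bool list" where
  "inc [] = [True]"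
| "inc (b # bs) = (if b then False # inc bs else True # bs)"

lemma bin_0 [simp]: "bin 0 = []"
  by (simp add: bin.simps)

lemma bin_pos: "0 < m \<Longrightarrow> bin m = odd m # bin (m div 2)"
  by (simp add: bin.simps)

lemma val_bin [simp]: "val (bin m) = m"
proof (induction m rule: bin.induct)
  case (1 m)
  then show ?case by (cases "m = 0") (auto simp: bin_pos)
qed

lemma bin_inject [simp]: "bin a = bin b \<longleftrightarrow> a = b"
  by (metis val_bin)

lemma bin_Suc: "bin (Suc m) = inc (bin m)"
proof (induction m rule: bin.induct)
  case (1 m)
  then show ?case by (cases "m = 0") (auto simp: bin_pos)
qed

lemma length_bin: "length (bin m) \<le> m"
proof (induction m rule: bin.induct)
  case (1 m)
  then show ?case by (cases "m = 0") (auto simp: bin_pos)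
qed

text \<open>Together with \<open>bin_val\<close> this characterises the digit lists produced by
  \<open>bin\<close>: a token with a most significant zero is no encoding and has to be
  detected.\<close>

lemma last_bin: "bin m = ds @ [b] \<Longrightarrow> b"
proof (induction m arbitrary: ds rule: bin.induct)
  case (1 m)
  then show ?case
    by (cases "m = 0"; cases ds; cases "m = 1") (auto simp: bin_pos)
qed

lemma bin_val: "ds = [] \<or> last ds \<Longrightarrow> bin (val ds) = ds"
proof (induction ds)
  case (Cons b ds)
  then have IH: "bin (val ds) = ds" by (auto split: if_splits)
  have "0 < val (b # ds)"
  proof (cases "ds = []")
    case False
    then have "val ds \<noteq> 0" using IH by (metis bin_0)
    then show ?thesis by simp
  qed (use Cons.prems in simp)
  then show ?case using IH by (simp add: bin_pos)
qed simp

lemma val_append: "val (xs @ ys) = val xs + 2 ^ length xs * val ys"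
  by (induction xs) (auto simp: algebra_simps)

lemma val_replicate_False [simp]: "val (replicate k False) = 0"
  by (induction k) auto

lemma val_less: "val ds < 2 ^ length ds"
  by (induction ds) auto

lemma exists_digits: "m < 2 ^ k \<Longrightarrow> \<exists>ds. length ds = k \<and> val ds = m"
proof (induction k arbitrary: m)
  case (Suc k)
  then have "m div 2 < 2 ^ k" by (simp add: less_mult_imp_div_less mult.commute)
  then obtain ds where "length ds = k" "val ds = m div 2" using Suc.IH[of "m div 2"] by auto
  then show ?case by (intro exI[of _ "odd m # ds"]) auto
qed simp

text \<open>Canonical digits are the shortest possible, since their top digit alone contributes a
  full power of two. Padding with zeros can therefore align a smaller number with a larger
  one.\<close>

lemma length_bin_less: "val ds = m \<Longrightarrow> length (bin m) \<le> length ds"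
proof (rule ccontr)
  assume m: "val ds = m" and "\<not> length (bin m) \<le> length ds"
  then have *: "length ds < length (bin m)" by simp
  then obtain es b where eb: "bin m = es @ [b]" by (metis length_0_conv not_less_zero rev_exhaust)
  then have "b" by (rule last_bin)
  then have "m = val es + 2 ^ length es" using eb val_bin[of m] by (simp add: val_append)
  moreover have "length ds \<le> length es" using * eb by simp
  then have "(2::nat) ^ length ds \<le> 2 ^ length es" by simp
  ultimately show False using val_less[of ds] m by linarith
qed

section \<open>The token code: doubled digits with a terminator\<close>

definition dbl :: "bool list \<Rightarrow> bool list" where
  "dbl ds = concat (map (\<lambda>b. [b, b]) ds)"

lemma dbl_simps [simp]: "dbl [] = []" "dbl (b # ds) = b # b # dbl ds" "dbl (ds @ es) = dbl ds @ dbl es"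
  by (simp_all add: dbl_def)

lemma length_dbl [simp]: "length (dbl ds) = 2 * length ds"
  by (induction ds) auto

lemma enc_nat_dbl: "enc_nat m = dbl (bin m) @ [True, False]"
  by (simp add: enc_nat_def dbl_def)

text \<open>The terminator is a pair of unequal bits, so a run of equal pairs cannot reach past
  it.\<close>

lemma dbl_prefix:
  "dbl ds @ q = dbl es @ True # False # r \<Longrightarrow> \<exists>es'. es = ds @ es' \<and> q = dbl es' @ True # False # r"
proof (induction ds arbitrary: es)
  case (Cons b ds)
  then show ?case by (cases es) auto
qed simp

lemma dbl_token: "dbl ds @ True # False # q = dbl es @ True # False # r \<longleftrightarrow> ds = es \<and> q = r"
proof
  assume "dbl ds @ True # False # q = dbl es @ True # False # r"
  from dbl_prefix[OF this] obtain es' where "es = ds @ es'" "True # False # q = dbl es' @ True # False # r"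
    by blast
  then show "ds = es \<and> q = r" by (cases es') auto
qed simp

definition toks :: "nat list \<Rightarrow> bool list" where
  "toks ns = concat (map enc_nat ns)"

lemma toks_simps [simp]: "toks [] = []" "toks (m # ns) = enc_nat m @ toks ns"
  "toks (ns @ ns') = toks ns @ toks ns'"
  by (simp_all add: toks_def)

lemma length_toks: "2 * length ns \<le> length (toks ns)" "m \<in> set ns \<Longrightarrow> length (bin m) \<le> length (toks ns)"
  by (induction ns) (auto simp: enc_nat_dbl)

section \<open>Specifications of program fragments\<close>

definition anyb :: "(bool \<Rightarrow> com) \<Rightarrow> com" where
  "anyb f = Alt (f False) (f True)"

lemma rn_anyb [simp]: "rn B (anyb f) s s' \<longleftrightarrow> (\<exists>b. rn B (f b) s s')"
  by (auto simp: anyb_def ex_bool_eq)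

primrec path :: "(bool \<Rightarrow> stacks \<Rightarrow> stacks \<Rightarrow> bool) \<Rightarrow> bool list \<Rightarrow> stacks \<Rightarrow> stacks \<Rightarrow> bool" where
  "path P [] = (=)"
| "path P (b # ds) = P b OO path P ds"

lemma relpowp_Suc_left: "(P ^^ Suc k) x z \<longleftrightarrow> (\<exists>y. P x y \<and> (P ^^ k) y z)"
  by (metis relpowp_Suc_D2 relpowp_Suc_I2)

text \<open>Collecting the digit guessed in each round turns iteration over an existential choice
  into a statement about one digit list.\<close>

lemma relpowp_path:
  "((\<lambda>s s'. \<exists>b. P b s s') ^^ k) s s' \<longleftrightarrow> (\<exists>ds. length ds = k \<and> path P ds s s')"
proof (induction k arbitrary: s)
  case (Suc k)
  have "(\<exists>ds. length ds = Suc k \<and> path P ds s s') \<longleftrightarrow> (\<exists>b ds. length ds = k \<and> path P (b # ds) s s')"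
    by (metis length_Suc_conv)
  then show ?case unfolding relpowp_Suc_left Suc.IH path.simps relcompp_apply by blast
qed auto

lemma rn_Star_anyb:
  "rn B (Star (anyb f)) s s' \<longleftrightarrow> (\<exists>ds. length ds \<le> B \<and> path (\<lambda>b. rn B (f b)) ds s s')"
proof -
  have "rn B (anyb f) = (\<lambda>s s'. \<exists>b. rn B (f b) s s')" by (simp add: fun_eq_iff)
  then show ?thesis by (auto simp: relpowp_path)
qed

text \<open>A one-point rule for the intermediate state of a sequence; it keeps long compositions
  from growing into nested existentials.\<close>

lemma ex_state_point:
  "(\<exists>u. (\<exists>x y. P x y \<and> Q x y \<and> u = f x y) \<and> R u) \<longleftrightarrow> (\<exists>x y. P x y \<and> Q x y \<and> R (f x y))"
  by blast

lemma ex_state_point1: "(\<exists>u. (\<exists>x. P x \<and> u = f x) \<and> R u) \<longleftrightarrow> (\<exists>x. P x \<and> R (f x))"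
  by blast

lemma rn_Seq: "rn B (c ;; d) s s' \<longleftrightarrow> (\<exists>u. rn B c s u \<and> rn B d u s')"
  by auto

definition skipbits :: com where
  "skipbits = Star (anyb (\<lambda>b. Pop RX (Dig b) ;; Pop RX (Dig b)))"

definition skiptok :: com where
  "skiptok = skipbits ;; Pop RX (Dig True) ;; Pop RX (Dig False)"

definition readtok :: "reg \<Rightarrow> com" where
  "readtok A = Star (anyb (\<lambda>b. Pop RX (Dig b) ;; Pop RX (Dig b) ;; Push A (Dig b))) ;;
     Pop RX (Dig True) ;; Pop RX (Dig False)"

definition copy :: "reg \<Rightarrow> reg \<Rightarrow> com" where
  "copy i j = Star (anyb (\<lambda>b. Pop i (Dig b) ;; Push j (Dig b)))"

definition pad :: "reg \<Rightarrow> com" where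
  "pad i = Star (Push i (Dig False))"

lemma rn_skipbits:
  "rn B skipbits s s' \<longleftrightarrow> (\<exists>ds r. length ds \<le> B \<and> s RX = map Dig (dbl ds) @ r \<and> s' = s(RX := r))"
proof -
  have "path (\<lambda>b. rn B (Pop RX (Dig b) ;; Pop RX (Dig b))) ds s s'
     \<longleftrightarrow> (\<exists>r. s RX = map Dig (dbl ds) @ r \<and> s' = s(RX := r))" for ds s
    by (induction ds arbitrary: s) (auto simp: relcompp_apply)
  then show ?thesis unfolding skipbits_def rn_Star_anyb by auto
qed

lemma rn_readbits:
  assumes "A \<noteq> RX"
  shows "rn B (Star (anyb (\<lambda>b. Pop RX (Dig b) ;; Pop RX (Dig b) ;; Push A (Dig b)))) s s' \<longleftrightarrow>
    (\<exists>ds r. length ds \<le> B \<and> s RX = map Dig (dbl ds) @ r \<and> s' = s(RX := r, A := map Dig (rev ds) @ s A))"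
proof -
  have "path (\<lambda>b. rn B (Pop RX (Dig b) ;; Pop RX (Dig b) ;; Push A (Dig b))) ds s s'
     \<longleftrightarrow> (\<exists>r. s RX = map Dig (dbl ds) @ r \<and> s' = s(RX := r, A := map Dig (rev ds) @ s A))" for ds s
    using assms by (induction ds arbitrary: s) (auto simp: relcompp_apply fun_upd_twist)
  then show ?thesis unfolding rn_Star_anyb by auto
qed

lemma rn_copy:
  assumes "i \<noteq> j"
  shows "rn B (copy i j) s s' \<longleftrightarrow>
    (\<exists>ds r. length ds \<le> B \<and> s i = map Dig ds @ r \<and> s' = s(i := r, j := map Dig (rev ds) @ s j))"
proof -
  have "path (\<lambda>b. rn B (Pop i (Dig b) ;; Push j (Dig b))) ds s s'
     \<longleftrightarrow> (\<exists>r. s i = map Dig ds @ r \<and> s' = s(i := r, j := map Dig (rev ds) @ s j))" for ds s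
    using assms by (induction ds arbitrary: s) (auto simp: relcompp_apply fun_upd_twist)
  then show ?thesis unfolding copy_def rn_Star_anyb by auto
qed

lemma rn_pad:
  "rn B (pad i) s s' \<longleftrightarrow> (\<exists>k\<le>B. s' = s(i := replicate k (Dig False) @ s i))"
proof -
  have "(rn B (Push i (Dig False)) ^^ k) s s' \<longleftrightarrow> s' = s(i := replicate k (Dig False) @ s i)" for k
    by (induction k arbitrary: s') (auto simp: relcompp_apply)
  then show ?thesis unfolding pad_def by simp
qed

lemma map_Dig_eq [simp]: "map Dig xs = map Dig ys \<longleftrightarrow> xs = ys"
  by (rule inj_map_eq_map) (simp add: inj_def)

lemma map_Dig_append_eq:
  assumes "\<And>b. x \<noteq> Dig b" "\<And>b. y \<noteq> Dig b"
  shows "map Dig ds @ x # r = map Dig es @ y # q \<longleftrightarrow> ds = es \<and> x = y \<and> r = q"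
proof (induction ds arbitrary: es)
  case Nil
  then show ?case using assms by (cases es) auto
next
  case (Cons b ds)
  then show ?case using assms by (cases es) auto
qed

text \<open>The register \<open>RX\<close> always holds a list of digits.\<close>

lemma map_Dig_token:
  "map Dig w = map Dig (dbl ds) @ Dig True # Dig False # q \<longleftrightarrow>
    (\<exists>q'. w = dbl ds @ True # False # q' \<and> q = map Dig q')"
proof
  assume "map Dig w = map Dig (dbl ds) @ Dig True # Dig False # q"
  then obtain us vs where 1: "w = us @ vs" "map Dig us = map Dig (dbl ds)" "map Dig vs = Dig True # Dig False # q"
    unfolding map_eq_append_conv by metis
  then obtain q' where "vs = True # False # q'" "q = map Dig q'"
    by (auto simp: map_eq_Cons_conv)
  then show "\<exists>q'. w = dbl ds @ True # False # q' \<and> q = map Dig q'" using 1 by simp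
qed auto

text \<open>The loop may guess any number of pairs, but only at the terminator do
  \<open>True\<close> and \<open>False\<close> follow, so the token is read deterministically. Its
  digits arrive reversed, the most significant one on top.\<close>

lemma rn_readtok:
  assumes "A \<noteq> RX" "s RX = map Dig (enc_nat m @ r)"
  shows "rn B (readtok A) s s' \<longleftrightarrow>
    length (bin m) \<le> B \<and> s' = s(RX := map Dig r, A := map Dig (rev (bin m)) @ s A)"
proof -
  have "s RX = map Dig (dbl ds) @ Dig True # Dig False # q \<longleftrightarrow> ds = bin m \<and> q = map Dig r" for ds q
    unfolding assms(2) map_Dig_token enc_nat_dbl using dbl_token by auto
  moreover have "rn B (readtok A) s s' \<longleftrightarrow> (\<exists>ds q. length ds \<le> B \<and>
      s RX = map Dig (dbl ds) @ Dig True # Dig False # q \<and> s' = s(RX := q, A := map Dig (rev ds) @ s A))"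
    using assms(1) unfolding readtok_def rn_Seq rn_readbits[OF assms(1)] ex_state_point
    by (auto simp: fun_upd_twist)
  ultimately show ?thesis by simp
qed

lemma rn_skiptok:
  "rn B skiptok s s' \<longleftrightarrow> (\<exists>ds r. length ds \<le> B \<and> s RX = map Dig (dbl ds) @ Dig True # Dig False # r \<and> s' = s(RX := r))"
  unfolding skiptok_def rn_Seq rn_skipbits ex_state_point by auto

declare rn.simps(4,6) [simp del]

section \<open>The binary counter\<close>

primrec addc :: "bool \<Rightarrow> bool list \<Rightarrow> bool list" where
  "addc c [] = []"
| "addc c (b # bs) = (b \<noteq> c) # addc (b \<and> c) bs"

primrec carry :: "bool \<Rightarrow> bool list \<Rightarrow> bool" where
  "carry c [] = c"
| "carry c (b # bs) = carry (b \<and> c) bs"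

lemma addc_False: "addc False bs = bs" "carry False bs = False"
  by (induction bs) auto

text \<open>\<open>addc\<close> preserves the width; the overflow digit is split off, just as
  \<open>emit\<close> writes it separately when the final carry is set.\<close>

lemma inc_addc: "inc bs = addc True bs @ (if carry True bs then [True] else [])"
  by (induction bs) (auto simp: addc_False)

lemma length_inc: "length (inc bs) \<le> Suc (length bs)"
  by (induction bs) auto

definition emitstep :: "bool \<Rightarrow> com" where
  "emitstep b = anyb (\<lambda>c. Pop RU (Dig c) ;; Pop RU (Dig b) ;; Push RR (Dig b) ;;
     Push RV (Dig (b \<noteq> c)) ;; Push RU (Dig (b \<and> c)))"

text \<open>Increments the counter in \<open>RU\<close> and appends its old value to \<open>RR\<close>. During the pass the
  carry lies on top of \<open>RU\<close>.\<close>

definition emit :: com where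
  "emit = Push RU (Dig True) ;; Star (anyb emitstep) ;;
     anyb (\<lambda>c. Pop RU (Dig c) ;; Emp RU ;; (if c then Push RV (Dig True) else Emp RU)) ;;
     copy RV RU ;; Emp RV"

text \<open>Stated for every prefix \<open>ds\<close>, since the loop may stop early; only the later
  \<open>Emp RU\<close> forces all digits to be processed.\<close>

lemma rn_emitloop:
  assumes "s RU = Dig c # map Dig us"
  shows "rn B (Star (anyb emitstep)) s s' \<longleftrightarrow> (\<exists>ds vs. length ds \<le> B \<and> us = ds @ vs \<and>
    s' = s(RU := Dig (carry c ds) # map Dig vs, RR := map Dig (rev ds) @ s RR,
      RV := map Dig (rev (addc c ds)) @ s RV))"
proof -
  have step: "rn B (emitstep b) s s' \<longleftrightarrow> (\<exists>c r. s RU = Dig c # Dig b # r \<and>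
      s' = s(RU := Dig (b \<and> c) # r, RR := Dig b # s RR, RV := Dig (b \<noteq> c) # s RV))" for b s s'
    unfolding emitstep_def by (auto simp: rn_Seq fun_upd_twist)
  have "path (\<lambda>b. rn B (emitstep b)) ds s s' \<longleftrightarrow> (\<exists>vs. us = ds @ vs \<and>
    s' = s(RU := Dig (carry c ds) # map Dig vs, RR := map Dig (rev ds) @ s RR,
      RV := map Dig (rev (addc c ds)) @ s RV))"
    if "s RU = Dig c # map Dig us" for ds s c us
    using that
  proof (induction ds arbitrary: s c us)
    case Nil
    then have eq: "s(RU := Dig c # map Dig us) = s" by (simp add: fun_upd_idem)
    have "s(RU := Dig c # map Dig us, RR := s RR, RV := s RV) = s"
      unfolding eq by (simp only: fun_upd_triv)
    then show ?case
      by (simp only: path.simps append_Nil carry.simps addc.simps rev.simps list.map) metis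
  next
    case (Cons b ds)
    show ?case
    proof (cases us)
      case Nil
      then show ?thesis using Cons.prems by (auto simp: relcompp_apply step)
    next
      case (Cons b' vs)
      let ?u = "s(RU := Dig (b \<and> c) # map Dig vs, RR := Dig b # s RR, RV := Dig (b \<noteq> c) # s RV)"
      have "path (\<lambda>b. rn B (emitstep b)) (b # ds) s s' \<longleftrightarrow> b' = b \<and> path (\<lambda>b. rn B (emitstep b)) ds ?u s'"
        using \<open>s RU = _\<close> Cons by (auto simp: relcompp_apply step)
      moreover have "?u(RU := X, RR := map Dig (rev ds) @ ?u RR, RV := map Dig (rev (addc (b \<and> c) ds)) @ ?u RV)
        = s(RU := X, RR := map Dig (rev (b # ds)) @ s RR, RV := map Dig (rev (addc c (b # ds))) @ s RV)" for X
        by (rule ext) simp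
      moreover have "?u RU = Dig (b \<and> c) # map Dig vs" by simp
      ultimately show ?thesis
        unfolding Cons append_Cons list.inject carry.simps by (simp only: Cons.IH) blast
    qed
  qed
  from this[where s = s and c = c and us = us, OF assms] show ?thesis unfolding rn_Star_anyb by blast
qed

text \<open>The strict bound on \<open>length us\<close> pays for the extra digit that
  \<open>inc\<close> may add and that must be copied back from \<open>RV\<close>.\<close>

lemma rn_emit:
  assumes "s RU = map Dig us" "s RV = []" "length us < B"
  shows "rn B emit s s' \<longleftrightarrow> s' = s(RU := map Dig (inc us), RR := map Dig (rev us) @ s RR)"
proof -
  let ?c = "carry True us"
  let ?u = "s(RU := [Dig ?c], RR := map Dig (rev us) @ s RR, RV := map Dig (rev (addc True us)))"
  let ?v = "s(RU := [], RR := map Dig (rev us) @ s RR, RV := map Dig (rev (inc us)))"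
  let ?mid = "anyb (\<lambda>c. Pop RU (Dig c) ;; Emp RU ;; (if c then Push RV (Dig True) else Emp RU))"
  have 1: "rn B (Star (anyb emitstep)) (s(RU := Dig True # map Dig us)) w \<longleftrightarrow> (\<exists>ds vs. length ds \<le> B \<and> us = ds @ vs \<and>
    w = s(RU := Dig (carry True ds) # map Dig vs, RR := map Dig (rev ds) @ s RR, RV := map Dig (rev (addc True ds))))" for w
    by (subst rn_emitloop[of _ True us]) (auto simp: assms fun_upd_twist)
  have 2: "rn B ?mid w t \<longleftrightarrow> vs = [] \<and> t = ?v"
    if "us = ds @ vs" "w = s(RU := Dig (carry True ds) # map Dig vs, RR := map Dig (rev ds) @ s RR, RV := map Dig (rev (addc True ds)))"
    for w t ds vs
    using that by (auto simp: rn_Seq inc_addc fun_upd_twist)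
  have 3: "rn B (copy RV RU ;; Emp RV) ?v s' \<longleftrightarrow> s' = s(RU := map Dig (inc us), RR := map Dig (rev us) @ s RR)"
  proof -
    have len: "length (rev (inc us)) \<le> B" using length_inc[of us] assms(3) by simp
    have upd: "?v(RV := [], RU := map Dig (inc us)) = s(RU := map Dig (inc us), RR := map Dig (rev us) @ s RR)"
      using assms(2) by auto
    show ?thesis
    proof
      assume "rn B (copy RV RU ;; Emp RV) ?v s'"
      then obtain ds r where "map Dig (rev (inc us)) = map Dig ds @ r" "s' = ?v(RV := r, RU := map Dig (rev ds))" "r = []"
        unfolding rn_Seq rn_copy[of RV RU, simplified] ex_state_point by auto
      then show "s' = s(RU := map Dig (inc us), RR := map Dig (rev us) @ s RR)"
        using upd by auto
    next
      assume "s' = s(RU := map Dig (inc us), RR := map Dig (rev us) @ s RR)"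
      moreover have "rn B (copy RV RU) ?v (?v(RV := [], RU := map Dig (inc us)))"
        unfolding rn_copy[of RV RU, simplified]
        using len by (intro exI[of _ "rev (inc us)"] exI[of _ "[]"]) simp
      ultimately show "rn B (copy RV RU ;; Emp RV) ?v s'"
        unfolding upd rn_Seq using assms(2) by auto
    qed
  qed
  show ?thesis
  proof
    assume "rn B emit s s'"
    then obtain w t where w: "rn B (Star (anyb emitstep)) (s(RU := Dig True # map Dig us)) w"
      and t: "rn B ?mid w t" "rn B (copy RV RU ;; Emp RV) t s'"
      unfolding emit_def rn_Seq[of B "Push _ _"] rn_Seq[of B "Star _"] rn_Seq[of B "anyb _"] rn.simps(2) assms(1)
      by blast
    obtain ds vs where "us = ds @ vs"
      "w = s(RU := Dig (carry True ds) # map Dig vs, RR := map Dig (rev ds) @ s RR, RV := map Dig (rev (addc True ds)))"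
      using w unfolding 1 by blast
    then have "t = ?v" using 2 t(1) by blast
    then show "s' = s(RU := map Dig (inc us), RR := map Dig (rev us) @ s RR)"
      using t(2) unfolding 3[symmetric] by blast
  next
    assume "s' = s(RU := map Dig (inc us), RR := map Dig (rev us) @ s RR)"
    then have "rn B (copy RV RU ;; Emp RV) ?v s'" unfolding 3 .
    moreover have "rn B (Star (anyb emitstep)) (s(RU := Dig True # map Dig us)) ?u"
      using assms(3) by (subst 1) (intro exI[of _ us] exI[of _ "[]"], simp)
    moreover have "rn B ?mid ?u ?v" by (subst 2[of us "[]"]) auto
    ultimately show "rn B emit s s'"
      unfolding emit_def rn_Seq[of B "Push _ _"] rn_Seq[of B "Star _"] rn_Seq[of B "anyb _"] rn.simps(2) assms(1)
      by blast
  qed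
qed

section \<open>Guessing the certificate\<close>

fun fval :: "bool list option \<Rightarrow> sym list" where
  "fval None = [Omega]"
| "fval (Some ds) = map Dig ds"

text \<open>\<open>Start\<close> occurs at no other place of a record, so boundaries can be
  recognised from any head position.\<close>

definition frec :: "bool list \<times> bool list option \<Rightarrow> sym list" where
  "frec = (\<lambda>(i, v). Start # map Dig i @ Hash # fval v @ [Hash])"

fun famt :: "(bool \<times> bool list) option \<Rightarrow> sym list" where
  "famt None = [Omega]"
| "famt (Some (b, cs)) = Dig b # map Dig cs"

text \<open>The index is reversed because \<open>emit\<close> writes the indices of the table in
  that order too. The bit of the amount precedes its digits because subtraction keeps the borrow on
  top.\<close>

definition fedge :: "nat \<times> (bool \<times> bool list) option \<Rightarrow> sym list" where
  "fedge = (\<lambda>(w, c). map Dig (rev (bin w)) @ Hash # famt c @ [Hash])"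

text \<open>The numbers \<open>(m + 1) div 2\<close> and \<open>m div 2\<close> are both represented by the digits of
  \<open>m div 2\<close>; the former needs an additional borrow if \<open>m\<close> is odd.\<close>

fun amt0 :: "bool list option \<Rightarrow> (bool \<times> bool list) option" where
  "amt0 None = None"
| "amt0 (Some ds) = Some (hd ds, tl ds @ [False])"

fun amt1 :: "bool list option \<Rightarrow> (bool \<times> bool list) option" where
  "amt1 None = None"
| "amt1 (Some ds) = Some (False, tl ds @ [False])"

definition push3 :: "sym \<Rightarrow> com" where
  "push3 a = Push RR a ;; Push RE0 a ;; Push RE1 a"

text \<open>Digits are pushed from the most significant one down. The zero pushed first onto
  \<open>RE0\<close> and \<open>RE1\<close> becomes the leading digit of the halves; the last digit
  becomes the borrow bit on \<open>RE0\<close> and is replaced by \<open>False\<close> on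
  \<open>RE1\<close>. Both halves thus get the width of the weight.\<close>

definition guess :: com where
  "guess = push3 Hash ;; Alt (push3 Omega)
     (Push RE0 (Dig False) ;; Push RE1 (Dig False) ;; Star (anyb (\<lambda>b. push3 (Dig b))) ;;
      anyb (\<lambda>b. Push RR (Dig b) ;; Push RE0 (Dig b) ;; Push RE1 (Dig False))) ;; push3 Hash"

text \<open>Stacks grow at the top, so a record and its two edges are written back to front: values
  before indices.\<close>

definition vertex :: com where
  "vertex = guess ;; readtok RE0 ;; readtok RE1 ;; emit ;; Push RR Start"

lemma rn_push3_loop:
  "rn B (Star (anyb (\<lambda>b. push3 (Dig b)))) s s' \<longleftrightarrow> (\<exists>ds. length ds \<le> B \<and>
    s' = s(RR := map Dig ds @ s RR, RE0 := map Dig ds @ s RE0, RE1 := map Dig ds @ s RE1))"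
proof -
  have "path (\<lambda>b. rn B (push3 (Dig b))) ds s s' \<longleftrightarrow>
    s' = s(RR := map Dig (rev ds) @ s RR, RE0 := map Dig (rev ds) @ s RE0, RE1 := map Dig (rev ds) @ s RE1)" for ds s
    unfolding push3_def by (induction ds arbitrary: s) (auto simp: rn_Seq relcompp_apply fun_upd_twist)
  then have "rn B (Star (anyb (\<lambda>b. push3 (Dig b)))) s s' \<longleftrightarrow> (\<exists>ds. length (rev ds) \<le> B \<and>
    s' = s(RR := map Dig (rev ds) @ s RR, RE0 := map Dig (rev ds) @ s RE0, RE1 := map Dig (rev ds) @ s RE1))"
    unfolding rn_Star_anyb by simp
  then show ?thesis by (metis rev_rev_ident)
qed

text \<open>The last digit is pushed outside the loop, hence the lists are nonempty and may exceed
  the loop bound by one.\<close>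

definition guessed :: "nat \<Rightarrow> bool list option \<Rightarrow> bool" where
  "guessed B t \<longleftrightarrow> (\<forall>ds. t = Some ds \<longrightarrow> ds \<noteq> [] \<and> length ds \<le> Suc B)"

lemma rn_guess:
  "rn B guess s s' \<longleftrightarrow> (\<exists>t. guessed B t \<and> s' = s(RR := Hash # fval t @ Hash # s RR,
      RE0 := Hash # famt (amt0 t) @ Hash # s RE0, RE1 := Hash # famt (amt1 t) @ Hash # s RE1))"
proof -
  let ?f = "\<lambda>t. s(RR := Hash # fval t @ Hash # s RR, RE0 := Hash # famt (amt0 t) @ Hash # s RE0,
      RE1 := Hash # famt (amt1 t) @ Hash # s RE1)"
  have twist: "f(RE0 := x, RR := y) = f(RR := y, RE0 := x)" "f(RE1 := x, RR := y) = f(RR := y, RE1 := x)"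
    "f(RE1 := x, RE0 := y) = f(RE0 := y, RE1 := x)" for f :: stacks and x y
    by auto
  define P where "P a u = u(RR := a # u RR, RE0 := a # u RE0, RE1 := a # u RE1)" for a and u :: stacks
  define Q where "Q ds b u = u(RR := Dig b # map Dig ds @ u RR, RE0 := Dig b # map Dig ds @ Dig False # u RE0,
     RE1 := Dig False # map Dig ds @ Dig False # u RE1)" for ds b and u :: stacks
  have push: "rn B (push3 a) u w \<longleftrightarrow> w = P a u" for a u w
    unfolding push3_def P_def by (simp add: rn_Seq)
  have fin: "rn B (Push RE0 (Dig False) ;; Push RE1 (Dig False) ;; Star (anyb (\<lambda>b. push3 (Dig b))) ;;
      anyb (\<lambda>b. Push RR (Dig b) ;; Push RE0 (Dig b) ;; Push RE1 (Dig False))) u w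
    \<longleftrightarrow> (\<exists>ds. length ds \<le> B \<and> (\<exists>b. w = Q ds b u))" for u w
    unfolding rn_Seq rn_push3_loop ex_state_point1 rn_anyb Q_def by (simp add: twist)
  have "rn B guess s s' \<longleftrightarrow> s' = P Hash (P Omega (P Hash s)) \<or>
      (\<exists>ds. length ds \<le> B \<and> (\<exists>b. s' = P Hash (Q ds b (P Hash s))))"
    unfolding guess_def rn_Seq[of B "push3 Hash"] rn_Seq[of B "Alt _ _"] push rn.simps(5) fin
    by blast
  moreover have "P Hash (P Omega (P Hash s)) = ?f None" "P Hash (Q ds b (P Hash s)) = ?f (Some (b # ds))" for ds b
    unfolding P_def Q_def by (rule ext, simp)+
  ultimately have "rn B guess s s' \<longleftrightarrow> s' = ?f None \<or> (\<exists>ds. length ds \<le> B \<and> (\<exists>b. s' = ?f (Some (b # ds))))"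
    by simp
  then have "rn B guess s s' \<longleftrightarrow> s' = ?f None \<or> (\<exists>b ds. length ds \<le> B \<and> s' = ?f (Some (b # ds)))"
    by blast
  also have "\<dots> \<longleftrightarrow> (\<exists>t. guessed B t \<and> s' = ?f t)"
  proof
    assume "s' = ?f None \<or> (\<exists>b ds. length ds \<le> B \<and> s' = ?f (Some (b # ds)))"
    then show "\<exists>t. guessed B t \<and> s' = ?f t"
    proof (elim disjE exE conjE)
      fix b ds assume "length ds \<le> B" "s' = ?f (Some (b # ds))"
      then show ?thesis by (intro exI[of _ "Some (b # ds)"]) (simp add: guessed_def)
    qed (intro exI[of _ None], simp add: guessed_def)
  next
    assume "\<exists>t. guessed B t \<and> s' = ?f t"
    then obtain t where t: "guessed B t" "s' = ?f t" by blast
    show "s' = ?f None \<or> (\<exists>b ds. length ds \<le> B \<and> s' = ?f (Some (b # ds)))"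
    proof (cases t)
      case (Some ds)
      then show ?thesis using t by (cases ds) (auto simp: guessed_def)
    qed (use t in simp)
  qed
  finally show ?thesis .
qed

lemma rn_vertex:
  assumes "s RX = map Dig (enc_nat a @ enc_nat b @ r)" "s RU = map Dig us" "s RV = []"
    "length us < B" "length (bin a) \<le> B" "length (bin b) \<le> B"
  shows "rn B vertex s s' \<longleftrightarrow> (\<exists>t. guessed B t \<and> s' = s(RX := map Dig r, RR := frec (rev us, t) @ s RR,
      RE0 := fedge (a, amt0 t) @ s RE0, RE1 := fedge (b, amt1 t) @ s RE1, RU := map Dig (inc us)))"
proof -
  let ?u = "\<lambda>t. s(RR := Hash # fval t @ Hash # s RR, RE0 := Hash # famt (amt0 t) @ Hash # s RE0,
      RE1 := Hash # famt (amt1 t) @ Hash # s RE1)"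
  have "rn B (readtok RE0 ;; readtok RE1 ;; emit ;; Push RR Start) (?u t) s' \<longleftrightarrow>
     s' = s(RX := map Dig r, RR := frec (rev us, t) @ s RR,
      RE0 := fedge (a, amt0 t) @ s RE0, RE1 := fedge (b, amt1 t) @ s RE1, RU := map Dig (inc us))" for t
    unfolding rn_Seq
    using assms by (auto simp: rn_readtok[of _ _ a "enc_nat b @ r"] rn_readtok[of _ _ b r] rn_emit[of _ us]
        frec_def fedge_def fun_upd_twist simp del: map_append)
  then show ?thesis
    unfolding vertex_def rn_Seq[of B guess] rn_guess ex_state_point1 by simp
qed

section \<open>Subtracting an edge from the table\<close>

definition anysym :: "(sym \<Rightarrow> com) \<Rightarrow> com" where
  "anysym f = Alt (anyb (\<lambda>b. f (Dig b))) (Alt (f Hash) (Alt (f Start) (f Omega)))"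

lemma rn_anysym [simp]: "rn B (anysym f) s s' \<longleftrightarrow> (\<exists>a. rn B (f a) s s')"
  unfolding anysym_def rn.simps(5) rn_anyb by (metis sym.exhaust)

definition roamstep :: com where
  "roamstep = anysym (\<lambda>a. Alt (Pop RR a ;; Push RL a) (Pop RL a ;; Push RR a))"

text \<open>The registers \<open>RL\<close> and \<open>RR\<close> form a tape with its head between them.\<close>

definition roam :: com where
  "roam = Star roamstep"

lemma upd_order:
  fixes s :: stacks
  shows "s(RR := x, RL := y) = s(RL := y, RR := x)"
    and "E \<noteq> RL \<Longrightarrow> s(RL := x, E := y) = s(E := y, RL := x)"
    and "E \<noteq> RR \<Longrightarrow> s(RR := x, E := y) = s(E := y, RR := x)"
  by auto

lemma ex_state_point_pair: "(\<exists>u. (\<exists>x y. P x y \<and> u = f x y) \<and> R u) \<longleftrightarrow> (\<exists>x y. P x y \<and> R (f x y))"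
  by blast

lemma rn_roamstep:
  "rn B roamstep s s' \<longleftrightarrow> (\<exists>a r. s RR = a # r \<and> s' = s(RL := a # s RL, RR := r)) \<or>
     (\<exists>a r. s RL = a # r \<and> s' = s(RL := r, RR := a # s RR))"
  unfolding roamstep_def rn_anysym rn.simps(5) rn_Seq by (auto simp: upd_order(1))

lemma roam_right: "s RR = us @ r \<Longrightarrow> (rn B roamstep ^^ length us) s (s(RL := rev us @ s RL, RR := r))"
proof (induction us arbitrary: s)
  case (Cons a us)
  let ?u = "s(RL := a # s RL, RR := us @ r)"
  have "rn B roamstep s ?u" using Cons.prems by (simp add: rn_roamstep)
  moreover have "(rn B roamstep ^^ length us) ?u (?u(RL := rev us @ ?u RL, RR := r))"
    by (rule Cons.IH) simp
  moreover have "?u(RL := rev us @ ?u RL, RR := r) = s(RL := rev (a # us) @ s RL, RR := r)"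
    by (rule ext) simp
  ultimately show ?case unfolding length_Cons relpowp_Suc_left by (simp only:) blast
qed (simp add: fun_upd_idem)

lemma roam_left: "s RL = us @ r \<Longrightarrow> (rn B roamstep ^^ length us) s (s(RL := r, RR := rev us @ s RR))"
proof (induction us arbitrary: s)
  case (Cons a us)
  let ?u = "s(RL := us @ r, RR := a # s RR)"
  have "rn B roamstep s ?u" using Cons.prems by (simp add: rn_roamstep)
  moreover have "(rn B roamstep ^^ length us) ?u (?u(RL := r, RR := rev us @ ?u RR))"
    by (rule Cons.IH) simp
  moreover have "?u(RL := r, RR := rev us @ ?u RR) = s(RL := r, RR := rev (a # us) @ s RR)"
    by (rule ext) simp
  ultimately show ?case unfolding length_Cons relpowp_Suc_left by (simp only:) blast
qed (simp add: fun_upd_idem)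

lemma roam_sound:
  "(rn B roamstep ^^ k) s s' \<Longrightarrow> \<exists>L R. rev L @ R = rev (s RL) @ s RR \<and> s' = s(RL := L, RR := R)"
proof (induction k arbitrary: s')
  case 0
  then have "s' = s(RL := s RL, RR := s RR)" by simp
  then show ?case by blast
next
  case (Suc k)
  then obtain u where "(rn B roamstep ^^ k) s u" and u: "rn B roamstep u s'" by auto
  then obtain L R where LR: "rev L @ R = rev (s RL) @ s RR" "u = s(RL := L, RR := R)"
    using Suc.IH by blast
  from u consider a r where "R = a # r" "s' = u(RL := a # L, RR := r)"
    | a r where "L = a # r" "s' = u(RL := r, RR := a # R)"
    unfolding rn_roamstep LR(2) by auto
  then show ?case
  proof cases
    case 1
    then have "s' = s(RL := a # L, RR := r)" unfolding LR(2) by (simp add: upd_order(1))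
    moreover have "rev (a # L) @ r = rev (s RL) @ s RR" using 1(1) LR(1) by simp
    ultimately show ?thesis by blast
  next
    case 2
    then have "s' = s(RL := r, RR := a # R)" unfolding LR(2) by (simp add: upd_order(1))
    moreover have "rev r @ a # R = rev (s RL) @ s RR" using 2(1) LR(1) by simp
    ultimately show ?thesis by blast
  qed
qed

text \<open>Every head position is reached by a straight walk, whose length is at most that of the
  tape.\<close>

lemma rn_roam:
  assumes "length (s RL) + length (s RR) \<le> B"
  shows "rn B roam s s' \<longleftrightarrow> (\<exists>L R. rev L @ R = rev (s RL) @ s RR \<and> s' = s(RL := L, RR := R))"
proof
  show "rn B roam s s' \<Longrightarrow> \<exists>L R. rev L @ R = rev (s RL) @ s RR \<and> s' = s(RL := L, RR := R)"
    unfolding roam_def rn.simps(6) using roam_sound by blast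
next
  assume "\<exists>L R. rev L @ R = rev (s RL) @ s RR \<and> s' = s(RL := L, RR := R)"
  then obtain L R where LR: "rev L @ R = rev (s RL) @ s RR" and s': "s' = s(RL := L, RR := R)" by blast
  from LR obtain us where "rev L = rev (s RL) @ us \<and> us @ R = s RR \<or> rev L @ us = rev (s RL) \<and> R = us @ s RR"
    unfolding append_eq_append_conv2 by blast
  then consider "L = rev us @ s RL" "s RR = us @ R" | "s RL = rev us @ L" "R = us @ s RR"
    by (metis rev_append rev_rev_ident)
  then have "\<exists>k\<le>B. (rn B roamstep ^^ k) s s'"
  proof cases
    case 1
    then show ?thesis using roam_right[of s us R B] s' assms by (intro exI[of _ "length us"]) simp
  next
    case 2
    then show ?thesis using roam_left[of s "rev us" L B] s' assms by (intro exI[of _ "length us"]) simp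
  qed
  then show "rn B roam s s'" unfolding roam_def by (simp add: rn.simps(6))
qed

definition matching :: "reg \<Rightarrow> com" where
  "matching E = Star (anyb (\<lambda>b. Pop E (Dig b) ;; Pop RR (Dig b) ;; Push RL (Dig b)))"

text \<open>Moves to the record whose index is on top of \<open>E\<close>.\<close>

definition seek :: "reg \<Rightarrow> com" where
  "seek E = roam ;; Pop RR Start ;; Push RL Start ;; matching E ;; Pop E Hash ;; Pop RR Hash ;; Push RL Hash"

definition flat :: "(bool list \<times> bool list option) list \<Rightarrow> sym list" where
  "flat recs = concat (map frec recs)"

lemma flat_simps [simp]: "flat [] = []" "flat (r # recs) = frec r @ flat recs"
  "flat (recs @ recs') = flat recs @ flat recs'"
  by (simp_all add: flat_def)

lemma rn_matching:
  assumes E: "E \<noteq> RL" "E \<noteq> RR"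
  shows "rn B (matching E) s s' \<longleftrightarrow> (\<exists>ds. length ds \<le> B \<and> (\<exists>x y. s E = map Dig ds @ x \<and> s RR = map Dig ds @ y \<and>
    s' = s(E := x, RL := map Dig (rev ds) @ s RL, RR := y)))"
proof -
  note upd = upd_order(1) upd_order(2)[OF E(1)] upd_order(3)[OF E(2)]
  have step: "rn B (Pop E (Dig b) ;; Pop RR (Dig b) ;; Push RL (Dig b)) s s' \<longleftrightarrow>
    (\<exists>x y. s E = Dig b # x \<and> s RR = Dig b # y \<and> s' = s(E := x, RL := Dig b # s RL, RR := y))" for b s s'
    using E by (auto simp: rn_Seq upd)
  have "path (\<lambda>b. rn B (Pop E (Dig b) ;; Pop RR (Dig b) ;; Push RL (Dig b))) ds s s' \<longleftrightarrow>
    (\<exists>x y. s E = map Dig ds @ x \<and> s RR = map Dig ds @ y \<and>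
    s' = s(E := x, RL := map Dig (rev ds) @ s RL, RR := y))" for ds s
  proof (induction ds arbitrary: s)
    case Nil
    then show ?case by (auto simp: fun_upd_idem)
  next
    case (Cons b ds)
    show ?case unfolding path.simps relcompp_apply Cons.IH unfolding step using E by (auto simp: upd intro!: ext)
  qed
  then show ?thesis unfolding matching_def rn_Star_anyb by simp
qed

text \<open>Since no other part of a record contains \<open>Start\<close>, popping it proves that
  the head stood at a record boundary.\<close>

lemma flat_Start:
  assumes "flat recs = A @ Start # C"
  shows "\<exists>pre post. recs = pre @ post \<and> A = flat pre \<and> Start # C = flat post"
  using assms
proof (induction recs arbitrary: A)
  case (Cons r recs)
  obtain i v where r: "r = (i, v)" by (cases r)
  have no: "Start \<notin> set (map Dig i @ Hash # fval v @ [Hash])" by (cases v) auto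
  show ?case
  proof (cases A)
    case Nil
    then show ?thesis using Cons.prems by (intro exI[of _ "[]"] exI[of _ "r # recs"]) simp
  next
    case (Cons a A')
    then have a: "a = Start" "(map Dig i @ Hash # fval v @ [Hash]) @ flat recs = A' @ Start # C"
      using \<open>flat (r # recs) = _\<close> by (auto simp: r frec_def)
    from a(2) obtain us where us: "(map Dig i @ Hash # fval v @ [Hash]) = A' @ us \<and> us @ flat recs = Start # C
       \<or> (map Dig i @ Hash # fval v @ [Hash]) @ us = A' \<and> flat recs = us @ Start # C"
      unfolding append_eq_append_conv2 by blast
    then show ?thesis
    proof
      assume *: "(map Dig i @ Hash # fval v @ [Hash]) = A' @ us \<and> us @ flat recs = Start # C"
      have "us = []"
      proof (rule ccontr)
        assume "us \<noteq> []"
        then have "Start \<in> set us" using * by (cases us) auto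
        then have "Start \<in> set (A' @ us)" by simp
        then show False using * no by metis
      qed
      then show ?thesis using * Cons a(1)
        by (intro exI[of _ "[r]"] exI[of _ recs]) (simp add: r frec_def)
    next
      assume *: "(map Dig i @ Hash # fval v @ [Hash]) @ us = A' \<and> flat recs = us @ Start # C"
      then obtain pre post where "recs = pre @ post" "us = flat pre" "Start # C = flat post"
        using Cons.IH by blast
      then show ?thesis using * Cons a(1)
        by (intro exI[of _ "r # pre"] exI[of _ post]) (auto simp: r frec_def)
    qed
  qed
qed simp

text \<open>The head position is guessed; \<open>Hash\<close> after the index on both stacks forces
  the whole index to match, so a wrong guess fails.\<close>

lemma rn_seek:
  assumes E: "E \<noteq> RL" "E \<noteq> RR" and tape: "rev (s RL) @ s RR = flat recs"
    and sE: "s E = map Dig i @ Hash # x" and B: "length (flat recs) \<le> B" "length i \<le> B"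
  shows "rn B (seek E) s s' \<longleftrightarrow> (\<exists>pre v post. recs = pre @ (i, v) # post \<and>
    s' = s(E := x, RL := Hash # map Dig (rev i) @ Start # rev (flat pre), RR := fval v @ Hash # flat post))"
proof -
  note upd = upd_order(1) upd_order(2)[OF E(1)] upd_order(3)[OF E(2)]
  have "length (rev (s RL) @ s RR) \<le> B" unfolding tape by (rule B(1))
  then have "length (s RL) + length (s RR) \<le> B" by simp
  note roam = rn_roam[of s B, OF this]
  let ?rest = "matching E ;; Pop E Hash ;; Pop RR Hash ;; Push RL Hash"
  have 0: "rn B (Pop RR Start ;; Push RL Start ;; ?rest) (s(RL := L, RR := R)) s'
    \<longleftrightarrow> (\<exists>C. R = Start # C \<and> rn B ?rest (s(RL := Start # L, RR := C)) s')" for L R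
    unfolding rn_Seq[of B "Pop RR Start"] rn_Seq[of B "Push RL Start"] by (auto simp: upd)
  have 1: "rn B (seek E) s s' \<longleftrightarrow> (\<exists>L C. rev L @ Start # C = flat recs \<and> rn B ?rest (s(RL := Start # L, RR := C)) s')"
    unfolding seek_def rn_Seq[of B roam] roam tape ex_state_point_pair 0 by blast
  have 2: "rn B ?rest (s(RL := L, RR := C)) s' \<longleftrightarrow> (\<exists>y. C = map Dig i @ Hash # y \<and>
      s' = s(E := x, RL := Hash # map Dig (rev i) @ L, RR := y))" for L C
  proof
    assume "rn B ?rest (s(RL := L, RR := C)) s'"
    then obtain ds z y where *: "map Dig i @ Hash # x = map Dig ds @ Hash # z" "C = map Dig ds @ Hash # y"
      "s' = s(E := z, RL := Hash # map Dig (rev ds) @ L, RR := y)"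
      unfolding rn_Seq rn_matching[OF E] using E sE by (auto simp: upd)
    then have "ds = i" "z = x" using map_Dig_append_eq[of Hash Hash i x ds z] by auto
    then show "\<exists>y. C = map Dig i @ Hash # y \<and> s' = s(E := x, RL := Hash # map Dig (rev i) @ L, RR := y)"
      using * by blast
  next
    assume "\<exists>y. C = map Dig i @ Hash # y \<and> s' = s(E := x, RL := Hash # map Dig (rev i) @ L, RR := y)"
    then obtain y where y: "C = map Dig i @ Hash # y" "s' = s(E := x, RL := Hash # map Dig (rev i) @ L, RR := y)" by blast
    have "rn B (matching E) (s(RL := L, RR := C)) (s(E := Hash # x, RL := map Dig (rev i) @ L, RR := Hash # y))"
      unfolding rn_matching[OF E] using B(2) y(1) sE E
      
      by (intro exI[of _ i] conjI, simp, rule_tac x = "Hash # x" in exI, rule_tac x = "Hash # y" in exI) (simp add: upd)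
    moreover have "rn B (Pop E Hash ;; Pop RR Hash ;; Push RL Hash)
        (s(E := Hash # x, RL := map Dig (rev i) @ L, RR := Hash # y)) s'"
      unfolding rn_Seq y(2) using E by (simp add: upd)
    ultimately show "rn B ?rest (s(RL := L, RR := C)) s'" unfolding rn_Seq[of B "matching E"] by blast
  qed
  show ?thesis
  proof
    assume "rn B (seek E) s s'"
    then obtain L C y where *: "rev L @ Start # C = flat recs" "C = map Dig i @ Hash # y"
      "s' = s(E := x, RL := Hash # map Dig (rev i) @ Start # L, RR := y)"
      unfolding 1 2 by blast
    from flat_Start[OF *(1)[symmetric]] obtain pre post where
      p: "recs = pre @ post" "rev L = flat pre" "Start # C = flat post" by blast
    then obtain j v post' where post: "post = (j, v) # post'" by (cases post) auto
    then have "map Dig i @ Hash # y = map Dig j @ Hash # fval v @ Hash # flat post'"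
      using p(3) *(2) by (simp add: frec_def)
    then have "i = j" "y = fval v @ Hash # flat post'"
      using map_Dig_append_eq[of Hash Hash i y j "fval v @ Hash # flat post'"] by auto
    moreover have "L = rev (flat pre)" using p(2) by (metis rev_rev_ident)
    ultimately show "\<exists>pre v post. recs = pre @ (i, v) # post \<and>
        s' = s(E := x, RL := Hash # map Dig (rev i) @ Start # rev (flat pre), RR := fval v @ Hash # flat post)"
      using p(1) post *(3) by blast
  next
    assume "\<exists>pre v post. recs = pre @ (i, v) # post \<and>
        s' = s(E := x, RL := Hash # map Dig (rev i) @ Start # rev (flat pre), RR := fval v @ Hash # flat post)"
    then obtain pre v post where p: "recs = pre @ (i, v) # post"
      "s' = s(E := x, RL := Hash # map Dig (rev i) @ Start # rev (flat pre), RR := fval v @ Hash # flat post)" by blast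
    show "rn B (seek E) s s'" unfolding 1 2
      using p 
      by (rule_tac x = "rev (flat pre)" in exI, rule_tac x = "map Dig i @ Hash # fval v @ Hash # flat post" in exI)
        (simp add: frec_def)
  qed
qed

section \<open>Binary subtraction with borrow\<close>

definition brw :: "bool \<Rightarrow> bool \<Rightarrow> bool \<Rightarrow> bool" where
  "brw b a r = (if r then a \<and> b else a \<or> b)"

fun diff :: "bool \<Rightarrow> bool list \<Rightarrow> bool list \<Rightarrow> bool list" where
  "diff b (a # cs) (r # rs) = (r \<noteq> (a \<noteq> b)) # diff (brw b a r) cs rs"
| "diff b _ _ = []"

fun borrow :: "bool \<Rightarrow> bool list \<Rightarrow> bool list \<Rightarrow> bool" where
  "borrow b (a # cs) (r # rs) = borrow (brw b a r) cs rs"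
| "borrow b _ _ = b"

text \<open>The invariant of schoolbook subtraction: a final borrow records that one unit of weight
  \<open>2 ^ length rs\<close> was lent.\<close>

lemma diff_borrow:
  "length cs = length rs \<Longrightarrow> length (diff b cs rs) = length rs \<and>
    val (diff b cs rs) + val cs + of_bool b = val rs + of_bool (borrow b cs rs) * 2 ^ length rs"
proof (induction b cs rs rule: diff.induct)
  case (1 b a cs r rs)
  then have "length (diff (brw b a r) cs rs) = length rs"
    "val (diff (brw b a r) cs rs) + val cs + of_bool (brw b a r) = val rs + of_bool (borrow (brw b a r) cs rs) * 2 ^ length rs"
    by auto
  then show ?case by (cases b; cases a; cases r) (auto simp: brw_def algebra_simps)
qed auto

lemma borrow_iff:
  assumes "length cs = length rs"
  shows "borrow b cs rs \<longleftrightarrow> val rs < val cs + of_bool b"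
  using diff_borrow[OF assms, of b] val_less[of "diff b cs rs"]
  by (cases "borrow b cs rs") auto

definition substep :: "reg \<Rightarrow> bool \<Rightarrow> com" where
  "substep E r = anyb (\<lambda>a. anyb (\<lambda>b. Pop E (Dig b) ;; Pop E (Dig a) ;; Pop RR (Dig r) ;;
     Push RL (Dig (r \<noteq> (a \<noteq> b))) ;; Push E (Dig (brw b a r))))"

text \<open>The borrow lies on top of \<open>E\<close>. Popping a borrow \<open>False\<close> at the end asserts that the result
  is nonnegative.\<close>

definition subtract :: "reg \<Rightarrow> com" where
  "subtract E = Star (anyb (substep E)) ;; Pop E (Dig False) ;; Pop E Hash ;; Pop RR Hash ;; Push RL Hash"

lemma rn_substep:
  assumes E: "E \<noteq> RL" "E \<noteq> RR"
  shows "rn B (substep E r) s s' \<longleftrightarrow> (\<exists>a b x y. s E = Dig b # Dig a # x \<and> s RR = Dig r # y \<and>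
    s' = s(E := Dig (brw b a r) # x, RL := Dig (r \<noteq> (a \<noteq> b)) # s RL, RR := y))"
proof -
  note upd = upd_order(1) upd_order(2)[OF E(1)] upd_order(3)[OF E(2)]
  show ?thesis unfolding substep_def rn_anyb rn_Seq using E by (auto simp: upd)
qed

text \<open>As with the counter, the loop may stop after any prefix \<open>ds\<close>; the tests
  behind it single out the complete pass.\<close>

lemma rn_subloop:
  assumes E: "E \<noteq> RL" "E \<noteq> RR" and s: "s E = Dig b # map Dig cs @ Hash # x" "s RR = map Dig rs @ Hash # y"
  shows "path (\<lambda>r. rn B (substep E r)) ds s s' \<longleftrightarrow> (\<exists>cs1 cs2 rs2. cs = cs1 @ cs2 \<and> rs = ds @ rs2 \<and>
    length cs1 = length ds \<and> s' = s(E := Dig (borrow b cs1 ds) # map Dig cs2 @ Hash # x,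
      RL := map Dig (rev (diff b cs1 ds)) @ s RL, RR := map Dig rs2 @ Hash # y))"
  using s
proof (induction ds arbitrary: s b cs rs)
  case Nil
  have eq: "s(E := Dig b # map Dig cs @ Hash # x, RL := s RL, RR := map Dig rs @ Hash # y) = s"
    unfolding Nil[symmetric] by (simp only: fun_upd_triv)
  show ?case
  proof
    assume "path (\<lambda>r. rn B (substep E r)) [] s s'"
    then have "s' = s(E := Dig b # map Dig cs @ Hash # x, RL := s RL, RR := map Dig rs @ Hash # y)"
      unfolding eq by simp
    then show "\<exists>cs1 cs2 rs2. cs = cs1 @ cs2 \<and> rs = [] @ rs2 \<and> length cs1 = length ([] :: bool list) \<and>
        s' = s(E := Dig (borrow b cs1 []) # map Dig cs2 @ Hash # x,
          RL := map Dig (rev (diff b cs1 [])) @ s RL, RR := map Dig rs2 @ Hash # y)"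
      by (rule_tac x = "[]" in exI, rule_tac x = cs in exI, rule_tac x = rs in exI)
        (simp del: fun_upd_apply)
  next
    assume "\<exists>cs1 cs2 rs2. cs = cs1 @ cs2 \<and> rs = [] @ rs2 \<and> length cs1 = length ([] :: bool list) \<and>
        s' = s(E := Dig (borrow b cs1 []) # map Dig cs2 @ Hash # x,
          RL := map Dig (rev (diff b cs1 [])) @ s RL, RR := map Dig rs2 @ Hash # y)"
    then have "s' = s(E := Dig b # map Dig cs @ Hash # x, RL := s RL, RR := map Dig rs @ Hash # y)"
      by (elim exE conjE) (simp del: fun_upd_apply)
    then show "path (\<lambda>r. rn B (substep E r)) [] s s'"
      unfolding eq by simp
  qed
next
  case (Cons r ds)
  note upd = upd_order(1) upd_order(2)[OF E(1)] upd_order(3)[OF E(2)]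
  define Q where "Q cs1 cs2 rs2 \<longleftrightarrow> s' = s(E := Dig (borrow b cs1 (r # ds)) # map Dig cs2 @ Hash # x,
      RL := map Dig (rev (diff b cs1 (r # ds))) @ s RL, RR := map Dig rs2 @ Hash # y)" for cs1 cs2 rs2
  have "path (\<lambda>r. rn B (substep E r)) (r # ds) s s' \<longleftrightarrow>
        (\<exists>cs1 cs2 rs2. cs = cs1 @ cs2 \<and> rs = (r # ds) @ rs2 \<and> length cs1 = length (r # ds) \<and> Q cs1 cs2 rs2)"
  proof (cases "\<exists>a cs' rs'. cs = a # cs' \<and> rs = r # rs'")
    case True
    then obtain a cs' rs' where cs: "cs = a # cs'" "rs = r # rs'" by blast
    let ?u = "s(E := Dig (brw b a r) # map Dig cs' @ Hash # x, RL := Dig (r \<noteq> (a \<noteq> b)) # s RL,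
      RR := map Dig rs' @ Hash # y)"
    have 1: "path (\<lambda>r. rn B (substep E r)) (r # ds) s s' \<longleftrightarrow> path (\<lambda>r. rn B (substep E r)) ds ?u s'"
      unfolding path.simps relcompp_apply rn_substep[OF E, of B r s] Cons.prems cs by auto
    have 2: "?u E = Dig (brw b a r) # map Dig cs' @ Hash # x" "?u RR = map Dig rs' @ Hash # y"
      using E by auto
    have 3: "?u(E := X, RL := map Dig (rev (diff (brw b a r) cs1 ds)) @ ?u RL, RR := Y)
       = s(E := X, RL := map Dig (rev (diff b (a # cs1) (r # ds))) @ s RL, RR := Y)" for X Y cs1
      by (rule ext) simp
    have 4: "(\<exists>cs1 cs2 rs2. cs = cs1 @ cs2 \<and> rs = (r # ds) @ rs2 \<and> length cs1 = length (r # ds) \<and> Q cs1 cs2 rs2)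
      \<longleftrightarrow> (\<exists>cs1 cs2 rs2. cs' = cs1 @ cs2 \<and> rs' = ds @ rs2 \<and> length cs1 = length ds \<and> Q (a # cs1) cs2 rs2)" for Q
    proof
      assume "\<exists>cs1 cs2 rs2. cs = cs1 @ cs2 \<and> rs = (r # ds) @ rs2 \<and> length cs1 = length (r # ds) \<and> Q cs1 cs2 rs2"
      then obtain cs1 cs2 rs2 where *: "cs = cs1 @ cs2" "rs = (r # ds) @ rs2" "length cs1 = length (r # ds)" "Q cs1 cs2 rs2"
        by blast
      then obtain cs1' where "cs1 = a # cs1'" unfolding cs by (cases cs1) auto
      then have "cs' = cs1' @ cs2" "rs' = ds @ rs2" "length cs1' = length ds" "Q (a # cs1') cs2 rs2"
        using * unfolding cs by simp_all
      then show "\<exists>cs1 cs2 rs2. cs' = cs1 @ cs2 \<and> rs' = ds @ rs2 \<and> length cs1 = length ds \<and> Q (a # cs1) cs2 rs2"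
        by blast
    next
      assume "\<exists>cs1 cs2 rs2. cs' = cs1 @ cs2 \<and> rs' = ds @ rs2 \<and> length cs1 = length ds \<and> Q (a # cs1) cs2 rs2"
      then obtain cs1 cs2 rs2 where *: "cs' = cs1 @ cs2" "rs' = ds @ rs2" "length cs1 = length ds" "Q (a # cs1) cs2 rs2"
        by blast
      then have "cs = (a # cs1) @ cs2" "rs = (r # ds) @ rs2" "length (a # cs1) = length (r # ds)"
        unfolding cs by auto
      then show "\<exists>cs1 cs2 rs2. cs = cs1 @ cs2 \<and> rs = (r # ds) @ rs2 \<and> length cs1 = length (r # ds) \<and> Q cs1 cs2 rs2"
        using *(4) by blast
    qed
    have 5: "path (\<lambda>r. rn B (substep E r)) ds ?u s' \<longleftrightarrow>
        (\<exists>cs1 cs2 rs2. cs' = cs1 @ cs2 \<and> rs' = ds @ rs2 \<and> length cs1 = length ds \<and> Q (a # cs1) cs2 rs2)"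
      unfolding Cons.IH[OF 2] Q_def 3 borrow.simps(1) by (rule refl)
    show ?thesis
      by (rule trans[OF trans[OF 1 5] 4[of Q, symmetric]])
  next
    case False
    have "\<not> path (\<lambda>r. rn B (substep E r)) (r # ds) s s'"
    proof
      assume "path (\<lambda>r. rn B (substep E r)) (r # ds) s s'"
      then obtain u where "rn B (substep E r) s u" by auto
      then obtain a b' z w where "map Dig cs @ Hash # x = Dig a # z" "map Dig rs @ Hash # y = Dig r # w"
        unfolding rn_substep[OF E] Cons.prems by blast
      then show False using False by (cases cs; cases rs) auto
    qed
    moreover have "\<not> (\<exists>cs1 cs2 rs2. cs = cs1 @ cs2 \<and> rs = (r # ds) @ rs2 \<and> length cs1 = length (r # ds) \<and> Q cs1 cs2 rs2)"
    proof
      assume "\<exists>cs1 cs2 rs2. cs = cs1 @ cs2 \<and> rs = (r # ds) @ rs2 \<and> length cs1 = length (r # ds) \<and> Q cs1 cs2 rs2"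
      then obtain cs1 cs2 rs2 where *: "cs = cs1 @ cs2" "rs = (r # ds) @ rs2" "length cs1 = length (r # ds)"
        by blast
      then obtain a cs1' where "cs1 = a # cs1'" by (cases cs1) simp_all
      then show False using False * by simp
    qed
    ultimately show ?thesis by (simp only:)
  qed
  then show ?case unfolding Q_def .
qed

text \<open>Both stacks must show \<open>Hash\<close> when the loop ends, which forces equal widths.
  For this reason the amounts are written with the width of the weights.\<close>

lemma rn_subtract:
  assumes E: "E \<noteq> RL" "E \<noteq> RR" and s: "s E = Dig b # map Dig cs @ Hash # x" "s RR = map Dig rs @ Hash # y"
    and B: "length rs \<le> B"
  shows "rn B (subtract E) s s' \<longleftrightarrow> length cs = length rs \<and> val cs + of_bool b \<le> val rs \<and>
    s' = s(E := x, RL := Hash # map Dig (rev (diff b cs rs)) @ s RL, RR := y)"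
proof -
  let ?end = "Pop E (Dig False) ;; Pop E Hash ;; Pop RR Hash ;; Push RL Hash"
  have e: "rn B ?end (s(E := Dig b' # map Dig cs' @ Hash # x, RL := l, RR := map Dig rs' @ Hash # y)) s'
     \<longleftrightarrow> \<not> b' \<and> cs' = [] \<and> rs' = [] \<and> s' = s(E := x, RL := Hash # l, RR := y)" for b' cs' rs' l
  proof -
    have "s(E := p, RL := l, RR := q, E := p', E := x, RR := y, RL := Hash # l)
       = s(E := x, RL := Hash # l, RR := y)" for p q p'
      using E by (intro ext) simp
    then show ?thesis unfolding rn_Seq using E
      by (cases cs'; cases rs') (auto simp del: fun_upd_apply simp: fun_upd_same fun_upd_other)
  qed
  show ?thesis
  proof
    assume "rn B (subtract E) s s'"
    then obtain ds w where "path (\<lambda>r. rn B (substep E r)) ds s w" "rn B ?end w s'"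
      unfolding subtract_def rn_Seq[of B "Star _"] rn_Star_anyb by blast
    then obtain cs1 cs2 rs2 where *: "cs = cs1 @ cs2" "rs = ds @ rs2" "length cs1 = length ds"
      "rn B ?end (s(E := Dig (borrow b cs1 ds) # map Dig cs2 @ Hash # x,
        RL := map Dig (rev (diff b cs1 ds)) @ s RL, RR := map Dig rs2 @ Hash # y)) s'"
      unfolding rn_subloop[OF E s] by blast
    then show "length cs = length rs \<and> val cs + of_bool b \<le> val rs \<and>
        s' = s(E := x, RL := Hash # map Dig (rev (diff b cs rs)) @ s RL, RR := y)"
      using borrow_iff[of cs1 ds b] unfolding e by auto
  next
    assume *: "length cs = length rs \<and> val cs + of_bool b \<le> val rs \<and>
        s' = s(E := x, RL := Hash # map Dig (rev (diff b cs rs)) @ s RL, RR := y)"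
    then have nb: "\<not> borrow b cs rs" using borrow_iff[of cs rs b] by auto
    let ?w = "s(E := Dig (borrow b cs rs) # map Dig [] @ Hash # x,
        RL := map Dig (rev (diff b cs rs)) @ s RL, RR := map Dig [] @ Hash # y)"
    have "path (\<lambda>r. rn B (substep E r)) rs s ?w"
      unfolding rn_subloop[OF E s] using * by (metis append_Nil2)
    then have "rn B (Star (anyb (substep E))) s ?w" unfolding rn_Star_anyb using B by blast
    moreover have "rn B ?end ?w s'" unfolding e using * nb by simp
    ultimately show "rn B (subtract E) s s'"
      unfolding subtract_def rn_Seq[of B "Star _"] by blast
  qed
qed

lemma rn_subtract_Omega:
  assumes E: "E \<noteq> RL" "E \<noteq> RR" and s: "s E = Omega # x \<or> s RR = Omega # y"
  shows "\<not> rn B (subtract E) s s'"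
proof
  assume "rn B (subtract E) s s'"
  then obtain ds w where w: "path (\<lambda>r. rn B (substep E r)) ds s w"
    "rn B (Pop E (Dig False) ;; Pop E Hash ;; Pop RR Hash ;; Push RL Hash) w s'"
    unfolding subtract_def rn_Seq[of B "Star _"] rn_Star_anyb by blast
  show False
  proof (cases ds)
    case Nil
    then show False using w E s by (auto simp: rn_Seq)
  next
    case (Cons r ds')
    then obtain u where "rn B (substep E r) s u" using w(1) by auto
    then show False unfolding rn_substep[OF E] using s by auto
  qed
qed

definition discard :: "reg \<Rightarrow> com" where
  "discard E = Alt (Pop E Omega) (Star (anyb (\<lambda>b. Pop E (Dig b))))"

lemma rn_discard:
  assumes "s E = famt c @ Hash # x" "length (famt c) \<le> B"
  shows "rn B (discard E ;; Pop E Hash) s s' \<longleftrightarrow> s' = s(E := x)"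
proof -
  have p: "path (\<lambda>b. rn B (Pop E (Dig b))) ds s s' \<longleftrightarrow> (\<exists>r. s E = map Dig ds @ r \<and> s' = s(E := r))" for ds s s'
    by (induction ds arbitrary: s) (auto simp: fun_upd_idem)
  have star: "rn B (Star (anyb (\<lambda>b. Pop E (Dig b)))) s u \<longleftrightarrow> (\<exists>ds r. length ds \<le> B \<and> s E = map Dig ds @ r \<and> u = s(E := r))" for u
    unfolding rn_Star_anyb p by blast
  have *: "rn B (discard E ;; Pop E Hash) s s' \<longleftrightarrow> (\<exists>r. s E = Omega # Hash # r \<and> s' = s(E := r)) \<or>
     (\<exists>ds r. length ds \<le> B \<and> s E = map Dig ds @ Hash # r \<and> s' = s(E := r))"
  proof
    assume "rn B (discard E ;; Pop E Hash) s s'"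
    then obtain u r' where u: "rn B (Pop E Omega) s u \<or> rn B (Star (anyb (\<lambda>b. Pop E (Dig b)))) s u"
      and r': "u E = Hash # r'" "s' = u(E := r')"
      unfolding discard_def rn_Seq rn.simps(5) by (auto simp only: rn.simps(1))
    from u show "(\<exists>r. s E = Omega # Hash # r \<and> s' = s(E := r)) \<or>
       (\<exists>ds r. length ds \<le> B \<and> s E = map Dig ds @ Hash # r \<and> s' = s(E := r))"
    proof
      assume "rn B (Pop E Omega) s u"
      then obtain r where "s E = Omega # r" "u = s(E := r)" by auto
      then have "s E = Omega # Hash # r'" "s' = s(E := r')" using r' by simp_all
      then show ?thesis by blast
    next
      assume "rn B (Star (anyb (\<lambda>b. Pop E (Dig b)))) s u"
      then obtain ds r where "length ds \<le> B" "s E = map Dig ds @ r" "u = s(E := r)"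
        unfolding star by blast
      then have "length ds \<le> B" "s E = map Dig ds @ Hash # r'" "s' = s(E := r')" using r' by simp_all
      then show ?thesis by blast
    qed
  next
    assume "(\<exists>r. s E = Omega # Hash # r \<and> s' = s(E := r)) \<or>
       (\<exists>ds r. length ds \<le> B \<and> s E = map Dig ds @ Hash # r \<and> s' = s(E := r))"
    then show "rn B (discard E ;; Pop E Hash) s s'"
    proof (elim disjE exE conjE)
      fix r assume "s E = Omega # Hash # r" "s' = s(E := r)"
      then have "rn B (Pop E Omega) s (s(E := Hash # r))" "rn B (Pop E Hash) (s(E := Hash # r)) s'"
        by simp_all
      then show ?thesis unfolding discard_def rn_Seq rn.simps(5) by blast
    next
      fix ds r assume "length ds \<le> B" "s E = map Dig ds @ Hash # r" "s' = s(E := r)"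
      then have "rn B (Star (anyb (\<lambda>b. Pop E (Dig b)))) s (s(E := Hash # r))"
        "rn B (Pop E Hash) (s(E := Hash # r)) s'"
        unfolding star by (blast, simp)
      then show ?thesis unfolding discard_def rn_Seq rn.simps(5) by blast
    qed
  qed
  show ?thesis
  proof (cases c)
    case None
    then have sE: "s E = Omega # Hash # x" using assms(1) by simp
    have "Omega # Hash # x \<noteq> map Dig ds @ Hash # r" for ds r by (cases ds) auto
    then show ?thesis unfolding * sE by auto
  next
    case (Some p)
    obtain b cs where c: "c = Some (b, cs)" using Some by (cases p) auto
    have sE: "s E = map Dig (b # cs) @ Hash # x" and len: "length (b # cs) \<le> B" using assms c by auto
    have e1: "s E = map Dig ds @ Hash # r \<longleftrightarrow> b # cs = ds \<and> x = r" for ds r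
      unfolding sE using map_Dig_append_eq[of Hash Hash "b # cs" x ds r] by (simp only: sym.distinct) blast
    have e2: "(s E = Omega # Hash # r) = False" for r unfolding sE by simp
    show ?thesis unfolding * e1 e2 using len by (simp only: simp_thms) blast
  qed
qed

text \<open>Removes the edge on top of \<open>E\<close> and subtracts its amount from the record of its target.\<close>

definition sub :: "reg \<Rightarrow> com" where
  "sub E = seek E ;; Alt (Pop RR Omega ;; Push RL Omega ;; discard E ;; Pop E Hash) (subtract E)"

text \<open>An infinite target absorbs every amount, whereas an infinite amount is blocked at a
  finite target; the second clause thus enforces the predecessor condition of
  \<open>certificate\<close>.\<close>

fun subv :: "(bool \<times> bool list) option \<Rightarrow> bool list option \<Rightarrow> bool list option \<Rightarrow> bool" where
  "subv c None v' \<longleftrightarrow> v' = None"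
| "subv None (Some rs) v' \<longleftrightarrow> False"
| "subv (Some (b, cs)) (Some rs) v' \<longleftrightarrow>
    length cs = length rs \<and> val cs + of_bool b \<le> val rs \<and> v' = Some (diff b cs rs)"

text \<open>The final head position is left open: the next edge depends only on the contents of the
  table.\<close>

lemma rn_sub:
  assumes E: "E \<noteq> RL" "E \<noteq> RR" and tape: "rev (s RL) @ s RR = flat recs"
    and sE: "s E = map Dig i @ Hash # famt c @ Hash # x"
    and B: "length (flat recs) \<le> B" "length i \<le> B" "length (famt c) \<le> B"
  shows "rn B (sub E) s s' \<Longrightarrow> \<exists>pre v post v' L R. recs = pre @ (i, v) # post \<and> subv c v v' \<and>
      rev L @ R = flat (pre @ (i, v') # post) \<and> s' = s(E := x, RL := L, RR := R)"
    and "recs = pre @ (i, v) # post \<Longrightarrow> subv c v v' \<Longrightarrow>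
      \<exists>L R. rev L @ R = flat (pre @ (i, v') # post) \<and> rn B (sub E) s (s(E := x, RL := L, RR := R))"
proof -
  define w where "w pre v post = s(E := famt c @ Hash # x, RL := Hash # map Dig (rev i) @ Start # rev (flat pre),
     RR := fval v @ Hash # flat post)" for pre v post
  have seek: "rn B (seek E) s t \<longleftrightarrow> (\<exists>pre v post. recs = pre @ (i, v) # post \<and> t = w pre v post)" for t
    unfolding w_def using rn_seek[OF E tape sE B(1,2)] by simp
  let ?alt = "Alt (Pop RR Omega ;; Push RL Omega ;; discard E ;; Pop E Hash) (subtract E)"
  have alt: "rn B ?alt (w pre v post) s' \<longleftrightarrow> (\<exists>v'. subv c v v' \<and>
      (\<exists>L R. (case v of None \<Rightarrow> L = Omega # Hash # map Dig (rev i) @ Start # rev (flat pre) \<and> R = Hash # flat post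
         | Some rs \<Rightarrow> L = Hash # rev (fval v') @ Hash # map Dig (rev i) @ Start # rev (flat pre) \<and> R = flat post) \<and>
       s' = s(E := x, RL := L, RR := R)))" if "recs = pre @ (i, v) # post" for pre v post s'
  proof (cases v)
    case None
    have wE: "w pre v post RR = Omega # Hash # flat post" using None E by (simp add: w_def)
    let ?w = "s(E := famt c @ Hash # x, RL := Omega # Hash # map Dig (rev i) @ Start # rev (flat pre), RR := Hash # flat post)"
    have 1: "(w pre v post)(RR := Hash # flat post, RL := Omega # w pre v post RL) = ?w"
      unfolding w_def using E by (intro ext) simp
    have 2: "rn B (discard E ;; Pop E Hash) ?w s' \<longleftrightarrow> s' = ?w(E := x)"
      by (rule rn_discard[OF _ B(3)]) (use E in simp)
    have 3: "?w(E := x) = s(E := x, RL := Omega # Hash # map Dig (rev i) @ Start # rev (flat pre), RR := Hash # flat post)"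
      using E by (intro ext) simp
    have "rn B (Pop RR Omega ;; Push RL Omega ;; discard E ;; Pop E Hash) (w pre v post) s'
       \<longleftrightarrow> rn B (discard E ;; Pop E Hash) ((w pre v post)(RR := Hash # flat post, RL := Omega # w pre v post RL)) s'"
      unfolding rn_Seq[of B "Pop RR Omega"] rn_Seq[of B "Push RL Omega"] rn.simps(1,2) wE by auto
    then show ?thesis
      using rn_subtract_Omega[OF E, of "w pre v post" _ "Hash # flat post" B s'] wE None
      unfolding rn.simps(5) 1 2 3 by simp
  next
    case (Some rs)
    have wE: "w pre v post E = famt c @ Hash # x" "w pre v post RR = map Dig rs @ Hash # flat post"
      "w pre v post RL = Hash # map Dig (rev i) @ Start # rev (flat pre)"
      using Some E by (simp_all add: w_def)
    have 1: "\<not> rn B (Pop RR Omega ;; Push RL Omega ;; discard E ;; Pop E Hash) (w pre v post) s'"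
      unfolding rn_Seq rn.simps(1) wE by (cases rs) auto
    show ?thesis
    proof (cases c)
      case None
      then show ?thesis using 1 Some wE rn_subtract_Omega[OF E, of "w pre v post" "Hash # x" _ B s'] by simp
    next
      case (Some p)
      obtain b cs where c: "c = Some (b, cs)" using Some by (cases p) auto
      have "length rs \<le> B" using B(1) that \<open>v = Some rs\<close> by (simp add: frec_def)
      then have "rn B (subtract E) (w pre v post) s' \<longleftrightarrow> length cs = length rs \<and> val cs + of_bool b \<le> val rs \<and>
          s' = (w pre v post)(E := x, RL := Hash # map Dig (rev (diff b cs rs)) @ w pre v post RL, RR := flat post)"
        using wE c by (intro rn_subtract[OF E]) auto
      moreover have "(w pre v post)(E := x, RL := Hash # map Dig (rev (diff b cs rs)) @ w pre v post RL, RR := flat post)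
         = s(E := x, RL := Hash # map Dig (rev (diff b cs rs)) @ Hash # map Dig (rev i) @ Start # rev (flat pre), RR := flat post)"
        unfolding wE unfolding w_def using E by (intro ext) simp
      ultimately show ?thesis using 1 c \<open>v = Some rs\<close> by (simp add: rev_map)
    qed
  qed
  have rec: "rev L @ R = flat (pre @ (i, v') # post)"
    if "subv c v v'" "case v of None \<Rightarrow> L = Omega # Hash # map Dig (rev i) @ Start # rev (flat pre) \<and> R = Hash # flat post
         | Some rs \<Rightarrow> L = Hash # rev (fval v') @ Hash # map Dig (rev i) @ Start # rev (flat pre) \<and> R = flat post"
    for pre v post v' L R
    using that by (cases v) (auto simp: frec_def rev_map)
  show "\<exists>pre v post v' L R. recs = pre @ (i, v) # post \<and> subv c v v' \<and>
      rev L @ R = flat (pre @ (i, v') # post) \<and> s' = s(E := x, RL := L, RR := R)" if "rn B (sub E) s s'"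
  proof -
    from that obtain pre v post where "recs = pre @ (i, v) # post" "rn B ?alt (w pre v post) s'"
      unfolding sub_def rn_Seq[of B "seek E"] seek by blast
    then show ?thesis using alt[of pre v post s'] rec by blast
  qed
  show "\<exists>L R. rev L @ R = flat (pre @ (i, v') # post) \<and> rn B (sub E) s (s(E := x, RL := L, RR := R))"
    if "recs = pre @ (i, v) # post" "subv c v v'"
  proof -
    obtain L R where LR: "case v of None \<Rightarrow> L = Omega # Hash # map Dig (rev i) @ Start # rev (flat pre) \<and> R = Hash # flat post
         | Some rs \<Rightarrow> L = Hash # rev (fval v') @ Hash # map Dig (rev i) @ Start # rev (flat pre) \<and> R = flat post"
      by (cases v) auto
    then have "rn B ?alt (w pre v post) (s(E := x, RL := L, RR := R))"
      using that alt by blast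
    then have "rn B (sub E) s (s(E := x, RL := L, RR := R))"
      unfolding sub_def rn_Seq[of B "seek E"] seek using that(1) by blast
    then show ?thesis using rec[OF that(2) LR] by blast
  qed
qed

section \<open>The table of all vertices\<close>

text \<open>Descending, because the vertex read last is pushed on top.\<close>

primrec tab :: "nat \<Rightarrow> (nat \<Rightarrow> bool list option) \<Rightarrow> (bool list \<times> bool list option) list" where
  "tab 0 r = []"
| "tab (Suc n) r = (rev (bin n), r n) # tab n r"

lemma tab_cong: "(\<And>u. u < n \<Longrightarrow> r u = r' u) \<Longrightarrow> tab n r = tab n r'"
  by (induction n) auto

text \<open>\<open>bin\<close> is injective, so an index determines its record.\<close>

lemma tab_split:
  "tab n r = pre @ (rev (bin w), v) # post \<Longrightarrow>
    w < n \<and> v = r w \<and> pre @ (rev (bin w), v') # post = tab n (r(w := v'))"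
proof (induction n arbitrary: pre)
  case (Suc n)
  show ?case
  proof (cases pre)
    case Nil
    then have "w = n" "v = r n" "post = tab n r" using Suc.prems by auto
    moreover have "tab n (r(n := v')) = tab n r" by (rule tab_cong) simp
    ultimately show ?thesis using Nil by (simp del: fun_upd_apply add: fun_upd_same)
  next
    case (Cons p pre')
    then have p: "p = (rev (bin n), r n)" "tab n r = pre' @ (rev (bin w), v) # post" using Suc.prems by auto
    then show ?thesis using Suc.IH[OF p(2)] Cons by auto
  qed
qed simp

lemma tab_member: "w < n \<Longrightarrow> \<exists>pre post. tab n r = pre @ (rev (bin w), r w) # post"
proof (induction n)
  case (Suc n)
  show ?case
  proof (cases "w = n")
    case True
    then have "tab (Suc n) r = [] @ (rev (bin w), r w) # tab n r" by simp
    then show ?thesis by blast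
  next
    case False
    then obtain pre post where "tab n r = pre @ (rev (bin w), r w) # post" using Suc by auto
    then have "tab (Suc n) r = ((rev (bin n), r n) # pre) @ (rev (bin w), r w) # post" by simp
    then show ?thesis by blast
  qed
qed simp

text \<open>Subtraction keeps widths, so one bound on the length of the table serves for all
  edges.\<close>

lemma length_flat_tab_cong:
  "(\<And>u. u < n \<Longrightarrow> length (fval (r u)) = length (fval (r' u))) \<Longrightarrow> length (flat (tab n r)) = length (flat (tab n r'))"
  by (induction n) (auto simp: frec_def)

text \<open>An index below \<open>n\<close> has at most \<open>n\<close> digits, and a record has
  three further marks. With \<open>m = n + 1\<close> this is the origin of
  \<open>n * (2 * n + 4)\<close>.\<close>

lemma length_flat_tab:
  "(\<And>u. u < n \<Longrightarrow> length (fval (r u)) \<le> m) \<Longrightarrow> length (flat (tab n r)) \<le> n * (n + m + 3)"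
proof (induction n)
  case (Suc n)
  have "length (fval (r n)) \<le> m" "length (bin n) \<le> n" using Suc.prems length_bin by auto
  moreover have "length (flat (tab n r)) \<le> n * (n + m + 3)" using Suc by auto
  ultimately have "length (flat (tab (Suc n) r)) \<le> n + m + 3 + n * (n + m + 3)" by (simp add: frec_def)
  then show ?case by (simp add: algebra_simps)
qed simp

lemma length_bin_mem: "w < n \<Longrightarrow> length (bin w) \<le> length (flat (tab n r))"
proof -
  assume "w < n"
  then obtain pre post where "tab n r = pre @ (rev (bin w), r w) # post" using tab_member by blast
  then show ?thesis by (simp add: frec_def)
qed

section \<open>Subtracting a whole list of edges\<close>

type_synonym edge = "nat \<times> (bool \<times> bool list) option"

definition flatE :: "edge list \<Rightarrow> sym list" where
  "flatE es = concat (map fedge es)"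

lemma flatE_simps [simp]: "flatE [] = []" "flatE (e # es) = fedge e @ flatE es" "flatE (es @ es') = flatE es @ flatE es'"
  by (simp_all add: flatE_def)

fun drain :: "edge list \<Rightarrow> (nat \<Rightarrow> bool list option) \<Rightarrow> (nat \<Rightarrow> bool list option) \<Rightarrow> bool" where
  "drain [] r r' \<longleftrightarrow> r' = r"
| "drain ((w, c) # es) r r' \<longleftrightarrow> (\<exists>v'. subv c (r w) v' \<and> drain es (r(w := v')) r')"

lemma subv_length: "subv c v v' \<Longrightarrow> length (fval v') = length (fval v)"
  by (induction c v v' rule: subv.induct) (auto simp: diff_borrow)

definition subs :: "reg \<Rightarrow> com" where
  "subs E = Star (sub E) ;; Emp E"

text \<open>Keeps the loop of \<open>subs\<close> from running beyond the last edge.\<close>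

lemma rn_sub_Nil:
  assumes E: "E \<noteq> RL" "E \<noteq> RR" and "s E = []"
  shows "\<not> rn B (sub E) s s'"
proof
  assume "rn B (sub E) s s'"
  then obtain u1 u2 u3 u4 u5 where u: "rn B roam s u1" "rn B (Pop RR Start) u1 u2" "rn B (Push RL Start) u2 u3"
    "rn B (matching E) u3 u4" "rn B (Pop E Hash) u4 u5"
    unfolding sub_def seek_def rn_Seq by blast
  obtain L R where "u1 = s(RL := L, RR := R)" using u(1) roam_sound unfolding roam_def rn.simps(6) by blast
  then have "u3 E = []" using u(2,3) E assms(3) by auto
  then have "u4 E = []" using u(4) E unfolding rn_matching[OF E] by auto
  then show False using u(5) by simp
qed

lemma subs_sound:
  assumes E: "E \<noteq> RL" "E \<noteq> RR"
  shows "(rn B (sub E) ^^ k) s s' \<Longrightarrow> s' E = [] \<Longrightarrow> s E = flatE es \<Longrightarrow> rev (s RL) @ s RR = flat (tab n r) \<Longrightarrow>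
    length (flat (tab n r)) \<le> B \<Longrightarrow> (\<forall>(w, c)\<in>set es. length (bin w) \<le> B \<and> length (famt c) \<le> B) \<Longrightarrow>
    \<exists>r' L R. drain es r r' \<and> rev L @ R = flat (tab n r') \<and> s' = s(E := [], RL := L, RR := R)"
proof (induction k arbitrary: s es r)
  case 0
  have "es = []"
  proof (cases es)
    case (Cons e es')
    then show ?thesis using 0 by (cases e) (auto simp: fedge_def)
  qed simp
  moreover have "s' = s" using 0(1) by simp
  then have "s' = s(E := [], RL := s RL, RR := s RR)" using 0(2) by (simp add: fun_upd_idem)
  moreover have "drain [] r r" by simp
  ultimately show ?case using 0(4) by blast
next
  case (Suc k)
  then obtain u where u: "rn B (sub E) s u" "(rn B (sub E) ^^ k) u s'" unfolding relpowp_Suc_left by blast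
  have "es \<noteq> []" using rn_sub_Nil[OF E] u(1) Suc.prems(3) by auto
  then obtain w c es' where es: "es = (w, c) # es'" by (cases es) auto
  have sE: "s E = map Dig (rev (bin w)) @ Hash # famt c @ Hash # flatE es'"
    using Suc.prems(3) es by (simp add: fedge_def)
  have B: "length (rev (bin w)) \<le> B" "length (famt c) \<le> B" using Suc.prems(6) es by auto
  from rn_sub(1)[OF E Suc.prems(4) sE Suc.prems(5) B u(1)]
  obtain pre v post v' L R where 1: "tab n r = pre @ (rev (bin w), v) # post" "subv c v v'"
    "rev L @ R = flat (pre @ (rev (bin w), v') # post)" "u = s(E := flatE es', RL := L, RR := R)" by blast
  have 2: "v = r w" "pre @ (rev (bin w), v') # post = tab n (r(w := v'))"
    using tab_split[OF 1(1)] by auto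
  have len: "length (flat (tab n (r(w := v')))) \<le> B"
    using Suc.prems(5) length_flat_tab_cong[of n r "r(w := v')"] subv_length[OF 1(2)] 2(1) by auto
  have "rev (u RL) @ u RR = flat (tab n (r(w := v')))" "u E = flatE es'"
    using 1(3,4) 2(2) E by auto
  moreover have "\<forall>(w, c)\<in>set es'. length (bin w) \<le> B \<and> length (famt c) \<le> B"
    using Suc.prems(6) es by simp
  ultimately obtain r' L' R' where
    3: "drain es' (r(w := v')) r'" "rev L' @ R' = flat (tab n r')" "s' = u(E := [], RL := L', RR := R')"
    using Suc.IH[OF u(2) Suc.prems(2) _ _ len] by blast
  have "s' = s(E := [], RL := L', RR := R')" unfolding 3(3) 1(4) by (rule ext) simp
  moreover have "drain es r r'" using es 1(2) 2(1) 3(1) by auto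
  ultimately show ?case using 3(2) by blast
qed

lemma subs_complete:
  assumes E: "E \<noteq> RL" "E \<noteq> RR"
  shows "drain es r r' \<Longrightarrow> s E = flatE es \<Longrightarrow> rev (s RL) @ s RR = flat (tab n r) \<Longrightarrow>
    length (flat (tab n r)) \<le> B \<Longrightarrow> (\<forall>(w, c)\<in>set es. w < n \<and> length (famt c) \<le> B) \<Longrightarrow>
    \<exists>L R. rev L @ R = flat (tab n r') \<and> (rn B (sub E) ^^ length es) s (s(E := [], RL := L, RR := R))"
proof (induction es arbitrary: s r)
  case Nil
  have "s(E := [], RL := s RL, RR := s RR) = s" using Nil(2) by (intro ext) auto
  then have "(rn B (sub E) ^^ length ([] :: edge list)) s (s(E := [], RL := s RL, RR := s RR))" by simp
  moreover have "rev (s RL) @ s RR = flat (tab n r')" using Nil(1,3) by simp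
  ultimately show ?case by blast
next
  case (Cons e es)
  obtain w c where e: "e = (w, c)" by (cases e)
  obtain v' where v': "subv c (r w) v'" "drain es (r(w := v')) r'" using Cons.prems(1) e by auto
  have w: "w < n" and c: "length (famt c) \<le> B" using Cons.prems(5) e by auto
  have sE: "s E = map Dig (rev (bin w)) @ Hash # famt c @ Hash # flatE es"
    using Cons.prems(2) e by (simp add: fedge_def)
  have bw: "length (rev (bin w)) \<le> B" using length_bin_mem[OF w, of r] Cons.prems(4) by simp
  obtain pre post where tab: "tab n r = pre @ (rev (bin w), r w) # post" using tab_member[OF w] by blast
  from rn_sub(2)[OF E Cons.prems(3) sE Cons.prems(4) bw c tab v'(1)]
  obtain L R where 1: "rev L @ R = flat (pre @ (rev (bin w), v') # post)"
    "rn B (sub E) s (s(E := flatE es, RL := L, RR := R))" by blast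
  let ?u = "s(E := flatE es, RL := L, RR := R)"
  have 2: "rev L @ R = flat (tab n (r(w := v')))" using tab_split[OF tab, of v'] 1(1) by simp
  have len: "length (flat (tab n (r(w := v')))) \<le> B"
    using Cons.prems(4) length_flat_tab_cong[of n r "r(w := v')"] subv_length[OF v'(1)] by auto
  have "?u E = flatE es" "rev (?u RL) @ ?u RR = flat (tab n (r(w := v')))" using E 2 by auto
  moreover have "\<forall>(w, c)\<in>set es. w < n \<and> length (famt c) \<le> B" using Cons.prems(5) by simp
  ultimately obtain L' R' where
    3: "rev L' @ R' = flat (tab n r')" "(rn B (sub E) ^^ length es) ?u (?u(E := [], RL := L', RR := R'))"
    using Cons.IH[OF v'(2) _ _ len] by blast
  have eq: "?u(E := [], RL := L', RR := R') = s(E := [], RL := L', RR := R')" by (rule ext) simp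
  have "(rn B (sub E) ^^ length (e # es)) s (s(E := [], RL := L', RR := R'))"
    unfolding length_Cons relpowp_Suc_left using 1(2) 3(2) unfolding eq by blast
  then show ?case using 3(1) by blast
qed

fun amt :: "(bool \<times> bool list) option \<Rightarrow> nat" where
  "amt None = 0"
| "amt (Some (b, cs)) = val cs + of_bool b"

definition load :: "edge list \<Rightarrow> nat \<Rightarrow> nat" where
  "load es v = (\<Sum>(w, c)\<leftarrow>es. if w = v then amt c else 0)"

lemma load_simps [simp]: "load [] v = 0" "load ((w, c) # es) v = (if w = v then amt c else 0) + load es v"
  "load (es @ es') v = load es v + load es' v"
  by (simp_all add: load_def)

lemma subv_Some: "subv c (Some ds) v' \<Longrightarrow>
  c \<noteq> None \<and> (\<exists>ds'. v' = Some ds' \<and> length ds' = length ds \<and> val ds' + amt c = val ds)"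
proof (cases c)
  case (Some p)
  assume s: "subv c (Some ds) v'"
  obtain b cs where c: "c = Some (b, cs)" using Some by (cases p) auto
  then have *: "length cs = length ds" "val cs + of_bool b \<le> val ds" "v' = Some (diff b cs ds)" using s by auto
  then have "\<not> borrow b cs ds" using borrow_iff[of cs ds b] by simp
  then show ?thesis using diff_borrow[OF *(1), of b] * c by auto
qed simp

lemma subv_exists: "length cs = length ds \<Longrightarrow> amt (Some (b, cs)) \<le> val ds \<Longrightarrow> \<exists>v'. subv (Some (b, cs)) (Some ds) v'"
  by auto

text \<open>A finite entry stays finite and loses exactly its load, so the amounts directed at it
  cannot exceed its initial value.\<close>

lemma drain_sound:
  "drain es r r' \<Longrightarrow> r v = Some ds \<Longrightarrow> (\<forall>c. (v, c) \<in> set es \<longrightarrow> c \<noteq> None) \<and>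
    (\<exists>ds'. r' v = Some ds' \<and> val ds' + load es v = val ds)"
proof (induction es r r' arbitrary: ds rule: drain.induct)
  case (2 w c es r r')
  then obtain v' where v': "subv c (r w) v'" "drain es (r(w := v')) r'" by auto
  show ?case
  proof (cases "w = v")
    case True
    then have "subv c (Some ds) v'" using v'(1) 2(3) by simp
    from subv_Some[OF this] obtain ds1 where ds1: "c \<noteq> None" "v' = Some ds1" "val ds1 + amt c = val ds" by blast
    have "(r(w := v')) v = Some ds1" using True ds1(2) by simp
    from 2(1)[OF v'(2) this] show ?thesis using ds1 True by auto
  next
    case False
    then have "(r(w := v')) v = Some ds" using 2(3) by simp
    from 2(1)[OF v'(2) this] show ?thesis using False by auto
  qed
qed auto

text \<open>The hypothesis is an invariant: one subtraction lowers the entry and the remaining load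
  of its target by the same amount.\<close>

lemma drain_complete:
  assumes "\<And>w ds. r w = Some ds \<Longrightarrow> length ds = K \<and> load es w \<le> val ds \<and>
    (\<forall>c. (w, c) \<in> set es \<longrightarrow> (\<exists>b cs. c = Some (b, cs) \<and> length cs = K))"
  shows "\<exists>r'. drain es r r' \<and> (\<forall>w. length (fval (r' w)) = length (fval (r w))) \<and>
    (\<forall>w ds. r' w = Some ds \<longrightarrow> length ds = K \<and> (\<exists>ds0. r w = Some ds0 \<and> val ds + load es w = val ds0))"
  using assms
proof (induction es arbitrary: r)
  case Nil
  then show ?case by auto
next
  case (Cons e es)
  obtain u c where e: "e = (u, c)" by (cases e)
  have "\<exists>v'. subv c (r u) v'"
  proof (cases "r u")
    case (Some ds)
    from Cons.prems[OF this] obtain b cs where "c = Some (b, cs)" "length cs = K" "length ds = K" "amt c \<le> val ds"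
      unfolding e by auto
    then show ?thesis using subv_exists[of cs ds b] Some by simp
  qed auto
  then obtain v' where v': "subv c (r u) v'" by blast
  let ?r = "r(u := v')"
  have step: "length ds = K \<and> (\<exists>ds0. r w = Some ds0 \<and> val ds + (if u = w then amt c else 0) = val ds0)"
    if "?r w = Some ds" for w ds
  proof (cases "u = w")
    case True
    show ?thesis
    proof (cases "r u")
      case None
      then show ?thesis using v' that True by simp
    next
      case (Some ds0)
      then show ?thesis using subv_Some[of c ds0 v'] v' that True Cons.prems[of u ds0] by auto
    qed
  next
    case False
    then show ?thesis using that Cons.prems[of w ds] by auto
  qed
  have "length ds = K \<and> load es w \<le> val ds \<and> (\<forall>c. (w, c) \<in> set es \<longrightarrow> (\<exists>b cs. c = Some (b, cs) \<and> length cs = K))"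
    if asm: "?r w = Some ds" for w ds
  proof -
    obtain ds0 where ds0: "r w = Some ds0" "val ds + (if u = w then amt c else 0) = val ds0" "length ds = K"
      using step[OF asm] by blast
    show ?thesis using Cons.prems[OF ds0(1)] ds0(2,3) unfolding e by auto
  qed
  from Cons.IH[OF this] obtain r' where r': "drain es ?r r'" "\<forall>w. length (fval (r' w)) = length (fval (?r w))"
    "\<forall>w ds. r' w = Some ds \<longrightarrow> length ds = K \<and> (\<exists>ds0. ?r w = Some ds0 \<and> val ds + load es w = val ds0)" by blast
  have "drain (e # es) r r'" using e v' r'(1) by auto
  moreover have "\<forall>w. length (fval (r' w)) = length (fval (r w))" using r'(2) subv_length[OF v'] by auto
  moreover have "length ds = K \<and> (\<exists>ds0. r w = Some ds0 \<and> val ds + load (e # es) w = val ds0)" if asm: "r' w = Some ds" for w ds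
  proof -
    obtain ds1 where 1: "?r w = Some ds1" "val ds + load es w = val ds1" "length ds = K" using r'(3) asm by blast
    obtain ds0 where "r w = Some ds0" "val ds1 + (if u = w then amt c else 0) = val ds0" using step[OF 1(1)] by blast
    then show ?thesis using 1 e by auto
  qed
  ultimately show ?case by blast
qed

section \<open>The verifier for valid instances\<close>

primrec edges :: "(nat \<Rightarrow> nat) \<Rightarrow> (bool list option \<Rightarrow> (bool \<times> bool list) option) \<Rightarrow> nat \<Rightarrow>
    (nat \<Rightarrow> bool list option) \<Rightarrow> edge list" where
  "edges f a 0 t = []"
| "edges f a (Suc n) t = (f n, a (t n)) # edges f a n t"

lemma edges_cong: "(\<And>u. u < n \<Longrightarrow> t u = t' u) \<Longrightarrow> edges f a n t = edges f a n t'"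
  by (induction n) auto

lemma set_edges: "set (edges f a n t) = (\<lambda>u. (f u, a (t u))) ` {..<n}"
  by (induction n) (auto simp: lessThan_Suc)

lemma length_edges [simp]: "length (edges f a n t) = n"
  by (induction n) auto

lemma load_edges: "load (edges f a n t) v = (\<Sum>u<n. if f u = v then amt (a (t u)) else 0)"
  by (induction n) auto

lemma amt_halves:
  assumes "ds \<noteq> []"
  shows "amt (amt0 (Some ds)) = (val ds + 1) div 2" "amt (amt1 (Some ds)) = val ds div 2"
  using assms by (cases ds; simp add: val_append)+

text \<open>The initial visit as an edge: zero digits with the borrow bit set amount to 1. The width
  \<open>k\<close> is guessed, since no weight has been written yet when this edge is.\<close>

definition start_edge :: "nat \<Rightarrow> nat \<Rightarrow> edge" where
  "start_edge o' k = (o', Some (True, replicate k False))"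

lemma load_inflow:
  assumes "\<And>u. u < n \<Longrightarrow> s0 u = v \<or> s1 u = v \<Longrightarrow> t u \<noteq> None" "\<And>u. t u \<noteq> Some []"
  shows "load (edges s0 amt0 n t @ [start_edge o' k]) v + load (edges s1 amt1 n t) v
    = inflow n s0 s1 o' (\<lambda>u. the (map_option val (t u))) v"
proof -
  let ?T = "\<lambda>u. the (map_option val (t u))"
  have "(if s0 u = v then amt (amt0 (t u)) else 0) + (if s1 u = v then amt (amt1 (t u)) else 0)
      = (if s0 u = v then (?T u + 1) div 2 else 0) + (if s1 u = v then ?T u div 2 else 0)" if u: "u < n" for u
  proof (cases "s0 u = v \<or> s1 u = v")
    case True
    then obtain ds where ds: "t u = Some ds" using assms(1)[OF u True] by blast
    moreover have "ds \<noteq> []" using ds assms(2)[of u] by auto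
    ultimately show ?thesis using amt_halves[of ds] by simp
  qed simp
  then have "(\<Sum>u<n. (if s0 u = v then amt (amt0 (t u)) else 0) + (if s1 u = v then amt (amt1 (t u)) else 0))
     = (\<Sum>u<n. (if s0 u = v then (?T u + 1) div 2 else 0) + (if s1 u = v then ?T u div 2 else 0))"
    by (intro sum.cong) auto
  then show ?thesis
    by (simp add: load_edges inflow_def start_edge_def sum.distrib)
qed

lemma flatE_bounds:
  "(w, c) \<in> set es \<Longrightarrow> length (bin w) \<le> length (flatE es) \<and> length (famt c) \<le> length (flatE es)"
  by (induction es) (auto simp: fedge_def)

definition input_from :: "(nat \<Rightarrow> nat) \<Rightarrow> (nat \<Rightarrow> nat) \<Rightarrow> nat \<Rightarrow> nat \<Rightarrow> bool list" where
  "input_from s0 s1 n k = concat (map (\<lambda>v. enc_nat (s0 v) @ enc_nat (s1 v)) [k..<n])"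

lemma input_from_less:
  "k < n \<Longrightarrow> input_from s0 s1 n k = enc_nat (s0 k) @ enc_nat (s1 k) @ input_from s0 s1 n (Suc k)"
  by (simp add: input_from_def upt_conv_Cons)

lemma enc_instance_from:
  "enc_instance n s0 s1 o' d = enc_nat n @ enc_nat o' @ enc_nat d @ input_from s0 s1 n 0"
  by (simp add: enc_instance_def input_from_def)

lemma length_enc_nat: "length (enc_nat m) = 2 * length (bin m) + 2"
  by (simp add: enc_nat_dbl)

lemma length_input_from: "k \<le> n \<Longrightarrow> n - k \<le> length (input_from s0 s1 n k)"
proof (induction "n - k" arbitrary: k)
  case (Suc j)
  then have "n - Suc k \<le> length (input_from s0 s1 n (Suc k))" "k < n" by auto
  then show ?case by (simp add: input_from_less length_enc_nat)
qed simp

lemma input_from_bins: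
  "v < n \<Longrightarrow> length (bin (s0 v)) \<le> length (input_from s0 s1 n 0) \<and> length (bin (s1 v)) \<le> length (input_from s0 s1 n 0)"
proof -
  assume "v < n"
  then have "[0..<n] = [0..<v] @ v # [Suc v..<n]"
    by (metis add_0 le_add_diff_inverse less_imp_le upt_add_eq_append upt_conv_Cons zero_le)
  then show ?thesis by (simp add: input_from_def length_enc_nat)
qed

definition start :: com where
  "start = readtok RN ;; Push RE0 Hash ;; pad RE0 ;; Push RE0 (Dig True) ;; Push RE0 Hash ;; readtok RE0 ;;
     Push RD Hash ;; readtok RD"

definition base :: "nat \<Rightarrow> nat \<Rightarrow> nat \<Rightarrow> bool list \<Rightarrow> nat \<Rightarrow> stacks" where
  "base n o' d y k = (\<lambda>_. [])(RX := map Dig y, RN := map Dig (rev (bin n)),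
     RE0 := fedge (start_edge o' k), RD := map Dig (rev (bin d)) @ [Hash])"

lemma rn_step: "(\<And>u. rn B c s u \<longleftrightarrow> u = s1) \<Longrightarrow> rn B (c ;; d) s s' \<longleftrightarrow> rn B d s1 s'"
  by (simp add: rn_Seq)

lemma rn_start:
  assumes "length (bin n) \<le> B" "length (bin o') \<le> B" "length (bin d) \<le> B"
  shows "rn B start (inp (enc_nat n @ enc_nat o' @ enc_nat d @ y)) s' \<longleftrightarrow> (\<exists>k\<le>B. s' = base n o' d y k)"
proof -
  define s0 where "s0 = inp (enc_nat n @ enc_nat o' @ enc_nat d @ y)"
  define s1 where "s1 = s0(RX := map Dig (enc_nat o' @ enc_nat d @ y), RN := map Dig (rev (bin n)) @ s0 RN)"
  define s2 where "s2 = s1(RE0 := Hash # s1 RE0)"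
  define s3 where "s3 k = s2(RE0 := replicate k (Dig False) @ s2 RE0)" for k
  define s4 where "s4 k = (s3 k)(RE0 := Dig True # s3 k RE0)" for k
  define s5 where "s5 k = (s4 k)(RE0 := Hash # s4 k RE0)" for k
  define s6 where "s6 k = (s5 k)(RX := map Dig (enc_nat d @ y), RE0 := map Dig (rev (bin o')) @ s5 k RE0)" for k
  define s7 where "s7 k = (s6 k)(RD := Hash # s6 k RD)" for k
  define s8 where "s8 k = (s7 k)(RX := map Dig y, RD := map Dig (rev (bin d)) @ s7 k RD)" for k
  note defs = s0_def s1_def s2_def s3_def s4_def s5_def s6_def s7_def s8_def
  have X: "s0 RX = map Dig (enc_nat n @ enc_nat o' @ enc_nat d @ y)"
    "s5 k RX = map Dig (enc_nat o' @ enc_nat d @ y)" "s7 k RX = map Dig (enc_nat d @ y)" for k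
    by (simp_all add: defs inp_def)
  have 1: "rn B (readtok RN) s0 u \<longleftrightarrow> u = s1" for u
    using rn_readtok[of RN s0 n "enc_nat o' @ enc_nat d @ y" B u] X(1) assms(1) by (simp add: s1_def del: fun_upd_apply)
  have 2: "rn B (Push RE0 Hash) s1 u \<longleftrightarrow> u = s2" for u by (simp add: s2_def)
  have 3: "rn B (pad RE0 ;; c) s2 u \<longleftrightarrow> (\<exists>k\<le>B. rn B c (s3 k) u)" for c u
    unfolding rn_Seq rn_pad s3_def by blast
  have 4: "rn B (Push RE0 (Dig True)) (s3 k) u \<longleftrightarrow> u = s4 k" for u k by (simp add: s4_def)
  have 5: "rn B (Push RE0 Hash) (s4 k) u \<longleftrightarrow> u = s5 k" for u k by (simp add: s5_def)
  have 6: "rn B (readtok RE0) (s5 k) u \<longleftrightarrow> u = s6 k" for u k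
    using rn_readtok[of RE0 "s5 k" o' "enc_nat d @ y" B u] X(2) assms(2) by (simp add: s6_def del: fun_upd_apply)
  have 7: "rn B (Push RD Hash) (s6 k) u \<longleftrightarrow> u = s7 k" for u k by (simp add: s7_def)
  have 8: "rn B (readtok RD) (s7 k) u \<longleftrightarrow> u = s8 k" for u k
    using rn_readtok[of RD "s7 k" d y B u] X(3) assms(3) by (simp add: s8_def del: fun_upd_apply)
  have eq: "s8 k = base n o' d y k" for k
    by (rule ext) (simp add: defs base_def inp_def fedge_def start_edge_def)
  show ?thesis
    unfolding s0_def[symmetric] start_def rn_step[OF 1] rn_step[OF 2] 3 rn_step[OF 4] rn_step[OF 5]
      rn_step[OF 6] rn_step[OF 7] 8 eq ..
qed

text \<open>The invariant of the reading loop: the state after \<open>k\<close> vertices, starting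
  from \<open>s\<close>.\<close>

definition vst :: "(nat \<Rightarrow> nat) \<Rightarrow> (nat \<Rightarrow> nat) \<Rightarrow> nat \<Rightarrow> stacks \<Rightarrow> nat \<Rightarrow> (nat \<Rightarrow> bool list option) \<Rightarrow> stacks" where
  "vst s0 s1 n s k t = s(RX := map Dig (input_from s0 s1 n k), RU := map Dig (bin k), RR := flat (tab k t),
     RE0 := flatE (edges s0 amt0 k t) @ s RE0, RE1 := flatE (edges s1 amt1 k t))"

lemma rn_vertex_nonempty: "rn B vertex s s' \<Longrightarrow> s RX \<noteq> []"
proof
  assume "rn B vertex s s'" and X: "s RX = []"
  then obtain u v where "rn B guess s u" "rn B (readtok RE0) u v"
    unfolding vertex_def rn_Seq by blast
  moreover from this have "u RX = []" using X unfolding rn_guess by auto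
  ultimately show False unfolding readtok_def rn_Seq rn_readbits[of RE0, simplified] by auto
qed

lemma rn_vertex_vst:
  assumes "k < n" "s RV = []" "n < B" "length (bin (s0 k)) \<le> B" "length (bin (s1 k)) \<le> B"
  shows "rn B vertex (vst s0 s1 n s k t) s' \<longleftrightarrow> (\<exists>v. guessed B v \<and> s' = vst s0 s1 n s (Suc k) (t(k := v)))"
proof -
  let ?w = "vst s0 s1 n s k t"
  have w: "?w RX = map Dig (enc_nat (s0 k) @ enc_nat (s1 k) @ input_from s0 s1 n (Suc k))"
    "?w RU = map Dig (bin k)" "?w RV = []"
    using assms(1,2) by (simp_all add: vst_def input_from_less)
  have "length (bin k) < B" using length_bin[of k] assms(1,3) by simp
  note r = rn_vertex[OF w this assms(4,5), of s']
  have cong: "tab k (t(k := v)) = tab k t" "edges f a k (t(k := v)) = edges f a k t" for v f a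
    by (auto intro: tab_cong edges_cong)
  have Suc: "tab (Suc k) (t(k := v)) = (rev (bin k), v) # tab k t"
    "edges f a (Suc k) (t(k := v)) = (f k, a v) # edges f a k t" for v f a
    unfolding tab.simps edges.simps cong by simp_all
  have "?w(RX := map Dig (input_from s0 s1 n (Suc k)), RR := frec (rev (bin k), v) @ ?w RR,
      RE0 := fedge (s0 k, amt0 v) @ ?w RE0, RE1 := fedge (s1 k, amt1 v) @ ?w RE1, RU := map Dig (inc (bin k)))
     = vst s0 s1 n s (Suc k) (t(k := v))" for v
    unfolding vst_def Suc by (rule ext) (simp add: bin_Suc)
  then show ?thesis unfolding r by simp
qed

lemma rn_vertices:
  assumes "s RV = []" "n < B" "\<And>v. v < n \<Longrightarrow> length (bin (s0 v)) \<le> B \<and> length (bin (s1 v)) \<le> B"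
  shows "(rn B vertex ^^ k) (vst s0 s1 n s 0 t) s' \<longleftrightarrow>
    k \<le> n \<and> (\<exists>t'. (\<forall>u<k. guessed B (t' u)) \<and> s' = vst s0 s1 n s k t')"
proof (induction k arbitrary: s')
  case 0
  then show ?case by (auto simp: vst_def)
next
  case (Suc k)
  show ?case
  proof
    assume "(rn B vertex ^^ Suc k) (vst s0 s1 n s 0 t) s'"
    then obtain u where "(rn B vertex ^^ k) (vst s0 s1 n s 0 t) u" and u: "rn B vertex u s'" by auto
    then obtain t' where t': "k \<le> n" "\<forall>u<k. guessed B (t' u)" "u = vst s0 s1 n s k t'"
      using Suc.IH by blast
    have "k < n"
    proof (rule ccontr)
      assume "\<not> k < n"
      then have "u RX = []" using t' by (simp add: vst_def input_from_def)
      then show False using rn_vertex_nonempty[OF u] by simp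
    qed
    then obtain v where v: "guessed B v" "s' = vst s0 s1 n s (Suc k) (t'(k := v))"
      using u rn_vertex_vst[of k n s B s0 s1 t' s'] assms t'(3) by blast
    have "\<forall>u<Suc k. guessed B ((t'(k := v)) u)" using v(1) t'(2) by (auto simp: less_Suc_eq)
    then show "Suc k \<le> n \<and> (\<exists>t'. (\<forall>u<Suc k. guessed B (t' u)) \<and> s' = vst s0 s1 n s (Suc k) t')"
      using \<open>k < n\<close> v(2) by (intro conjI) (simp, blast)
  next
    assume "Suc k \<le> n \<and> (\<exists>t'. (\<forall>u<Suc k. guessed B (t' u)) \<and> s' = vst s0 s1 n s (Suc k) t')"
    then obtain t' where t': "k < n" "\<forall>u<Suc k. guessed B (t' u)" "s' = vst s0 s1 n s (Suc k) t'" by auto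
    have "(rn B vertex ^^ k) (vst s0 s1 n s 0 t) (vst s0 s1 n s k t')"
      unfolding Suc.IH using t'(1,2) by (intro conjI exI[of _ t']) auto
    moreover have "rn B vertex (vst s0 s1 n s k t') s'"
      using rn_vertex_vst[of k n s B s0 s1 t' s'] assms t' by (metis fun_upd_triv lessI)
    ultimately show "(rn B vertex ^^ Suc k) (vst s0 s1 n s 0 t) s'" by auto
  qed
qed

definition zeros :: com where
  "zeros = Star (Pop RR (Dig False) ;; Push RL (Dig False)) ;; Pop RR Hash ;; Push RL Hash"

text \<open>Run before the subtractions, while the table still holds the guessed weights.\<close>

definition dcheck :: com where
  "dcheck = seek RD ;; zeros"

lemma rn_zeros:
  "rn B zeros s s' \<longleftrightarrow> (\<exists>k r. k \<le> B \<and> s RR = replicate k (Dig False) @ Hash # r \<and>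
    s' = s(RL := Hash # replicate k (Dig False) @ s RL, RR := r))"
proof -
  have move: "rn B (Pop RR a ;; Push RL a) (s(RL := l, RR := r)) u \<longleftrightarrow>
       (\<exists>r'. r = a # r' \<and> u = s(RL := a # l, RR := r'))" for a l r u
    unfolding rn_Seq by (auto simp: upd_order(1))
  have loop: "(rn B (Pop RR (Dig False) ;; Push RL (Dig False)) ^^ k) s u \<longleftrightarrow>
    (\<exists>r. s RR = replicate k (Dig False) @ r \<and> u = s(RL := replicate k (Dig False) @ s RL, RR := r))" for k u
  proof (induction k arbitrary: u)
    case 0
    have "s(RL := s RL, RR := s RR) = s" by simp
    then show ?case by (simp del: fun_upd_apply) metis
  next
    case (Suc k)
    have c: "Dig False # replicate k (Dig False) @ r = replicate k (Dig False) @ Dig False # r" for r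
      by (rule replicate_app_Cons_same[symmetric])
    have "(rn B (Pop RR (Dig False) ;; Push RL (Dig False)) ^^ Suc k) s u \<longleftrightarrow>
      (\<exists>r. s RR = replicate k (Dig False) @ r \<and>
        (\<exists>r'. r = Dig False # r' \<and> u = s(RL := Dig False # replicate k (Dig False) @ s RL, RR := r')))"
      unfolding relpowp.simps(2) relcompp_apply Suc.IH ex_state_point1 move ..
    then show ?case
      unfolding replicate_Suc append_Cons c[of "_ :: sym list"] by (simp only:) blast
  qed
  have pt: "(\<exists>u. (\<exists>k\<le>B. \<exists>r. P k r \<and> u = f k r) \<and> R u) \<longleftrightarrow> (\<exists>k r. k \<le> B \<and> P k r \<and> R (f k r))"
    for P R and f :: "nat \<Rightarrow> sym list \<Rightarrow> stacks"
    by blast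
  show ?thesis
    unfolding zeros_def rn_Seq[of B "Star _"] rn.simps(6) loop pt move by blast
qed

lemma fval_zeros:
  "fval v @ Hash # r = replicate k (Dig False) @ Hash # r' \<longleftrightarrow> v = Some (replicate k False) \<and> r = r'"
proof (cases v)
  case None
  then show ?thesis by (cases k) auto
next
  case (Some ds)
  then show ?thesis using map_Dig_append_eq[of Hash Hash ds r "replicate k False" r'] by simp
qed

lemma rn_dcheck:
  assumes tape: "rev (s RL) @ s RR = flat (tab n t)" and sD: "s RD = map Dig (rev (bin d)) @ [Hash]"
    and d: "d < n" and B: "length (flat (tab n t)) \<le> B"
  shows "rn B dcheck s s' \<Longrightarrow> \<exists>k L R. t d = Some (replicate k False) \<and> rev L @ R = flat (tab n t) \<and>
      s' = s(RD := [], RL := L, RR := R)"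
    and "t d = Some (replicate k False) \<Longrightarrow>
      \<exists>L R. rev L @ R = flat (tab n t) \<and> rn B dcheck s (s(RD := [], RL := L, RR := R))"
proof -
  have bd: "length (rev (bin d)) \<le> B" using length_bin_mem[OF d, of t] B by simp
  define w where "w pre v post = s(RD := [], RL := Hash # map Dig (rev (rev (bin d))) @ Start # rev (flat pre),
     RR := fval v @ Hash # flat post)" for pre v post
  have seek: "rn B (seek RD) s u \<longleftrightarrow> (\<exists>pre v post. tab n t = pre @ (rev (bin d), v) # post \<and> u = w pre v post)" for u
    unfolding w_def using rn_seek[of RD s "tab n t" "rev (bin d)" "[]" B u] tape sD B bd by simp
  have 1: "rn B zeros (w pre v post) s' \<longleftrightarrow> (\<exists>k. k \<le> B \<and> v = Some (replicate k False) \<and>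
     s' = s(RD := [], RL := Hash # replicate k (Dig False) @ Hash # map Dig (bin d) @ Start # rev (flat pre), RR := flat post))"
    for pre v post s'
  proof -
    have "w pre v post RR = fval v @ Hash # flat post"
      "(w pre v post)(RL := Hash # replicate k (Dig False) @ w pre v post RL, RR := r)
        = s(RD := [], RL := Hash # replicate k (Dig False) @ Hash # map Dig (bin d) @ Start # rev (flat pre), RR := r)" for k r
      unfolding w_def by (simp, rule ext, simp)
    then show ?thesis unfolding rn_zeros by (auto simp only: fval_zeros)
  qed
  have 2: "rev (Hash # replicate k (Dig False) @ Hash # map Dig (bin d) @ Start # rev (flat pre)) @ flat post = flat (tab n t)"
    if "tab n t = pre @ (rev (bin d), Some (replicate k False)) # post" for pre post k
    unfolding that by (simp add: frec_def rev_map)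
  show "\<exists>k L R. t d = Some (replicate k False) \<and> rev L @ R = flat (tab n t) \<and> s' = s(RD := [], RL := L, RR := R)"
    if "rn B dcheck s s'"
  proof -
    from that obtain pre v post where p: "tab n t = pre @ (rev (bin d), v) # post" "rn B zeros (w pre v post) s'"
      unfolding dcheck_def rn_Seq seek by blast
    moreover have "v = t d" using tab_split[OF p(1)] by blast
    moreover obtain k where k: "v = Some (replicate k False)"
      "s' = s(RD := [], RL := Hash # replicate k (Dig False) @ Hash # map Dig (bin d) @ Start # rev (flat pre), RR := flat post)"
      using p(2) unfolding 1 by blast
    moreover have "rev (Hash # replicate k (Dig False) @ Hash # map Dig (bin d) @ Start # rev (flat pre)) @ flat post
        = flat (tab n t)"
      using 2 p(1) unfolding k(1) .
    ultimately show ?thesis by (metis (no_types))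
  qed
  show "\<exists>L R. rev L @ R = flat (tab n t) \<and> rn B dcheck s (s(RD := [], RL := L, RR := R))"
    if td: "t d = Some (replicate k False)"
  proof -
    obtain pre post where p: "tab n t = pre @ (rev (bin d), Some (replicate k False)) # post"
      using tab_member[OF d, of t] td by auto
    have "k \<le> B" using B unfolding p by (simp add: frec_def)
    then show ?thesis using 2[OF p] p unfolding dcheck_def rn_Seq seek using 1 by blast
  qed
qed

text \<open>\<open>Emp RX\<close> forces the loop to have read every vertex.\<close>

definition vprog :: com where
  "vprog = start ;; Star vertex ;; Emp RX ;; dcheck ;; subs RE0 ;; subs RE1"

definition all_edges0 :: "nat \<Rightarrow> (nat \<Rightarrow> nat) \<Rightarrow> nat \<Rightarrow> nat \<Rightarrow> (nat \<Rightarrow> bool list option) \<Rightarrow> edge list" where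
  "all_edges0 n s0 o' k t = edges s0 amt0 n t @ [start_edge o' k]"

lemma vst_base:
  "vst s0 s1 n (base n o' d (input_from s0 s1 n 0) k) 0 t = base n o' d (input_from s0 s1 n 0) k"
  by (rule ext) (simp add: vst_def base_def)

lemma vst_end:
  fixes n o' d k t s0 s1
  defines "w \<equiv> vst s0 s1 n (base n o' d (input_from s0 s1 n 0) k) n t"
  shows "w RX = []" "w RL = []" "w RR = flat (tab n t)" "w RD = map Dig (rev (bin d)) @ [Hash]"
    "w RE0 = flatE (all_edges0 n s0 o' k t)" "w RE1 = flatE (edges s1 amt1 n t)"
  by (simp_all add: w_def vst_def base_def input_from_def all_edges0_def)

lemma valid_sound:
  assumes valid: "valid_instance n s0 s1 o' d" and run: "rn B vprog (inp (enc_instance n s0 s1 o' d)) s'"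
  shows "\<exists>t. certificate n s0 s1 o' d t"
proof -
  let ?y = "input_from s0 s1 n 0"
  let ?x = "enc_instance n s0 s1 o' d"
  \<comment> \<open>\<open>B\<close> is arbitrary here and is enlarged in stages, first by the
    length of the input, later by lengths known only once the weights are.\<close>
  define B1 where "B1 = B + length ?x + 1"
  have len: "length ?x = length (enc_nat n) + length (enc_nat o') + length (enc_nat d) + length ?y"
    by (simp add: enc_instance_from)
  have bins: "length (bin n) \<le> B1" "length (bin o') \<le> B1" "length (bin d) \<le> B1"
    unfolding B1_def len by (simp_all add: length_enc_nat)
  have nB: "n < B1" using length_input_from[of 0 n s0 s1] unfolding B1_def len by simp
  have vB: "length (bin (s0 v)) \<le> B1 \<and> length (bin (s1 v)) \<le> B1" if "v < n" for v
    using input_from_bins[OF that, of s0 s1] unfolding B1_def len by simp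
  have "rn B1 vprog (inp ?x) s'" using run by (rule rn_mono[rotated]) (simp add: B1_def)
  then obtain u1 u2 u3 u4 where u: "rn B1 start (inp ?x) u1" "rn B1 (Star vertex) u1 u2" "u2 RX = []"
    "rn B1 dcheck u2 u3" "rn B1 (subs RE0) u3 u4" "rn B1 (subs RE1) u4 s'"
    unfolding vprog_def rn_Seq rn.simps(3) by blast
  obtain k where u1: "u1 = base n o' d ?y k"
    using u(1) unfolding enc_instance_from rn_start[OF bins] by blast
  obtain m t where m: "m \<le> n" "\<forall>v<m. guessed B1 (t v)" "u2 = vst s0 s1 n u1 m t"
  proof -
    obtain m where "(rn B1 vertex ^^ m) (vst s0 s1 n u1 0 (\<lambda>_. None)) u2"
      using u(2) unfolding u1 vst_base rn.simps(6) by blast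
    moreover have "u1 RV = []" by (simp add: u1 base_def)
    ultimately show ?thesis using that rn_vertices[of u1 n B1 s0 s1 m "\<lambda>_. None" u2] nB vB by blast
  qed
  have "m = n"
  proof (rule ccontr)
    assume "m \<noteq> n"
    then have "m < n" using m(1) by simp
    then have "u2 RX \<noteq> []" unfolding m(3) by (simp add: vst_def input_from_less enc_nat_def)
    then show False using u(3) by simp
  qed
  note u2 = m(3)[unfolded u1 this]
  note w = vst_end[of s0 s1 n o' d k t, folded u2]
  let ?E0 = "all_edges0 n s0 o' k t" and ?E1 = "edges s1 amt1 n t"
  define B2 where "B2 = B1 + length (flat (tab n t)) + length (flatE ?E0) + length (flatE ?E1)"
  have mono: "rn B1 c s u \<Longrightarrow> rn B2 c s u" for c s u
    by (erule rn_mono[rotated]) (simp add: B2_def)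
  have d: "d < n" using valid by (simp add: valid_instance_def)
  have tape: "rev (u2 RL) @ u2 RR = flat (tab n t)" using w by simp
  have tB: "length (flat (tab n t)) \<le> B2" by (simp add: B2_def)
  obtain j L R where td: "t d = Some (replicate j False)" and LR: "rev L @ R = flat (tab n t)"
    and u3: "u3 = u2(RD := [], RL := L, RR := R)"
    using rn_dcheck(1)[OF tape w(4) d tB mono[OF u(4)]] by blast
  have eB: "\<forall>(w, c)\<in>set es. length (bin w) \<le> B2 \<and> length (famt c) \<le> B2"
    if "length (flatE es) \<le> B2" for es
    using flatE_bounds[of _ _ es] that by fastforce
  obtain k0 where k0: "(rn B2 (sub RE0) ^^ k0) u3 u4" "u4 RE0 = []"
    using mono[OF u(5)] unfolding subs_def rn_Seq rn.simps(3,6) by blast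
  have "u3 RE0 = flatE ?E0" "rev (u3 RL) @ u3 RR = flat (tab n t)"
    using w(5) LR by (simp_all add: u3)
  from subs_sound[OF _ _ k0 this tB eB] obtain r1 L1 R1 where
    r1: "drain ?E0 t r1" "rev L1 @ R1 = flat (tab n r1)" "u4 = u3(RE0 := [], RL := L1, RR := R1)"
    by (auto simp: B2_def)
  define B3 where "B3 = B2 + length (flat (tab n r1))"
  have "rn B3 (subs RE1) u4 s'" using mono[OF u(6)] by (rule rn_mono[rotated]) (simp add: B3_def)
  then obtain k1 where k1: "(rn B3 (sub RE1) ^^ k1) u4 s'" "s' RE1 = []"
    unfolding subs_def rn_Seq rn.simps(3,6) by blast
  have "u4 RE1 = flatE ?E1" "rev (u4 RL) @ u4 RR = flat (tab n r1)"
    using w(6) r1(2) by (simp_all add: u3 r1(3))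
  moreover have "\<forall>(w, c)\<in>set ?E1. length (bin w) \<le> B3 \<and> length (famt c) \<le> B3"
    using eB[of ?E1] unfolding B3_def by (force simp: B2_def)
  ultimately obtain r2 where r2: "drain ?E1 r1 r2"
    using subs_sound[OF _ _ k1, of ?E1 n r1] by (auto simp: B3_def)
  \<comment> \<open>Nothing was guessed beyond \<open>n\<close>; \<open>None\<close> there rules out
    empty digit lists, as \<open>load_inflow\<close> requires for all arguments.\<close>
  let ?t = "\<lambda>u. if u < n then t u else None"
  have ne: "?t u \<noteq> Some []" for u using m(2) \<open>m = n\<close> by (auto simp: guessed_def)
  have cong: "edges f a n ?t = edges f a n t" for f a by (rule edges_cong) simp
  have "certificate n s0 s1 o' d (\<lambda>u. map_option val (?t u))"
    unfolding certificate_def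
  proof (intro conjI allI impI)
    show "map_option val (?t d) = Some 0" using td d by simp
    fix v m assume v: "v < n" "map_option val (?t v) = Some m"
    then obtain ds where ds: "t v = Some ds" "val ds = m" by auto
    from drain_sound[OF r1(1) ds(1)] obtain ds1 where
      1: "\<forall>c. (v, c) \<in> set ?E0 \<longrightarrow> c \<noteq> None" "r1 v = Some ds1" "val ds1 + load ?E0 v = val ds" by blast
    from drain_sound[OF r2 1(2)] have
      2: "\<forall>c. (v, c) \<in> set ?E1 \<longrightarrow> c \<noteq> None" "load ?E1 v \<le> val ds1" by auto
    have pred: "t u \<noteq> None" if "u < n" "s0 u = v \<or> s1 u = v" for u
    proof
      assume "t u = None"
      then have "s0 u = v \<Longrightarrow> (v, None) \<in> set ?E0" "s1 u = v \<Longrightarrow> (v, None) \<in> set ?E1"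
        using that(1) unfolding all_edges0_def set_append set_edges by force+
      then show False using 1(1) 2(1) that(2) by blast
    qed
    show "map_option val (?t u) \<noteq> None" if "u < n" "s0 u = v \<or> s1 u = v" for u
      using pred[OF that] that(1) by simp
    have "load (edges s0 amt0 n ?t @ [start_edge o' k]) v + load (edges s1 amt1 n ?t) v
        = inflow n s0 s1 o' (\<lambda>u. the (map_option val (?t u))) v"
      using pred ne by (intro load_inflow) auto
    then show "inflow n s0 s1 o' (\<lambda>u. the (map_option val (?t u))) v \<le> m"
      using 1(3) 2(2) ds(2) unfolding cong all_edges0_def by simp
  qed
  then show ?thesis by blast
qed

lemma valid_complete:
  assumes valid: "valid_instance n s0 s1 o' d" and cert: "certificate n s0 s1 o' d t0"
    and small: "\<And>v m. t0 v = Some m \<Longrightarrow> m < 2 ^ n"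
    and B: "length (enc_instance n s0 s1 o' d) + 3 \<le> B" "n * (2 * n + 4) \<le> B"
  shows "\<exists>s'. rn B vprog (inp (enc_instance n s0 s1 o' d)) s'"
proof -
  let ?y = "input_from s0 s1 n 0"
  let ?x = "enc_instance n s0 s1 o' d"
  have len: "length ?x = length (enc_nat n) + length (enc_nat o') + length (enc_nat d) + length ?y"
    by (simp add: enc_instance_from)
  have bins: "length (bin n) \<le> B" "length (bin o') \<le> B" "length (bin d) \<le> B"
    using B(1) unfolding len by (simp_all add: length_enc_nat)
  have nB: "n + 3 \<le> B" using length_input_from[of 0 n s0 s1] B(1) unfolding len by simp
  have vB: "length (bin (s0 v)) \<le> B \<and> length (bin (s1 v)) \<le> B" if "v < n" for v
    using input_from_bins[OF that, of s0 s1] B(1) unfolding len by simp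
  have d: "d < n" "o' < n" and s: "\<And>v. v < n \<Longrightarrow> s0 v < n \<and> s1 v < n"
    using valid by (auto simp: valid_instance_def)
  \<comment> \<open>A common width lets every subtraction align; \<open>Suc n\<close> digits hold
    any value below \<open>2 ^ n\<close> and are never empty.\<close>
  define t where "t u = map_option (\<lambda>m. SOME ds. length ds = Suc n \<and> val ds = m) (t0 u)" for u
  have t: "length ds = Suc n \<and> t0 u = Some (val ds)" if tu: "t u = Some ds" for u ds
  proof -
    obtain m where m: "t0 u = Some m" "ds = (SOME ds. length ds = Suc n \<and> val ds = m)"
      using tu by (auto simp: t_def)
    have "m < 2 ^ Suc n" using small[OF m(1)] by simp
    then have "length ds = Suc n \<and> val ds = m" unfolding m(2) by (rule someI_ex[OF exists_digits])
    then show ?thesis using m(1) by simp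
  qed
  have t0: "map_option val (t u) = t0 u" for u
    using t[of u] by (cases "t u") (auto simp: t_def)
  have ne: "t u \<noteq> Some []" for u using t[of u "[]"] by auto
  have tB: "length (flat (tab n t)) \<le> B"
  proof -
    have "length (fval (t u)) \<le> Suc n" for u using t[of u] by (cases "t u") auto
    then have "length (flat (tab n t)) \<le> n * (n + Suc n + 3)" by (rule length_flat_tab)
    also have "\<dots> \<le> B" using B(2) by (simp add: algebra_simps)
    finally show ?thesis .
  qed
  let ?E0 = "all_edges0 n s0 o' (Suc n) t" and ?E1 = "edges s1 amt1 n t"
  let ?u1 = "base n o' d ?y (Suc n)"
  let ?u2 = "vst s0 s1 n ?u1 n t"
  note w = vst_end[of s0 s1 n o' d "Suc n" t]
  have 1: "rn B start (inp ?x) ?u1"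
    unfolding enc_instance_from rn_start[OF bins] by (rule exI[of _ "Suc n"]) (use nB in simp)
  have 2: "rn B (Star vertex) ?u1 ?u2"
  proof -
    have g: "guessed B (t u)" for u unfolding guessed_def using t[of u] nB by auto
    have RV: "?u1 RV = []" by (simp add: base_def)
    have "n < B" "n \<le> B" using nB by auto
    have iff: "(rn B vertex ^^ n) (vst s0 s1 n ?u1 0 t) ?u2 \<longleftrightarrow>
        n \<le> n \<and> (\<exists>t'. (\<forall>u<n. guessed B (t' u)) \<and> ?u2 = vst s0 s1 n ?u1 n t')"
      by (rule rn_vertices) (rule RV, rule \<open>n < B\<close>, rule vB)
    have "(rn B vertex ^^ n) (vst s0 s1 n ?u1 0 t) ?u2"
      unfolding iff by (rule conjI[OF le_refl], rule exI[of _ t]) (simp add: g)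
    then have "(rn B vertex ^^ n) ?u1 ?u2" unfolding vst_base .
    then show ?thesis unfolding rn.simps(6) using \<open>n \<le> B\<close> by (rule_tac exI[of _ n]) (rule conjI)
  qed
  have "t0 d = Some 0" using cert by (simp add: certificate_def)
  then obtain dd where "t d = Some dd" "val dd = 0" using t0[of d] by auto
  moreover have "val dd = 0 \<Longrightarrow> dd = replicate (length dd) False" for dd
    by (induction dd) auto
  ultimately have td: "t d = Some (replicate (length dd) False)" by simp
  have tape: "rev (?u2 RL) @ ?u2 RR = flat (tab n t)" using w by simp
  obtain L R where LR: "rev L @ R = flat (tab n t)" and 3: "rn B dcheck ?u2 (?u2(RD := [], RL := L, RR := R))"
    using rn_dcheck(2)[OF tape w(4) d(1) tB td] by blast
  let ?u3 = "?u2(RD := [], RL := L, RR := R)"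
  have amts: "(\<exists>b cs. amt0 (t u) = Some (b, cs) \<and> length cs = Suc n) \<and> (\<exists>b cs. amt1 (t u) = Some (b, cs) \<and> length cs = Suc n)"
    if tu: "t u \<noteq> None" for u
  proof -
    obtain ds where ds: "t u = Some ds" using tu by blast
    then have "length ds = Suc n" using t by blast
    then have "amt0 (t u) = Some (hd ds, tl ds @ [False])" "amt1 (t u) = Some (False, tl ds @ [False])"
      "length (tl ds @ [False]) = Suc n" using ds by simp_all
    then show ?thesis by blast
  qed
  have fB: "length (famt (amt0 (t u))) \<le> B" "length (famt (amt1 (t u))) \<le> B" for u
    using amts[of u] nB by (cases "t u", auto)+
  \<comment> \<open>The certificate inequality is a joint budget for both edge lists: what the first
    drain leaves is enough for the second.\<close>
  have both: "length ds = Suc n \<and> load ?E0 w + load ?E1 w \<le> val ds \<and>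
      (\<forall>c. (w, c) \<in> set ?E0 \<union> set ?E1 \<longrightarrow> (\<exists>b cs. c = Some (b, cs) \<and> length cs = Suc n))"
    if w: "t w = Some ds" "w < n" for w ds
  proof -
    have l: "length ds = Suc n" "t0 w = Some (val ds)" using t[OF w(1)] by auto
    have inf: "inflow n s0 s1 o' (\<lambda>u. the (t0 u)) w \<le> val ds" and
      pred: "\<And>u. u < n \<Longrightarrow> s0 u = w \<or> s1 u = w \<Longrightarrow> t u \<noteq> None"
      using cert w(2) l(2) t0 unfolding certificate_def by (blast, metis option.map_disc_iff)
    have "load ?E0 w + load ?E1 w = inflow n s0 s1 o' (\<lambda>u. the (t0 u)) w"
      unfolding all_edges0_def t0[symmetric] using pred ne by (rule load_inflow)
    moreover have "\<exists>b cs. c = Some (b, cs) \<and> length cs = Suc n" if c: "(w, c) \<in> set ?E0 \<union> set ?E1" for c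
    proof -
      consider u where "u < n" "s0 u = w" "c = amt0 (t u)" | u where "u < n" "s1 u = w" "c = amt1 (t u)"
        | "c = Some (True, replicate (Suc n) False)"
        using c unfolding all_edges0_def set_append set_edges by (auto simp: start_edge_def)
      then show ?thesis
      proof cases
        case 3
        moreover have "length (replicate (Suc n) False) = Suc n" by (rule length_replicate)
        ultimately show ?thesis by blast
      qed (use pred amts in blast)+
    qed
    ultimately show ?thesis using l(1) inf by auto
  qed
  \<comment> \<open>\<open>drain_complete\<close> quantifies over all entries, so the weights are
    cut off outside the vertices; this leaves \<open>tab n\<close> unchanged.\<close>
  define tt where "tt u = (if u < n then t u else None)" for u
  have cong: "tab n tt = tab n t" by (rule tab_cong) (simp add: tt_def)
  have "\<exists>r1. drain ?E0 tt r1 \<and> (\<forall>w. length (fval (r1 w)) = length (fval (tt w))) \<and>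
    (\<forall>w ds. r1 w = Some ds \<longrightarrow> length ds = Suc n \<and> (\<exists>ds0. tt w = Some ds0 \<and> val ds + load ?E0 w = val ds0))"
  proof (rule drain_complete)
    fix w ds assume "tt w = Some ds"
    then have "t w = Some ds" "w < n" by (auto simp: tt_def split: if_splits)
    from both[OF this] show "length ds = Suc n \<and> load ?E0 w \<le> val ds \<and>
        (\<forall>c. (w, c) \<in> set ?E0 \<longrightarrow> (\<exists>b cs. c = Some (b, cs) \<and> length cs = Suc n))" by auto
  qed
  then obtain r1 where r1: "drain ?E0 tt r1" "\<And>w. length (fval (r1 w)) = length (fval (tt w))"
    "\<And>w ds. r1 w = Some ds \<Longrightarrow> length ds = Suc n \<and> (\<exists>ds0. tt w = Some ds0 \<and> val ds + load ?E0 w = val ds0)"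
    by blast
  have "\<exists>r2. drain ?E1 r1 r2 \<and> (\<forall>w. length (fval (r2 w)) = length (fval (r1 w))) \<and>
    (\<forall>w ds. r2 w = Some ds \<longrightarrow> length ds = Suc n \<and> (\<exists>ds0. r1 w = Some ds0 \<and> val ds + load ?E1 w = val ds0))"
  proof (rule drain_complete)
    fix w ds assume "r1 w = Some ds"
    from r1(3)[OF this] obtain ds0 where "length ds = Suc n" "tt w = Some ds0" "val ds + load ?E0 w = val ds0" by blast
    moreover from this have "t w = Some ds0" "w < n" by (auto simp: tt_def split: if_splits)
    ultimately show "length ds = Suc n \<and> load ?E1 w \<le> val ds \<and>
        (\<forall>c. (w, c) \<in> set ?E1 \<longrightarrow> (\<exists>b cs. c = Some (b, cs) \<and> length cs = Suc n))"
      using both[of w ds0] by auto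
  qed
  then obtain r2 where r2: "drain ?E1 r1 r2" by blast
  have e0: "\<forall>(w, c)\<in>set ?E0. w < n \<and> length (famt c) \<le> B"
    unfolding all_edges0_def set_append set_edges using s d(2) fB nB by (auto simp: start_edge_def)
  have e1: "\<forall>(w, c)\<in>set ?E1. w < n \<and> length (famt c) \<le> B"
    unfolding set_edges using s fB by auto
  have "?u3 RE0 = flatE ?E0" "rev (?u3 RL) @ ?u3 RR = flat (tab n tt)" using w(5) LR cong by simp_all
  moreover have "length (flat (tab n tt)) \<le> B" using tB cong by simp
  ultimately obtain L1 R1 where LR1: "rev L1 @ R1 = flat (tab n r1)"
    and run0: "(rn B (sub RE0) ^^ length ?E0) ?u3 (?u3(RE0 := [], RL := L1, RR := R1))"
    using subs_complete[OF _ _ r1(1) _ _ _ e0, where E = RE0 and s = ?u3] by blast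
  let ?u4 = "?u3(RE0 := [], RL := L1, RR := R1)"
  have 4: "rn B (subs RE0) ?u3 ?u4"
    unfolding subs_def rn_Seq rn.simps(3,6)
    using run0 nB by (intro exI[of _ ?u4] conjI exI[of _ "length ?E0"]) (simp_all add: all_edges0_def)
  have "?u4 RE1 = flatE ?E1" "rev (?u4 RL) @ ?u4 RR = flat (tab n r1)" using w(6) LR1 by simp_all
  moreover have "length (flat (tab n r1)) \<le> B"
    using length_flat_tab_cong[of n r1 tt] r1(2) tB cong by simp
  ultimately obtain L2 R2 where
    run1: "(rn B (sub RE1) ^^ length ?E1) ?u4 (?u4(RE1 := [], RL := L2, RR := R2))"
    using subs_complete[OF _ _ r2 _ _ _ e1, where E = RE1 and s = ?u4] by blast
  let ?u5 = "?u4(RE1 := [], RL := L2, RR := R2)"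
  have 5: "rn B (subs RE1) ?u4 ?u5"
    unfolding subs_def rn_Seq rn.simps(3,6)
    using run1 nB by (intro exI[of _ ?u5] conjI exI[of _ "length ?E1"]) simp_all
  have "rn B (Emp RX) ?u2 ?u2" using w(1) by simp
  then show ?thesis unfolding vprog_def rn_Seq using 1 2 3 4 5 by blast
qed

section \<open>The verifier for invalid encodings\<close>

lemma skiptok_toks:
  assumes "s RX = map Dig (toks ns)"
  shows "rn B skiptok s s' \<longleftrightarrow> (\<exists>m ns'. ns = m # ns' \<and> length (bin m) \<le> B \<and> s' = s(RX := map Dig (toks ns')))"
proof (cases ns)
  case Nil
  then show ?thesis using assms by (simp add: rn_skiptok)
next
  case (Cons m ns')
  have "s RX = map Dig (dbl ds) @ Dig True # Dig False # r \<longleftrightarrow> ds = bin m \<and> r = map Dig (toks ns')" for ds r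
    unfolding assms map_Dig_token Cons toks_simps enc_nat_dbl append_assoc append_Cons append_Nil dbl_token by auto
  then show ?thesis unfolding rn_skiptok Cons by auto
qed

lemma skiptok_append:
  assumes "s RX = map Dig (enc_nat m @ r)" "length (bin m) \<le> B"
  shows "rn B skiptok s (s(RX := map Dig r))"
  unfolding rn_skiptok using assms
  by (rule_tac x = "bin m" in exI, rule_tac x = "map Dig r" in exI) (simp add: enc_nat_dbl)

lemma readtok_toks:
  assumes "A \<noteq> RX" "s RX = map Dig (toks ns)" "\<forall>m\<in>set ns. length (bin m) \<le> B"
  shows "rn B (readtok A) s s' \<longleftrightarrow> (\<exists>m ns'. ns = m # ns' \<and>
    s' = s(RX := map Dig (toks ns'), A := map Dig (rev (bin m)) @ s A))"
proof (cases ns)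
  case Nil
  have False if asm: "rn B (readtok A) s s'"
  proof -
    obtain ds r u where "s RX = map Dig (dbl ds) @ r" "rn B (Pop RX (Dig True)) (s(RX := r, A := map Dig (rev ds) @ s A)) u"
      using asm unfolding readtok_def rn_Seq rn_readbits[OF assms(1)] by blast
    then show False using Nil assms(1,2) by auto
  qed
  then show ?thesis using Nil by auto
next
  case (Cons m ns')
  then have X: "s RX = map Dig (enc_nat m @ toks ns')" using assms(2) by simp
  have "length (bin m) \<le> B" using Cons assms(3) by simp
  then show ?thesis using rn_readtok[of A s m "toks ns'" B s', OF assms(1) X] Cons by simp
qed

lemma skips_toks:
  assumes "s RX = map Dig (toks ns)" "\<forall>m\<in>set ns. length (bin m) \<le> B"
  shows "(rn B skiptok ^^ k) s s' \<longleftrightarrow> k \<le> length ns \<and> s' = s(RX := map Dig (toks (drop k ns)))"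
proof (induction k arbitrary: s')
  case 0
  have "s(RX := map Dig (toks ns)) = s" using assms(1) by (simp add: fun_upd_idem)
  then show ?case by auto
next
  case (Suc k)
  have 1: "(rn B skiptok ^^ Suc k) s s' \<longleftrightarrow> k \<le> length ns \<and> rn B skiptok (s(RX := map Dig (toks (drop k ns)))) s'"
    unfolding relpowp.simps(2) relcompp_apply Suc.IH by blast
  have "rn B skiptok (s(RX := map Dig (toks (drop k ns)))) s' \<longleftrightarrow>
      (\<exists>m ns'. drop k ns = m # ns' \<and> length (bin m) \<le> B \<and> s' = s(RX := map Dig (toks ns')))"
    by (subst skiptok_toks[of _ "drop k ns"]) simp_all
  also have "\<dots> \<longleftrightarrow> k < length ns \<and> s' = s(RX := map Dig (toks (drop (Suc k) ns)))"
  proof (cases "k < length ns")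
    case True
    then have "drop k ns = ns ! k # drop (Suc k) ns" by (rule Cons_nth_drop_Suc[symmetric])
    moreover have "length (bin (ns ! k)) \<le> B" using True assms(2) by simp
    ultimately show ?thesis using True by auto
  qed simp
  finally show ?case unfolding 1 by auto
qed

lemma skips_append:
  "s RX = map Dig (toks ns @ r) \<Longrightarrow> \<forall>m\<in>set ns. length (bin m) \<le> B \<Longrightarrow>
    (rn B skiptok ^^ length ns) s (s(RX := map Dig r))"
proof (induction ns arbitrary: s)
  case Nil
  then have "s(RX := map Dig r) = s" by (simp add: fun_upd_idem)
  then show ?case by simp
next
  case (Cons m ns)
  have "rn B skiptok s (s(RX := map Dig (toks ns @ r)))"
    using skiptok_append[of s m "toks ns @ r" B] Cons.prems by simp
  moreover have "(rn B skiptok ^^ length ns) (s(RX := map Dig (toks ns @ r)))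
      ((s(RX := map Dig (toks ns @ r)))(RX := map Dig r))"
    by (rule Cons.IH) (use Cons.prems in simp_all)
  then have "(rn B skiptok ^^ length ns) (s(RX := map Dig (toks ns @ r))) (s(RX := map Dig r))"
    unfolding fun_upd_upd .
  ultimately show ?case unfolding length_Cons relpowp_Suc_left by blast
qed

text \<open>The ways in which a token can fail after some equal pairs: the word ends right after a
  pair, it ends with a single bit, a pair \<open>False\<close>, \<open>True\<close> occurs, or the
  terminator follows a most significant digit \<open>False\<close>.\<close>

definition bad :: "bool list \<Rightarrow> bool" where
  "bad q \<longleftrightarrow> (\<exists>b. q = [b, b]) \<or> (\<exists>b. q = [b]) \<or> (\<exists>r. q = False # True # r) \<or>
     (\<exists>r. q = False # False # True # False # r)"

definition bad_end :: com where
  "bad_end = Alt (anyb (\<lambda>b. Pop RX (Dig b) ;; Pop RX (Dig b)) ;; Emp RX) (Alt (anyb (\<lambda>b. Pop RX (Dig b)) ;; Emp RX)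
     (Alt (Pop RX (Dig False) ;; Pop RX (Dig True))
       (Pop RX (Dig False) ;; Pop RX (Dig False) ;; Pop RX (Dig True) ;; Pop RX (Dig False))))"

definition malformed :: com where
  "malformed = Star skiptok ;; skipbits ;; bad_end"

lemma rn_bad_end: "s RX = map Dig q \<Longrightarrow> (\<exists>s'. rn B bad_end s s') \<longleftrightarrow> bad q"
proof -
  assume s: "s RX = map Dig q"
  have 1: "(\<exists>s'. rn B (anyb (\<lambda>b. Pop RX (Dig b) ;; Pop RX (Dig b)) ;; Emp RX) s s') \<longleftrightarrow> (\<exists>b. q = [b, b])"
  proof -
    have "(\<exists>s'. rn B (anyb (\<lambda>b. Pop RX (Dig b) ;; Pop RX (Dig b)) ;; Emp RX) s s') \<longleftrightarrow> (\<exists>b. s RX = [Dig b, Dig b])"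
      by (auto simp: rn_Seq)
    then show ?thesis unfolding s by auto
  qed
  have 2: "(\<exists>s'. rn B (anyb (\<lambda>b. Pop RX (Dig b)) ;; Emp RX) s s') \<longleftrightarrow> (\<exists>b. q = [b])"
  proof -
    have "(\<exists>s'. rn B (anyb (\<lambda>b. Pop RX (Dig b)) ;; Emp RX) s s') \<longleftrightarrow> (\<exists>b. s RX = [Dig b])"
      by (auto simp: rn_Seq)
    then show ?thesis unfolding s by auto
  qed
  have 3: "(\<exists>s'. rn B (Pop RX (Dig False) ;; Pop RX (Dig True)) s s') \<longleftrightarrow> (\<exists>r. q = False # True # r)"
  proof -
    have "(\<exists>s'. rn B (Pop RX (Dig False) ;; Pop RX (Dig True)) s s') \<longleftrightarrow> (\<exists>r. s RX = Dig False # Dig True # r)"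
      by (auto simp: rn_Seq)
    then show ?thesis unfolding s by (auto simp: map_eq_Cons_conv)
  qed
  have 4: "(\<exists>s'. rn B (Pop RX (Dig False) ;; Pop RX (Dig False) ;; Pop RX (Dig True) ;; Pop RX (Dig False)) s s')
      \<longleftrightarrow> (\<exists>r. q = False # False # True # False # r)"
  proof -
    have "(\<exists>s'. rn B (Pop RX (Dig False) ;; Pop RX (Dig False) ;; Pop RX (Dig True) ;; Pop RX (Dig False)) s s')
      \<longleftrightarrow> (\<exists>r. s RX = Dig False # Dig False # Dig True # Dig False # r)"
      by (auto simp: rn_Seq)
    then show ?thesis unfolding s by (auto simp: map_eq_Cons_conv)
  qed
  show ?thesis
    unfolding bad_end_def bad_def rn.simps(5) ex_disj_distrib 1 2 3 4 ..
qed

text \<open>Within a token, the remainder consists of equal pairs and the terminator, and by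
  \<open>last_bin\<close> the last of these pairs is not a zero.\<close>

lemma toks_not_bad: "toks ns = dbl ds @ q \<Longrightarrow> \<not> bad q"
proof (cases ns)
  case (Cons m ns')
  assume "toks ns = dbl ds @ q"
  then have "dbl ds @ q = dbl (bin m) @ True # False # toks ns'" using Cons by (simp add: enc_nat_dbl)
  from dbl_prefix[OF this] obtain es where es: "bin m = ds @ es" "q = dbl es @ True # False # toks ns'" by blast
  show ?thesis
  proof (cases es)
    case Nil
    then show ?thesis using es(2) by (auto simp: bad_def)
  next
    case (Cons e es')
    then have q: "q = e # e # dbl es' @ True # False # toks ns'" using es(2) by simp
    have "es' = [] \<Longrightarrow> e" using es(1) Cons last_bin[of m ds e] by simp
    then show ?thesis unfolding q bad_def by (cases es') auto
  qed
qed (auto simp: bad_def)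

lemma dbl_decomposition:
  "\<exists>ds q. w = dbl ds @ q \<and> (q = [] \<or> (\<exists>b. q = [b]) \<or> (\<exists>r. q = False # True # r) \<or> (\<exists>r. q = True # False # r))"
proof (induction "length w" arbitrary: w rule: less_induct)
  case less
  show ?case
  proof (cases "\<exists>b w'. w = b # b # w'")
    case True
    then obtain b w' where w: "w = b # b # w'" by blast
    then obtain ds q where "w' = dbl ds @ q"
      and q: "q = [] \<or> (\<exists>b. q = [b]) \<or> (\<exists>r. q = False # True # r) \<or> (\<exists>r. q = True # False # r)"
      using less[of w'] by auto
    then have "w = dbl (b # ds) @ q" using w by simp
    then show ?thesis using q by blast
  next
    case False
    have "w = [] \<or> (\<exists>b. w = [b]) \<or> (\<exists>r. w = False # True # r) \<or> (\<exists>r. w = True # False # r)"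
    proof (cases w)
      case (Cons a w1)
      then show ?thesis using False by (cases w1; cases a; cases "hd w1") auto
    qed simp
    moreover have "w = dbl [] @ w" by simp
    ultimately show ?thesis by blast
  qed
qed

text \<open>Tokens are cut off from the left until the first failure, by induction on the length of
  the word.\<close>

lemma toks_or_bad: "(\<exists>ns. w = toks ns) \<or> (\<exists>ns ds q. w = toks ns @ dbl ds @ q \<and> bad q)"
proof (induction "length w" arbitrary: w rule: less_induct)
  case less
  obtain ds q where w: "w = dbl ds @ q" and
    "q = [] \<or> (\<exists>b. q = [b]) \<or> (\<exists>r. q = False # True # r) \<or> (\<exists>r. q = True # False # r)"
    using dbl_decomposition by blast
  then consider "q = []" | "bad q" | r where "q = True # False # r"
    unfolding bad_def by blast
  then show ?case
  proof cases
    case 1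
    show ?thesis
    proof (cases ds rule: rev_cases)
      case Nil
      then have "w = toks []" using w 1 by simp
      then show ?thesis by blast
    next
      case (snoc ds' b)
      then have "w = toks [] @ dbl ds' @ [b, b]" using w 1 by simp
      moreover have "bad [b, b]" by (simp add: bad_def)
      ultimately show ?thesis by blast
    qed
  next
    case 2
    then have "w = toks [] @ dbl ds @ q" using w by simp
    then show ?thesis using 2 by blast
  next
    case 3
    show ?thesis
    \<comment> \<open>Digits without a leading zero are canonical by \<open>bin_val\<close>;
      otherwise a zero pair precedes the terminator, the last case of \<open>bad\<close>.\<close>
    proof (cases "ds = [] \<or> last ds")
      case True
      then have w': "w = enc_nat (val ds) @ r" using w 3 bin_val[of ds] by (simp add: enc_nat_dbl)
      have "length r < length w" using w 3 by simp
      from less[OF this] show ?thesis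
      proof (elim disjE exE conjE)
        fix ns assume "r = toks ns"
        then have "w = toks (val ds # ns)" using w' by simp
        then show ?thesis by blast
      next
        fix ns es p assume "r = toks ns @ dbl es @ p" "bad p"
        then have "w = toks (val ds # ns) @ dbl es @ p" using w' by simp
        then show ?thesis using \<open>bad p\<close> by blast
      qed
    next
      case False
      then obtain ds' where "ds = ds' @ [False]" by (metis append_butlast_last_id)
      then have "w = toks [] @ dbl ds' @ False # False # True # False # r" using w 3 by simp
      moreover have "bad (False # False # True # False # r)" by (simp add: bad_def)
      ultimately show ?thesis by blast
    qed
  qed
qed

lemma malformed_sound: "\<not> rn B malformed (inp (toks ns)) s'"
proof
  let ?s = "inp (toks ns)"
  define B1 where "B1 = B + length (toks ns)"
  have X: "?s RX = map Dig (toks ns)" by (simp add: inp_def)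
  have b: "\<forall>m\<in>set ns. length (bin m) \<le> B1" using length_toks(2) unfolding B1_def by fastforce
  assume "rn B malformed ?s s'"
  then have "rn B1 malformed ?s s'" by (rule rn_mono[rotated]) (simp add: B1_def)
  then obtain k u v where u: "(rn B1 skiptok ^^ k) ?s u" "rn B1 skipbits u v" "rn B1 bad_end v s'"
    unfolding malformed_def rn_Seq rn.simps(6) by blast
  have "u = ?s(RX := map Dig (toks (drop k ns)))" using skips_toks[of ?s ns B1 k u] X b u(1) by blast
  then have "u RX = map Dig (toks (drop k ns))" by simp
  then obtain ds r where "map Dig (toks (drop k ns)) = map Dig (dbl ds) @ r" "v = u(RX := r)"
    using u(2) unfolding rn_skipbits by auto
  then obtain q where "toks (drop k ns) = dbl ds @ q" "v RX = map Dig q"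
    by (auto simp: map_eq_append_conv)
  then show False using toks_not_bad rn_bad_end[of v q B1] u(3) by blast
qed

lemma malformed_complete:
  assumes "w = toks ns @ dbl ds @ q" "bad q" "length w \<le> B"
  shows "\<exists>s'. rn B malformed (inp w) s'"
proof -
  let ?s = "inp w"
  have "\<forall>m\<in>set ns. length (bin m) \<le> B" using length_toks(2)[of _ ns] assms(1,3) by fastforce
  then have "(rn B skiptok ^^ length ns) ?s (?s(RX := map Dig (dbl ds @ q)))"
    using assms(1) by (intro skips_append) (simp_all add: inp_def)
  moreover have "length ns \<le> B" using length_toks(1)[of ns] assms(1,3) by simp
  ultimately have 1: "rn B (Star skiptok) ?s (?s(RX := map Dig (dbl ds @ q)))"
    unfolding rn.simps(6) by blast
  have "length ds \<le> B" using assms(1,3) by simp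
  then have 2: "rn B skipbits (?s(RX := map Dig (dbl ds @ q))) (?s(RX := map Dig q))"
    unfolding rn_skipbits by (rule_tac x = ds in exI, rule_tac x = "map Dig q" in exI) simp
  obtain s' where "rn B bad_end (?s(RX := map Dig q)) s'"
    using rn_bad_end[of "?s(RX := map Dig q)" q B] assms(2) by auto
  then show ?thesis unfolding malformed_def rn_Seq using 1 2 by blast
qed

section \<open>Token sequences of the wrong length or with entries out of range\<close>

definition neq :: com where
  "neq = Star (anyb (\<lambda>b. Pop RU (Dig b) ;; Pop RM (Dig b))) ;;
     Alt (anyb (\<lambda>b. Pop RU (Dig b) ;; Pop RM (Dig (\<not> b))))
       (Alt (anyb (\<lambda>b. Pop RU (Dig b)) ;; Emp RM) (anyb (\<lambda>b. Pop RM (Dig b)) ;; Emp RU))"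

text \<open>For different lists the loop runs along the longest common prefix; then the next digits
  differ or exactly one list has ended.\<close>

lemma rn_neq:
  assumes "s RU = map Dig xs" "s RM = map Dig ys"
  shows "rn B neq s s' \<Longrightarrow> xs \<noteq> ys" and "xs \<noteq> ys \<Longrightarrow> length xs \<le> B \<Longrightarrow> \<exists>s'. rn B neq s s'"
proof -
  have "path (\<lambda>b. rn B (Pop RU (Dig b) ;; Pop RM (Dig b))) ds s s' \<longleftrightarrow>
      (\<exists>x y. s RU = map Dig ds @ x \<and> s RM = map Dig ds @ y \<and> s' = s(RU := x, RM := y))" for ds s s'
  proof (induction ds arbitrary: s)
    case Nil
    have "s(RU := s RU, RM := s RM) = s" by simp
    then show ?case by (simp del: fun_upd_apply) metis
  next
    case (Cons b ds)
    have *: "rn B (Pop RU (Dig b) ;; Pop RM (Dig b)) s u \<longleftrightarrow>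
        (\<exists>x y. s RU = Dig b # x \<and> s RM = Dig b # y \<and> u = s(RU := x, RM := y))" for u
      unfolding rn_Seq by auto
    have upd: "s(RU := x, RM := y, RU := x', RM := y') = s(RU := x', RM := y')" for x y x' y'
      by (rule ext) simp
    show ?case
      unfolding path.simps relcompp_apply Cons.IH * ex_state_point upd by (auto intro!: ext)
  qed
  then have loop: "rn B (Star (anyb (\<lambda>b. Pop RU (Dig b) ;; Pop RM (Dig b)))) s u \<longleftrightarrow>
     (\<exists>ds. length ds \<le> B \<and> (\<exists>x y. s RU = map Dig ds @ x \<and> s RM = map Dig ds @ y \<and> u = s(RU := x, RM := y)))" for u
    unfolding rn_Star_anyb by simp
  let ?end = "Alt (anyb (\<lambda>b. Pop RU (Dig b) ;; Pop RM (Dig (\<not> b))))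
       (Alt (anyb (\<lambda>b. Pop RU (Dig b)) ;; Emp RM) (anyb (\<lambda>b. Pop RM (Dig b)) ;; Emp RU))"
  have fin: "(\<exists>s'. rn B ?end u s') \<longleftrightarrow> (\<exists>b x y. u RU = Dig b # x \<and> u RM = Dig (\<not> b) # y) \<or>
     (\<exists>b x. u RU = Dig b # x \<and> u RM = []) \<or> (\<exists>b y. u RM = Dig b # y \<and> u RU = [])" for u
    unfolding rn.simps(5) rn_Seq rn_anyb ex_disj_distrib by auto
  show "xs \<noteq> ys" if "rn B neq s s'"
  proof
    assume "xs = ys"
    obtain u where "rn B (Star (anyb (\<lambda>b. Pop RU (Dig b) ;; Pop RM (Dig b)))) s u" "rn B ?end u s'"
      using \<open>rn B neq s s'\<close> unfolding neq_def rn_Seq by blast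
    moreover from this(1) have "u RU = u RM" unfolding loop using assms \<open>xs = ys\<close> by auto
    ultimately show False using fin[of u] by auto
  qed
  show "\<exists>s'. rn B neq s s'" if ne: "xs \<noteq> ys" and l: "length xs \<le> B"
  proof -
    obtain ds xs' ys' where d: "xs = ds @ xs'" "ys = ds @ ys'" "xs' = [] \<or> ys' = [] \<or> hd xs' \<noteq> hd ys'"
      using longest_common_prefix[of xs ys] by blast
    let ?u = "s(RU := map Dig xs', RM := map Dig ys')"
    have 1: "rn B (Star (anyb (\<lambda>b. Pop RU (Dig b) ;; Pop RM (Dig b)))) s ?u"
      unfolding loop using d(1,2) l assms
      by (rule_tac x = ds in exI, intro conjI, simp, rule_tac x = "map Dig xs'" in exI, rule_tac x = "map Dig ys'" in exI) simp
    have "(\<exists>b x y. ?u RU = Dig b # x \<and> ?u RM = Dig (\<not> b) # y) \<or>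
     (\<exists>b x. ?u RU = Dig b # x \<and> ?u RM = []) \<or> (\<exists>b y. ?u RM = Dig b # y \<and> ?u RU = [])"
      using d ne by (cases xs'; cases ys') auto
    then obtain s' where "rn B ?end ?u s'" unfolding fin[symmetric] by blast
    then show ?thesis unfolding neq_def rn_Seq using 1 by blast
  qed
qed

text \<open>The residue of reusing \<open>emit\<close> as a plain counter: its old values pile up on
  \<open>RR\<close>.\<close>

primrec emitted :: "nat \<Rightarrow> sym list \<Rightarrow> sym list" where
  "emitted 0 q = q"
| "emitted (Suc k) q = map Dig (rev (bin k)) @ emitted k q"

definition count_pairs :: com where
  "count_pairs = skiptok ;; skiptok ;; emit"

text \<open>In an encoding, \<open>2 * n + 2\<close> tokens follow \<open>n\<close>. The
  alternatives catch no token at all, an odd number of them, and \<open>2 + 2 * k\<close> tokens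
  with \<open>k\<close> different from \<open>n\<close>.\<close>

definition wrong_length :: com where
  "wrong_length = readtok RN ;; Alt (Emp RX) (Alt (Star (skiptok ;; skiptok) ;; skiptok ;; Emp RX)
     (skiptok ;; skiptok ;; Star count_pairs ;; Emp RX ;; copy RN RM ;; Emp RN ;; neq))"

text \<open>Tests \<open>n \<le> m\<close> by subtraction: \<open>n\<close> is padded with a guessed
  number of zeros to the width of \<open>m\<close>, and \<open>subtract\<close> succeeds only
  without a final borrow.\<close>

definition compare :: com where
  "compare = Push RE0 Hash ;; pad RE0 ;; copy RN RE0 ;; Emp RN ;;
     Push RE0 (Dig False) ;; Push RR Hash ;; copy RM RR ;; Emp RM ;; subtract RE0"

definition out_of_range :: com where
  "out_of_range = readtok RN ;; Star skiptok ;; readtok RM ;; compare"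

lemma skip2_toks:
  assumes "s RX = map Dig (toks ns)" "\<forall>m\<in>set ns. length (bin m) \<le> B"
  shows "rn B (skiptok ;; skiptok) s s' \<longleftrightarrow> 2 \<le> length ns \<and> s' = s(RX := map Dig (toks (drop 2 ns)))"
proof -
  have "rn B (skiptok ;; skiptok) s s' \<longleftrightarrow> (rn B skiptok ^^ 2) s s'"
    unfolding numeral_2_eq_2 relpowp_Suc_left rn_Seq by simp
  then show ?thesis using skips_toks[of s ns B 2 s'] assms by blast
qed

lemma skip2s_toks:
  assumes "s RX = map Dig (toks ns)" "\<forall>m\<in>set ns. length (bin m) \<le> B"
  shows "(rn B (skiptok ;; skiptok) ^^ k) s s' \<longleftrightarrow> 2 * k \<le> length ns \<and> s' = s(RX := map Dig (toks (drop (2 * k) ns)))"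
proof (induction k arbitrary: s')
  case 0
  have "s(RX := map Dig (toks ns)) = s" using assms(1) by (simp add: fun_upd_idem)
  then show ?case by auto
next
  case (Suc k)
  have 1: "(rn B (skiptok ;; skiptok) ^^ Suc k) s s' \<longleftrightarrow> 2 * k \<le> length ns \<and>
      rn B (skiptok ;; skiptok) (s(RX := map Dig (toks (drop (2 * k) ns)))) s'"
    unfolding relpowp.simps(2) relcompp_apply Suc.IH by blast
  have b: "\<forall>m\<in>set (drop (2 * k) ns). length (bin m) \<le> B" using assms(2) by (meson in_set_dropD)
  have 2: "rn B (skiptok ;; skiptok) (s(RX := map Dig (toks (drop (2 * k) ns)))) s' \<longleftrightarrow>
      2 \<le> length (drop (2 * k) ns) \<and> s' = s(RX := map Dig (toks (drop 2 (drop (2 * k) ns))))"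
    using skip2_toks[of "s(RX := map Dig (toks (drop (2 * k) ns)))" "drop (2 * k) ns" B s'] b by simp
  show ?case unfolding 1 2 by auto
qed

lemma count_pairs_toks:
  assumes "s RX = map Dig (toks ns)" "\<forall>m\<in>set ns. length (bin m) \<le> B" "s RU = []" "s RV = []" "length ns < B"
  shows "(rn B count_pairs ^^ k) s s' \<longleftrightarrow> 2 * k \<le> length ns \<and>
    s' = s(RX := map Dig (toks (drop (2 * k) ns)), RU := map Dig (bin k), RR := emitted k (s RR))"
proof (induction k arbitrary: s')
  case 0
  have "s(RX := map Dig (toks ns), RU := [], RR := s RR) = s"
    using assms(1,3) by (intro ext) simp
  then show ?case by (simp del: fun_upd_apply) metis
next
  case (Suc k)
  define u where "u = s(RX := map Dig (toks (drop (2 * k) ns)), RU := map Dig (bin k), RR := emitted k (s RR))"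
  have 1: "(rn B count_pairs ^^ Suc k) s s' \<longleftrightarrow> 2 * k \<le> length ns \<and> rn B count_pairs u s'"
    unfolding relpowp.simps(2) relcompp_apply Suc.IH u_def by blast
  show ?case
  proof (cases "2 * Suc k \<le> length ns")
    case True
    have b: "\<forall>m\<in>set (drop (2 * k) ns). length (bin m) \<le> B" using assms(2) by (meson in_set_dropD)
    let ?v = "u(RX := map Dig (toks (drop 2 (drop (2 * k) ns))))"
    have skip: "rn B (skiptok ;; skiptok) u w \<longleftrightarrow> w = ?v" for w
    proof -
      have "u RX = map Dig (toks (drop (2 * k) ns))" by (simp add: u_def)
      moreover have "2 \<le> length (drop (2 * k) ns)" using True by simp
      ultimately show ?thesis using skip2_toks[of u "drop (2 * k) ns" B w] b by blast
    qed
    have "length (bin k) < B" using length_bin[of k] True assms(5) by simp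
    then have emit: "rn B emit ?v w \<longleftrightarrow> w = ?v(RU := map Dig (inc (bin k)), RR := map Dig (rev (bin k)) @ ?v RR)" for w
      using assms(4) by (intro rn_emit) (simp_all add: u_def)
    have "rn B count_pairs u s' \<longleftrightarrow> rn B ((skiptok ;; skiptok) ;; emit) u s'"
      unfolding count_pairs_def rn_Seq by blast
    also have "\<dots> \<longleftrightarrow> s' = ?v(RU := map Dig (inc (bin k)), RR := map Dig (rev (bin k)) @ ?v RR)"
      unfolding rn_step[OF skip] emit ..
    also have "?v(RU := map Dig (inc (bin k)), RR := map Dig (rev (bin k)) @ ?v RR)
       = s(RX := map Dig (toks (drop (2 * Suc k) ns)), RU := map Dig (bin (Suc k)), RR := emitted (Suc k) (s RR))"
      unfolding u_def by (rule ext) (simp add: bin_Suc)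
    finally show ?thesis using True unfolding 1 by auto
  next
    case False
    have "\<not> rn B count_pairs u s'" if "2 * k \<le> length ns"
    proof
      assume "rn B count_pairs u s'"
      then obtain w where "rn B (skiptok ;; skiptok) u w" unfolding count_pairs_def rn_Seq by blast
      moreover have "\<forall>m\<in>set (drop (2 * k) ns). length (bin m) \<le> B" using assms(2) by (meson in_set_dropD)
      moreover have "u RX = map Dig (toks (drop (2 * k) ns))" by (simp add: u_def)
      ultimately have "2 \<le> length (drop (2 * k) ns)"
        using skip2_toks[of u "drop (2 * k) ns" B w] by blast
      then show False using False by simp
    qed
    then show ?thesis using False unfolding 1 by auto
  qed
qed

lemma wrong_length_tail:
  assumes "s RN = map Dig (rev (bin n))" "s RM = []" "s RU = map Dig (bin k)" "length (bin n) \<le> B" "length (bin k) \<le> B"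
  shows "(\<exists>s'. rn B (copy RN RM ;; Emp RN ;; neq) s s') \<longleftrightarrow> k \<noteq> n"
proof -
  let ?w = "s(RN := [], RM := map Dig (bin n))"
  have 1: "rn B (copy RN RM ;; Emp RN ;; neq) s s' \<longleftrightarrow> rn B neq ?w s'" for s'
  proof
    assume "rn B (copy RN RM ;; Emp RN ;; neq) s s'"
    then obtain ds r where *: "s RN = map Dig ds @ r" "r = []" "rn B neq (s(RN := r, RM := map Dig (rev ds) @ s RM)) s'"
      unfolding rn_Seq rn_copy[of RN RM, simplified] rn.simps(3) by auto
    then have "ds = rev (bin n)" using assms(1) by simp
    then show "rn B neq ?w s'" using * assms(2) by simp
  next
    assume "rn B neq ?w s'"
    moreover have "rn B (copy RN RM) s ?w"
      unfolding rn_copy[of RN RM, simplified] using assms(1,2,4)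
      by (rule_tac x = "rev (bin n)" in exI, intro conjI, simp, rule_tac x = "[]" in exI) simp
    moreover have "rn B (Emp RN) ?w ?w" by simp
    ultimately show "rn B (copy RN RM ;; Emp RN ;; neq) s s'" unfolding rn_Seq by blast
  qed
  have w: "?w RU = map Dig (bin k)" "?w RM = map Dig (bin n)" using assms(3) by simp_all
  show ?thesis unfolding 1 using rn_neq[OF w] assms(5) by (metis bin_inject)
qed

lemma rn_wrong_length:
  assumes "length (toks (n # ns)) < B"
  shows "(\<exists>s'. rn B wrong_length (inp (toks (n # ns))) s') \<longleftrightarrow> length ns \<noteq> 2 * n + 2"
proof -
  let ?s = "inp (toks (n # ns))"
  let ?u = "?s(RX := map Dig (toks ns), RN := map Dig (rev (bin n)))"
  have b: "\<forall>m\<in>set (n # ns). length (bin m) \<le> B" using length_toks(2)[of _ "n # ns"] assms by (meson le_trans less_imp_le)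
  then have bns: "\<forall>m\<in>set ns. length (bin m) \<le> B" by simp
  have l: "2 * length (n # ns) < B" using length_toks(1)[of "n # ns"] assms by linarith
  have X: "?s RX = map Dig (toks (n # ns))" by (simp add: inp_def)
  have "rn B (readtok RN) ?s w \<longleftrightarrow> w = ?u" for w
    using readtok_toks[of RN ?s "n # ns" B w, OF _ X b] by (simp add: inp_def)
  note read = rn_step[OF this]
  have uX: "?u RX = map Dig (toks ns)" by simp
  have 1: "(\<exists>s'. rn B (Emp RX) ?u s') \<longleftrightarrow> ns = []"
    by (cases ns) (auto simp: enc_nat_def)
  have 2: "(\<exists>s'. rn B (Star (skiptok ;; skiptok) ;; skiptok ;; Emp RX) ?u s') \<longleftrightarrow> odd (length ns)"
  proof -
    let ?v = "\<lambda>k. ?u(RX := map Dig (toks (drop (2 * k) ns)))"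
    have last: "(\<exists>s'. rn B (skiptok ;; Emp RX) (?v k) s') \<longleftrightarrow> length ns = 2 * k + 1"
      if k: "2 * k \<le> length ns" for k
    proof -
      have vX: "?v k RX = map Dig (toks (drop (2 * k) ns))" by simp
      have "(\<exists>s'. rn B (skiptok ;; Emp RX) (?v k) s') \<longleftrightarrow>
          (\<exists>w. rn B skiptok (?v k) w \<and> w RX = [])"
        unfolding rn_Seq rn.simps(3) by blast
      also have "\<dots> \<longleftrightarrow> (\<exists>m ns'. drop (2 * k) ns = m # ns' \<and> length (bin m) \<le> B \<and> map Dig (toks ns') = [])"
        unfolding skiptok_toks[of "?v k" "drop (2 * k) ns" B, OF vX] by (auto simp del: fun_upd_upd)
      also have "\<dots> \<longleftrightarrow> (\<exists>m. drop (2 * k) ns = [m] \<and> length (bin m) \<le> B)"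
      proof -
        have "map Dig (toks zs) = [] \<longleftrightarrow> zs = []" for zs
          by (cases zs) (auto simp: enc_nat_def)
        then show ?thesis by simp
      qed
      also have "\<dots> \<longleftrightarrow> length (drop (2 * k) ns) = 1"
      proof -
        have "length (bin m) \<le> B" if "drop (2 * k) ns = [m]" for m
          using that bns by (metis in_set_dropD list.set_intros(1))
        moreover have "length zs = 1 \<longleftrightarrow> (\<exists>m. zs = [m])" for zs :: "nat list"
          by (cases zs; cases "tl zs") auto
        ultimately show ?thesis by blast
      qed
      also have "\<dots> \<longleftrightarrow> length ns = 2 * k + 1" using k by auto
      finally show ?thesis .
    qed
    have st: "rn B (Star (skiptok ;; skiptok)) ?u x \<longleftrightarrow> (\<exists>k\<le>B. 2 * k \<le> length ns \<and> x = ?v k)" for x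
      unfolding rn.simps(6) skip2s_toks[of ?u ns B, OF uX bns] ..
    have "(\<exists>s'. rn B (Star (skiptok ;; skiptok) ;; skiptok ;; Emp RX) ?u s') \<longleftrightarrow>
      (\<exists>k\<le>B. 2 * k \<le> length ns \<and> (\<exists>s'. rn B (skiptok ;; Emp RX) (?v k) s'))"
      unfolding rn_Seq[of B "Star _"] st by blast
    also have "\<dots> \<longleftrightarrow> (\<exists>k\<le>B. 2 * k \<le> length ns \<and> length ns = 2 * k + 1)"
      by (intro ex_cong1 conj_cong refl last)
    also have "\<dots> \<longleftrightarrow> odd (length ns)"
    proof -
      have "L < B \<Longrightarrow> (\<exists>k\<le>B. 2 * k \<le> L \<and> L = 2 * k + 1) \<longleftrightarrow> odd L" for L :: nat by presburger
      then show ?thesis using l by simp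
    qed
    finally show ?thesis .
  qed
  have 3: "(\<exists>s'. rn B (skiptok ;; skiptok ;; Star count_pairs ;; Emp RX ;; copy RN RM ;; Emp RN ;; neq) ?u s')
     \<longleftrightarrow> (\<exists>k. length ns = 2 + 2 * k \<and> k \<noteq> n)"
  proof -
    let ?ms = "drop 2 ns"
    let ?v = "?u(RX := map Dig (toks ?ms))"
    let ?w = "\<lambda>k. ?v(RX := map Dig (toks (drop (2 * k) ?ms)), RU := map Dig (bin k), RR := emitted k (?v RR))"
    let ?rest = "copy RN RM ;; Emp RN ;; neq"
    have bms: "\<forall>m\<in>set ?ms. length (bin m) \<le> B" using bns by (meson in_set_dropD)
    have vX: "?v RX = map Dig (toks ?ms)" "?v RU = []" "?v RV = []" "length ?ms < B" using l by (auto simp: inp_def)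
    have cp: "rn B (Star count_pairs) ?v x \<longleftrightarrow> (\<exists>k\<le>B. 2 * k \<le> length ?ms \<and> x = ?w k)" for x
      unfolding rn.simps(6) using count_pairs_toks[of ?v ?ms B, OF vX(1) bms vX(2-4)] by blast
    have emp: "rn B (Emp RX) (?w k) x \<longleftrightarrow> 2 * k = length ?ms \<and> x = ?w k" if "2 * k \<le> length ?ms" for k x
    proof -
      have "toks (drop (2 * k) ?ms) = [] \<longleftrightarrow> drop (2 * k) ?ms = []"
        by (cases "drop (2 * k) ?ms") (auto simp: enc_nat_def)
      then show ?thesis using that by auto
    qed
    have tail: "(\<exists>s'. rn B ?rest (?w k) s') \<longleftrightarrow> k \<noteq> n" if "2 * k \<le> length ?ms" for k
    proof (rule wrong_length_tail)
      show "length (bin n) \<le> B" using b by simp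
      show "length (bin k) \<le> B" using length_bin[of k] that l by simp
    qed (simp_all add: inp_def)
    have step: "(\<exists>s'. rn B (Emp RX ;; ?rest) (?w k) s') \<longleftrightarrow> 2 * k = length ?ms \<and> k \<noteq> n"
      if k: "2 * k \<le> length ?ms" for k
    proof -
      have "(\<exists>s'. rn B (Emp RX ;; ?rest) (?w k) s') \<longleftrightarrow> 2 * k = length ?ms \<and> (\<exists>s'. rn B ?rest (?w k) s')"
        unfolding rn_Seq[of B "Emp RX"] emp[OF k] by blast
      then show ?thesis unfolding tail[OF k] .
    qed
    have "(\<exists>s'. rn B (Star count_pairs ;; Emp RX ;; ?rest) ?v s') \<longleftrightarrow>
         (\<exists>k\<le>B. 2 * k \<le> length ?ms \<and> (\<exists>s'. rn B (Emp RX ;; ?rest) (?w k) s'))"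
      unfolding rn_Seq[of B "Star _"] cp by blast
    also have "\<dots> \<longleftrightarrow> (\<exists>k\<le>B. 2 * k \<le> length ?ms \<and> 2 * k = length ?ms \<and> k \<noteq> n)"
      by (intro ex_cong1 conj_cong refl step)
    also have "\<dots> \<longleftrightarrow> (\<exists>k\<le>B. 2 * k = length ?ms \<and> k \<noteq> n)" by (rule ex_cong1) auto
    finally have "(\<exists>s'. rn B (Star count_pairs ;; Emp RX ;; ?rest) ?v s') \<longleftrightarrow> (\<exists>k\<le>B. 2 * k = length ?ms \<and> k \<noteq> n)" .
    moreover have "rn B (skiptok ;; skiptok ;; Star count_pairs ;; Emp RX ;; ?rest) ?u s' \<longleftrightarrow>
        2 \<le> length ns \<and> rn B (Star count_pairs ;; Emp RX ;; ?rest) ?v s'" for s'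
    proof -
      have "rn B (skiptok ;; skiptok ;; Star count_pairs ;; Emp RX ;; ?rest) ?u s' \<longleftrightarrow>
          rn B ((skiptok ;; skiptok) ;; Star count_pairs ;; Emp RX ;; ?rest) ?u s'"
        unfolding rn_Seq by blast
      also have "\<dots> \<longleftrightarrow> 2 \<le> length ns \<and> rn B (Star count_pairs ;; Emp RX ;; ?rest) ?v s'"
        unfolding rn_Seq[of B "skiptok ;; skiptok"] skip2_toks[of ?u ns B, OF uX bns] by blast
      finally show ?thesis .
    qed
    ultimately have "(\<exists>s'. rn B (skiptok ;; skiptok ;; Star count_pairs ;; Emp RX ;; ?rest) ?u s')
      \<longleftrightarrow> 2 \<le> length ns \<and> (\<exists>k\<le>B. 2 * k = length ns - 2 \<and> k \<noteq> n)" by (simp only: length_drop) blast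
    also have "\<dots> \<longleftrightarrow> (\<exists>k. length ns = 2 + 2 * k \<and> k \<noteq> n)"
    proof -
      have "2 \<le> L \<and> (\<exists>k\<le>B. 2 * k = L - 2 \<and> k \<noteq> n) \<longleftrightarrow> (\<exists>k. L = 2 + 2 * k \<and> k \<noteq> n)" if "L < B" for L
      proof -
        have "2 \<le> L \<and> k \<le> B \<and> 2 * k = L - 2 \<longleftrightarrow> L = 2 + 2 * k" for k using that by linarith
        then show ?thesis by blast
      qed
      then show ?thesis using l by simp
    qed
    finally show ?thesis .
  qed
  have "(\<exists>s'. rn B wrong_length ?s s') \<longleftrightarrow> ns = [] \<or> odd (length ns) \<or> (\<exists>k. length ns = 2 + 2 * k \<and> k \<noteq> n)"
    unfolding wrong_length_def read rn.simps(5) ex_disj_distrib 1 2 3 ..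
  also have "\<dots> \<longleftrightarrow> length ns \<noteq> 2 * n + 2"
  proof -
    have "L = 0 \<or> odd L \<or> (\<exists>k. L = 2 + 2 * k \<and> k \<noteq> n) \<longleftrightarrow> L \<noteq> 2 * n + 2" for L by presburger
    from this[of "length ns"] show ?thesis by (simp only: length_0_conv)
  qed
  finally show ?thesis .
qed

text \<open>Registers filled by \<open>readtok\<close> hold reversed digits; pouring restores their
  order, and \<open>Emp i\<close> forces the copy to be complete.\<close>

lemma rn_pour:
  assumes "i \<noteq> j" "s i = map Dig (rev ds)" "length ds \<le> B"
  shows "rn B (copy i j ;; Emp i ;; c) s s' \<longleftrightarrow> rn B c (s(i := [], j := map Dig ds @ s j)) s'"
proof
  assume "rn B (copy i j ;; Emp i ;; c) s s'"
  then obtain es r where *: "s i = map Dig es @ r" "rn B (Emp i ;; c) (s(i := r, j := map Dig (rev es) @ s j)) s'"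
    unfolding rn_Seq[of B "copy i j"] rn_copy[OF assms(1)] by blast
  then have "r = []" "rn B c (s(i := r, j := map Dig (rev es) @ s j)) s'"
    unfolding rn_Seq rn.simps(3) using assms(1) by auto
  moreover from this have "es = rev ds" using * assms(2) by simp
  ultimately show "rn B c (s(i := [], j := map Dig ds @ s j)) s'" by simp
next
  let ?w = "s(i := [], j := map Dig ds @ s j)"
  assume "rn B c ?w s'"
  moreover have "rn B (copy i j) s ?w"
    unfolding rn_copy[OF assms(1)] using assms(2,3)
    by (rule_tac x = "rev ds" in exI, rule_tac x = "[]" in exI) simp
  moreover have "rn B (Emp i) ?w ?w" using assms(1) by simp
  ultimately show "rn B (copy i j ;; Emp i ;; c) s s'" unfolding rn_Seq by blast
qed

text \<open>Padding can only lengthen \<open>xs\<close>, hence the condition on the lengths; for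
  canonical lists it follows from the one on the values.\<close>

lemma rn_compare:
  assumes s: "s RN = map Dig (rev xs)" "s RM = map Dig (rev ys)" "s RE0 = []" "s RR = []"
    and B: "length xs \<le> B" "length ys \<le> B"
  shows "(\<exists>s'. rn B compare s s') \<longleftrightarrow> length xs \<le> length ys \<and> val xs \<le> val ys"
proof -
  define s1 where "s1 = s(RE0 := [Hash])"
  define s2 where "s2 k = s1(RE0 := replicate k (Dig False) @ s1 RE0)" for k
  define s3 where "s3 k = (s2 k)(RN := [], RE0 := map Dig xs @ s2 k RE0)" for k
  define s4 where "s4 k = (s3 k)(RE0 := Dig False # s3 k RE0)" for k
  define s5 where "s5 k = (s4 k)(RR := [Hash])" for k
  define s6 where "s6 k = (s5 k)(RM := [], RR := map Dig ys @ s5 k RR)" for k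
  note defs = s1_def s2_def s3_def s4_def s5_def s6_def
  have 1: "rn B (Push RE0 Hash) s u \<longleftrightarrow> u = s1" for u using s(3) by (simp add: s1_def)
  have 2: "rn B (pad RE0 ;; c) s1 u \<longleftrightarrow> (\<exists>k\<le>B. rn B c (s2 k) u)" for c u
    unfolding rn_Seq rn_pad s2_def by blast
  have 3: "rn B (copy RN RE0 ;; Emp RN ;; c) (s2 k) u \<longleftrightarrow> rn B c (s3 k) u" for c u k
    unfolding s3_def using s(1) B(1) by (intro rn_pour) (simp_all add: defs)
  have 4: "rn B (Push RE0 (Dig False)) (s3 k) u \<longleftrightarrow> u = s4 k" for u k by (simp add: s4_def)
  have 5: "rn B (Push RR Hash) (s4 k) u \<longleftrightarrow> u = s5 k" for u k using s(4) by (simp add: defs)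
  have 6: "rn B (copy RM RR ;; Emp RM ;; c) (s5 k) u \<longleftrightarrow> rn B c (s6 k) u" for c u k
    unfolding s6_def using s(2) B(2) by (intro rn_pour) (simp_all add: defs)
  have E: "s6 k RE0 = Dig False # map Dig (xs @ replicate k False) @ Hash # []"
    "s6 k RR = map Dig ys @ Hash # []" for k
    by (simp_all add: defs)
  have "rn B compare s s' \<longleftrightarrow> (\<exists>k\<le>B. rn B (subtract RE0) (s6 k) s')" for s'
    unfolding compare_def rn_step[OF 1] 2 3 rn_step[OF 4] rn_step[OF 5] 6 ..
  then have "(\<exists>s'. rn B compare s s') \<longleftrightarrow> (\<exists>k\<le>B. \<exists>s'. rn B (subtract RE0) (s6 k) s')" by blast
  also have "\<dots> \<longleftrightarrow> (\<exists>k\<le>B. length xs + k = length ys \<and> val xs \<le> val ys)"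
  proof (intro ex_cong1 conj_cong refl)
    fix k
    show "(\<exists>s'. rn B (subtract RE0) (s6 k) s') \<longleftrightarrow> length xs + k = length ys \<and> val xs \<le> val ys"
      using rn_subtract[of RE0 "s6 k" False "xs @ replicate k False" "[]" ys "[]" B, OF _ _ E B(2)]
      by (simp add: val_append)
  qed
  also have "\<dots> \<longleftrightarrow> length xs \<le> length ys \<and> val xs \<le> val ys"
  proof
    assume *: "length xs \<le> length ys \<and> val xs \<le> val ys"
    then show "\<exists>k\<le>B. length xs + k = length ys \<and> val xs \<le> val ys"
      using B(2) by (intro exI[of _ "length ys - length xs"]) simp
  qed auto
  finally show ?thesis .
qed

lemma rn_out_of_range:
  assumes "length (toks (n # ns)) < B"
  shows "(\<exists>s'. rn B out_of_range (inp (toks (n # ns))) s') \<longleftrightarrow> (\<exists>m\<in>set ns. n \<le> m)"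
proof -
  let ?s = "inp (toks (n # ns))"
  let ?u = "?s(RX := map Dig (toks ns), RN := map Dig (rev (bin n)))"
  have b: "\<forall>m\<in>set (n # ns). length (bin m) \<le> B" using length_toks(2)[of _ "n # ns"] assms by (meson le_trans less_imp_le)
  then have bns: "\<forall>m\<in>set ns. length (bin m) \<le> B" by simp
  have l: "length ns \<le> B" using length_toks(1)[of "n # ns"] assms by simp
  have X: "?s RX = map Dig (toks (n # ns))" by (simp add: inp_def)
  have "rn B (readtok RN) ?s w \<longleftrightarrow> w = ?u" for w
    using readtok_toks[of RN ?s "n # ns" B w, OF _ X b] by (simp add: inp_def)
  note read = rn_step[OF this]
  have uX: "?u RX = map Dig (toks ns)" by simp
  let ?v = "\<lambda>k. ?u(RX := map Dig (toks (drop k ns)))"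
  let ?w = "\<lambda>k m ns'. (?v k)(RX := map Dig (toks ns'), RM := map Dig (rev (bin m)) @ ?v k RM)"
  have st: "rn B (Star skiptok) ?u x \<longleftrightarrow> (\<exists>k\<le>B. k \<le> length ns \<and> x = ?v k)" for x
    unfolding rn.simps(6) skips_toks[of ?u ns B, OF uX bns] ..
  have rd: "rn B (readtok RM) (?v k) x \<longleftrightarrow> (\<exists>m ns'. drop k ns = m # ns' \<and> x = ?w k m ns')" for k x
  proof (rule readtok_toks)
    show "\<forall>m\<in>set (drop k ns). length (bin m) \<le> B" using bns by (meson in_set_dropD)
  qed simp_all
  have cmp: "(\<exists>s'. rn B compare (?w k m ns') s') \<longleftrightarrow> n \<le> m" if "m \<in> set ns" for k m ns'
  proof -
    have "(\<exists>s'. rn B compare (?w k m ns') s') \<longleftrightarrow> length (bin n) \<le> length (bin m) \<and> val (bin n) \<le> val (bin m)"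
      using b that by (intro rn_compare) (simp_all add: inp_def)
    moreover have "length (bin n) \<le> length (bin m)" if "n \<le> m"
    proof -
      have "n < 2 ^ length (bin m)" using val_less[of "bin m"] that by simp
      then obtain ds where "length ds = length (bin m)" "val ds = n" using exists_digits by blast
      then show ?thesis using length_bin_less[of ds n] by simp
    qed
    ultimately show ?thesis by auto
  qed
  have next_token: "(\<exists>s'. rn B (readtok RM ;; compare) (?v k) s') \<longleftrightarrow> (\<exists>m ns'. drop k ns = m # ns' \<and> n \<le> m)" for k
  proof -
    have "(\<exists>s'. rn B (readtok RM ;; compare) (?v k) s') \<longleftrightarrow>
        (\<exists>m ns'. drop k ns = m # ns' \<and> (\<exists>s'. rn B compare (?w k m ns') s'))"
      unfolding rn_Seq rd by blast
    also have "\<dots> \<longleftrightarrow> (\<exists>m ns'. drop k ns = m # ns' \<and> n \<le> m)"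
    proof (intro ex_cong1 conj_cong refl cmp)
      fix m ns' assume "drop k ns = m # ns'"
      then show "m \<in> set ns" by (metis in_set_dropD list.set_intros(1))
    qed
    finally show ?thesis .
  qed
  have "(\<exists>s'. rn B out_of_range ?s s') \<longleftrightarrow>
      (\<exists>k\<le>B. k \<le> length ns \<and> (\<exists>s'. rn B (readtok RM ;; compare) (?v k) s'))"
    unfolding out_of_range_def read rn_Seq[of B "Star _"] st by blast
  also have "\<dots> \<longleftrightarrow> (\<exists>k\<le>B. k \<le> length ns \<and> (\<exists>m ns'. drop k ns = m # ns' \<and> n \<le> m))"
    unfolding next_token ..
  also have "\<dots> \<longleftrightarrow> (\<exists>m\<in>set ns. n \<le> m)"
  proof
    assume "\<exists>m\<in>set ns. n \<le> m"
    then obtain i where i: "i < length ns" "n \<le> ns ! i" by (metis in_set_conv_nth)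
    then have "drop i ns = ns ! i # drop (Suc i) ns" by (simp add: Cons_nth_drop_Suc)
    moreover have "i \<le> B" "i \<le> length ns" using i(1) l by simp_all
    ultimately show "\<exists>k\<le>B. k \<le> length ns \<and> (\<exists>m ns'. drop k ns = m # ns' \<and> n \<le> m)"
      using i(2) by blast
  next
    assume "\<exists>k\<le>B. k \<le> length ns \<and> (\<exists>m ns'. drop k ns = m # ns' \<and> n \<le> m)"
    then obtain k m ns' where "drop k ns = m # ns'" "n \<le> m" by blast
    moreover from this(1) have "m \<in> set ns" by (metis in_set_dropD list.set_intros(1))
    ultimately show "\<exists>m\<in>set ns. n \<le> m" by blast
  qed
  finally show ?thesis .
qed

section \<open>Membership in coNP\<close>

text \<open>\<open>Emp RX\<close> covers the empty word: it is a sequence of tokens, hence not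
  malformed, but has no vertex count.\<close>

definition verifier :: com where
  "verifier = Alt vprog (Alt malformed (Alt (Emp RX) (Alt wrong_length out_of_range)))"

definition tokens :: "nat \<Rightarrow> (nat \<Rightarrow> nat) \<Rightarrow> (nat \<Rightarrow> nat) \<Rightarrow> nat \<Rightarrow> nat \<Rightarrow> nat list" where
  "tokens n s0 s1 o' d = o' # d # concat (map (\<lambda>v. [s0 v, s1 v]) [0..<n])"

lemma toks_tokens: "enc_instance n s0 s1 o' d = toks (n # tokens n s0 s1 o' d)"
proof -
  have "toks (concat (map (\<lambda>v. [s0 v, s1 v]) vs)) = concat (map (\<lambda>v. enc_nat (s0 v) @ enc_nat (s1 v)) vs)" for vs
    by (induction vs) auto
  then show ?thesis by (simp add: enc_instance_def tokens_def)
qed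

lemma length_tokens: "length (tokens n s0 s1 o' d) = 2 * n + 2"
  by (induction n) (auto simp: tokens_def)

lemma tokens_less: "valid_instance n s0 s1 o' d \<Longrightarrow> m \<in> set (tokens n s0 s1 o' d) \<Longrightarrow> m < n"
proof -
  assume valid: "valid_instance n s0 s1 o' d" and "m \<in> set (tokens n s0 s1 o' d)"
  then consider "m = o'" | "m = d" | v where "v < n" "m = s0 v \<or> m = s1 v"
    by (auto simp: tokens_def)
  then show "m < n" by cases (use valid in \<open>auto simp: valid_instance_def\<close>)
qed

text \<open>Any list of even length interleaves two maps, so a token sequence is a valid encoding as
  soon as its length and the range of its entries are right.\<close>

lemma tokens_exist:
  fixes ms :: "nat list"
  assumes "length ms = 2 * n"
  shows "ms = concat (map (\<lambda>v. [ms ! (2 * v), ms ! (2 * v + 1)]) [0..<n])"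
  using assms
proof (induction n arbitrary: ms)
  case (Suc n)
  then obtain ms' a b where ms: "ms = ms' @ [a, b]" "length ms' = 2 * n"
  proof -
    have "length (drop (2 * n) ms) = 2" using Suc.prems by simp
    moreover have "\<exists>a b. zs = [a, b]" if "length zs = 2" for zs :: "nat list"
      using that by (cases zs; cases "tl zs") auto
    ultimately obtain a b where "drop (2 * n) ms = [a, b]" by blast
    then have "ms = take (2 * n) ms @ [a, b]" by (metis append_take_drop_id)
    then show ?thesis using that[of "take (2 * n) ms" a b] Suc.prems by simp
  qed
  let ?f = "\<lambda>v. [ms ! (2 * v), ms ! (2 * v + 1)]"
  have 1: "map ?f [0..<n] = map (\<lambda>v. [ms' ! (2 * v), ms' ! (2 * v + 1)]) [0..<n]"
    using ms by (auto simp: nth_append)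
  have 2: "?f n = [a, b]" using ms by (simp add: nth_append)
  have "concat (map ?f [0..<Suc n]) = concat (map ?f [0..<n]) @ ?f n" by simp
  also have "\<dots> = ms" unfolding 1 2 using Suc.IH[OF ms(2)] ms(1) by simp
  finally show ?case by (rule sym)
qed simp

lemma verifier_sound:
  assumes "rn B verifier (inp x) s'"
  shows "x \<notin> ARRIVAL"
proof
  assume "x \<in> ARRIVAL"
  then obtain n s0 s1 o' d where valid: "valid_instance n s0 s1 o' d" and x: "x = enc_instance n s0 s1 o' d"
    and run: "run_terminates s0 s1 o' d" unfolding ARRIVAL_def by blast
  interpret arrival_run n s0 s1 o' d by unfold_locales (rule valid)
  let ?ns = "tokens n s0 s1 o' d"
  have xt: "x = toks (n # ?ns)" unfolding x by (rule toks_tokens)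
  define B1 where "B1 = B + length x + 1"
  have len: "length (toks (n # ?ns)) < B1" unfolding xt[symmetric] by (simp add: B1_def)
  have mono: "rn B c (inp x) s' \<Longrightarrow> rn B1 c (inp x) s'" for c
    by (erule rn_mono[rotated]) (simp add: B1_def)
  from assms consider "rn B vprog (inp x) s'" | "rn B malformed (inp x) s'" | "inp x RX = []"
    | "rn B wrong_length (inp x) s'" | "rn B out_of_range (inp x) s'"
    unfolding verifier_def rn.simps(3,5) by blast
  then show False
  proof cases
    case 1
    then show False using valid_sound[OF valid] certificate_sound run unfolding x by blast
  next
    case 2
    then show False using malformed_sound unfolding xt by blast
  next
    case 3
    then show False unfolding xt by (simp add: inp_def enc_nat_def)
  next
    case 4
    then show False using mono rn_wrong_length[OF len] length_tokens[of n s0 s1 o' d] unfolding xt by blast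
  next
    case 5
    then have "\<exists>m\<in>set ?ns. n \<le> m" using mono rn_out_of_range[OF len] unfolding xt by blast
    then show False using tokens_less[OF valid] by fastforce
  qed
qed

text \<open>The product dominates the table length \<open>n * (2 * n + 4)\<close> since
  \<open>n \<le> m\<close>; the remaining summands give the slack over the input length required by
  \<open>valid_complete\<close>.\<close>

definition bound :: "nat \<Rightarrow> nat" where
  "bound m = m * (2 * m + 4) + m + 3"

lemma verifier_complete:
  assumes "x \<notin> ARRIVAL"
  shows "\<exists>s'. rn (bound (length x)) verifier (inp x) s'"
proof -
  let ?B = "bound (length x)"
  have B: "length x < ?B" "length x + 3 \<le> ?B" "length x \<le> ?B" by (simp_all add: bound_def)
  consider ns ds q where "x = toks ns @ dbl ds @ q" "bad q" | "x = []" | n ns where "x = toks (n # ns)"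
    using toks_or_bad[of x] by (metis neq_Nil_conv toks_simps(1))
  then show ?thesis
  proof cases
    case 1
    then show ?thesis using malformed_complete[OF _ _ B(3)] unfolding verifier_def rn.simps(5) by blast
  next
    case 2
    then have "rn ?B (Emp RX) (inp x) (inp x)" by (simp add: inp_def)
    then show ?thesis unfolding verifier_def rn.simps(5) by blast
  next
    case (3 n ns)
    have len: "length (toks (n # ns)) < ?B" using B(1) 3 by simp
    show ?thesis
    proof (cases "length ns = 2 * n + 2 \<and> (\<forall>m\<in>set ns. m < n)")
      case False
      then have "(\<exists>s'. rn ?B wrong_length (inp x) s') \<or> (\<exists>s'. rn ?B out_of_range (inp x) s')"
        using rn_wrong_length[OF len] rn_out_of_range[OF len] unfolding 3 by (meson not_le)
      then show ?thesis unfolding verifier_def rn.simps(5) by blast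
    next
      case True
      then obtain o' d ms where ns: "ns = o' # d # ms" and ms: "length ms = 2 * n"
        by (cases ns; cases "tl ns") auto
      define s0 where "s0 v = ms ! (2 * v)" for v
      define s1 where "s1 v = ms ! (2 * v + 1)" for v
      have tok: "ns = tokens n s0 s1 o' d"
        unfolding tokens_def s0_def s1_def ns using tokens_exist[OF ms] by simp
      then have x: "x = enc_instance n s0 s1 o' d" using 3 toks_tokens by simp
      \<comment> \<open>\<open>0 < n\<close> follows from \<open>o' < n\<close>; a word with
        \<open>n = 0\<close> and two tokens behind it is caught by the range check.\<close>
      have valid: "valid_instance n s0 s1 o' d"
        using True ms unfolding valid_instance_def ns s0_def s1_def by (auto simp: nth_mem)
      then interpret arrival_run n s0 s1 o' d by unfold_locales
      have "\<not> run_terminates s0 s1 o' d" using assms valid x unfolding ARRIVAL_def by blast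
      then obtain t where t: "certificate n s0 s1 o' d t" "\<And>v m. t v = Some m \<Longrightarrow> m < 2 ^ n"
        using certificate_complete by blast
      have "n \<le> length x" using length_toks(1)[of "n # ns"] True 3 by simp
      then have "n * (2 * n + 4) \<le> length x * (2 * length x + 4)" by (intro mult_le_mono) simp_all
      then have "n * (2 * n + 4) \<le> ?B" by (simp add: bound_def)
      moreover have "length (enc_instance n s0 s1 o' d) + 3 \<le> ?B" using B(2) x by simp
      ultimately have "\<exists>s'. rn ?B vprog (inp (enc_instance n s0 s1 o' d)) s'"
        using valid_complete[OF valid t(1)] t(2) by blast
      then show ?thesis unfolding x[symmetric] verifier_def rn.simps(5) by blast
    qed
  qed
qed

theorem theorem3:
  shows "in_coNP ARRIVAL"
  unfolding in_coNP_def
proof (rule in_NP_if_program)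
  show "poly_bounded bound"
    unfolding bound_def by (intro poly_bounded_intros)
  show "x \<in> - ARRIVAL" if "rn B verifier (inp x) s'" for x B s'
    using verifier_sound[OF that] by simp
  show "\<exists>s'. rn (bound (length x)) verifier (inp x) s'" if "x \<in> - ARRIVAL" for x
    using verifier_complete that by simp
qed

end
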